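(* Let $X_1,\ldots,X_n$ be i.i.d. real random variables with common density $f$ and let $f_0=\mathbb{I}_{[0,1]}$. Assume that $n$ is larger than $16$ and that $\mathcal{M}=\{(1,D),D\in\mathcal{D}_1\}$ with $\mathcal{D}_1=\{2^J,\ 0\le J\le\log_2(n^2/(\log\log n)^3)\}$. Let $\alpha\in\,]0,1[$ and let $T_\alpha$ be the test statistic defined in the context. Fix some $\beta\in\,]0,1[$. For all $s>0$, $M>0$, $R>0$, there exists a positive constant $C(R,s,\alpha,\beta,M)$ such that if $f$ belongs to the set $\mathcal{H}_s(R)$ with $\|f\|_\infty\le M$, and if $f$ satisfies $$\|f-f_0\|_2^2>C(R,s,\alpha,\beta,M)\left(\frac{\sqrt{\log\log n}}{n}\right)^{4s/(4s+1)},$$ then $$\mathbb{P}_f(T_\alpha\le0)\le\beta.$$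
   Context: Notation: $\|\cdot\|_2$ is the usual norm of $\mathbb{L}_2(\mathbb{R})$ (Lebesgue measure); $\|g\|_\infty=\sup|g|$; $\mathbb{P}_g$ denotes the law of $(X_1,\ldots,X_n)$ when the $X_i$ are i.i.d. with density $g$. The density $f$ belongs to $\mathbb{L}_2(\mathbb{R})$. Hölder class. For $s>0$ and $R>0$, write $s=s_1+s_2$ with $s_1\in\mathbb{N}$ and $s_2\in\,]0,1]$, and $$\mathcal{H}_s(R)=\{f:[0,1]\to\mathbb{R},\ \forall x,y\in[0,1],\ |f^{(s_1)}(x)-f^{(s_1)}(y)|\le R|x-y|^{s_2}\}.$$ A density $f\in\mathcal{H}_s(R)$ is a density on $[0,1]$ (zero outside $[0,1]$). Test statistic. For $D\in\mathbb{N}^*$ and $k\in\mathbb{Z}$, let $I_{D,k}=\sqrt{D}\,\mathbb{I}_{[k/D,(k+1)/D[}$. For $m=(1,D)\in\mathcal{M}$, let $$\hat\theta_m=\frac{1}{n(n-1)}\sum_{k\in\mathbb{Z}}\sum_{i\ne j=1}^n I_{D,k}(X_i)I_{D,k}(X_j),\qquad \hat T_m=\hat\theta_m+\|f_0\|_2^2-\frac2n\sum_{i=1}^n f_0(X_i).$$ For $u\in\,]0,1[$, $t_m(u)$ is the $(1-u)$ quantile of the law of $\hat T_m$ under $\mathbb{P}_{f_0}$, and $$u_\alpha=\sup\left\{u\in\,]0,1[,\ \mathbb{P}_{f_0}\left(\sup_{m\in\mathcal{M}}(\hat T_m-t_m(u))>0\right)\le\alpha\right\},\qquad T_\alpha=\sup_{m\in\mathcal{M}}(\hat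 T_m-t_m(u_\alpha)).$$ The null hypothesis "$f=f_0$" is rejected when $T_\alpha>0$. The constant depends only on the quantities displayed as its arguments (in particular not on $n$ or $f$). *)

theory Defs
  imports "HOL-Probability.Probability"
begin

definition norm2 :: "(real \<Rightarrow> real) \<Rightarrow> real" where
  "norm2 g = sqrt (LINT x|lborel. (g x)\<^sup>2)"

(* Extended-real valued, so that unbounded functions get the value \<infinity>. *)
definition sup_norm :: "(real \<Rightarrow> real) \<Rightarrow> ereal" where
  "sup_norm g = (SUP x. ereal \<bar>g x\<bar>)"

definition prob_density :: "(real \<Rightarrow> real) \<Rightarrow> bool" where
  "prob_density g \<longleftrightarrow> (\<forall>x. 0 \<le> g x) \<and> has_bochner_integral lborel g 1"

(* The functions d 0, ..., d s1 are the successive derivatives of f on [0,1], one-sided at the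
   end points.  Values of f outside [0,1] are irrelevant here. *)
definition holder_class :: "real \<Rightarrow> real \<Rightarrow> (real \<Rightarrow> real) set" where
  "holder_class s R = {f. \<exists>(s1::nat) (s2::real) (d :: nat \<Rightarrow> real \<Rightarrow> real).
     s = real s1 + s2 \<and> 0 < s2 \<and> s2 \<le> 1 \<and>
     (\<forall>x\<in>{0..1}. d 0 x = f x) \<and>
     (\<forall>i<s1. \<forall>x\<in>{0..1}. (d i has_real_derivative d (Suc i) x) (at x within {0..1})) \<and>
     (\<forall>x\<in>{0..1}. \<forall>y\<in>{0..1}. \<bar>d s1 x - d s1 y\<bar> \<le> R * \<bar>x - y\<bar> powr s2)}"

(* Law of an i.i.d. sample (X_1, ..., X_n) with density g. *)
definition sample_law :: "nat \<Rightarrow> (real \<Rightarrow> real) \<Rightarrow> (nat \<Rightarrow> real) measure" where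
  "sample_law n g = (\<Pi>\<^sub>M i\<in>{1..n}. density lborel (\<lambda>x. ennreal (g x)))"

definition bin_fun :: "nat \<Rightarrow> int \<Rightarrow> real \<Rightarrow> real" where
  "bin_fun D k = (\<lambda>x. sqrt (real D) *
     indicator {real_of_int k / real D ..< (real_of_int k + 1) / real D} x)"

definition theta_hat :: "nat \<Rightarrow> nat \<Rightarrow> (nat \<Rightarrow> real) \<Rightarrow> real" where
  "theta_hat n D X = 1 / (real n * (real n - 1)) *
     (\<Sum>\<^sub>\<infinity>k\<in>(UNIV::int set). \<Sum>i\<in>{1..n}. \<Sum>j\<in>{1..n} - {i}. bin_fun D k (X i) * bin_fun D k (X j))"

definition T_hat :: "nat \<Rightarrow> (real \<Rightarrow> real) \<Rightarrow> nat \<Rightarrow> (nat \<Rightarrow> real) \<Rightarrow> real" where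
  "T_hat n f0 D X = theta_hat n D X + (norm2 f0)\<^sup>2 - 2 / real n * (\<Sum>i\<in>{1..n}. f0 (X i))"

(* Generalised inverse of the distribution function.  It is real for 0 < p < 1; with extended
   real values the level p = 0, which is reached below when u_level = 1, yields -\<infinity>. *)
definition quantile :: "real measure \<Rightarrow> real \<Rightarrow> ereal" where
  "quantile \<mu> p = (INF t\<in>{t. p \<le> cdf \<mu> t}. ereal t)"

definition t_crit :: "nat \<Rightarrow> (real \<Rightarrow> real) \<Rightarrow> nat \<Rightarrow> real \<Rightarrow> ereal" where
  "t_crit n f0 D u = quantile (distr (sample_law n f0) borel (T_hat n f0 D)) (1 - u)"

(* A model (1, D) is identified with its dimension D. *)
definition dims :: "nat \<Rightarrow> nat set" where
  "dims n = {2 ^ J |J::nat. real J \<le> log 2 ((real n)\<^sup>2 / (ln (ln (real n))) ^ 3)}"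

definition T_sup :: "nat \<Rightarrow> (real \<Rightarrow> real) \<Rightarrow> nat set \<Rightarrow> real \<Rightarrow> (nat \<Rightarrow> real) \<Rightarrow> ereal" where
  "T_sup n f0 \<D> u X = (SUP D\<in>\<D>. ereal (T_hat n f0 D X) - t_crit n f0 D u)"

definition u_level :: "nat \<Rightarrow> (real \<Rightarrow> real) \<Rightarrow> nat set \<Rightarrow> real \<Rightarrow> real" where
  "u_level n f0 \<D> \<alpha> =
     Sup {u \<in> {0<..<1}. \<P>(X in sample_law n f0. T_sup n f0 \<D> u X > 0) \<le> \<alpha>}"

definition T_test :: "nat \<Rightarrow> (real \<Rightarrow> real) \<Rightarrow> nat set \<Rightarrow> real \<Rightarrow> (nat \<Rightarrow> real) \<Rightarrow> ereal" where
  "T_test n f0 \<D> \<alpha> X = T_sup n f0 \<D> (u_level n f0 \<D> \<alpha>) X"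

end

theory Submission
  imports Defs "HOL-Computational_Algebra.Polynomial" "HOL-Real_Asymp.Real_Asymp"
begin

text \<open>
  The test rejects as soon as one statistic \<open>T_hat n f0 D\<close> exceeds its critical value, so an upper
  bound for the error of the second kind only needs one well chosen dimension \<open>D\<close>. Write
  \<open>L = ln (ln n)\<close> and let \<open>\<Delta>\<close> be the squared norm of the projection of \<open>f - f0\<close> onto the functions
  that are constant on the \<open>D\<close> bins \<open>[k/D, (k+1)/D)\<close>, that is, \<open>D\<close> times the sum of the squared
  integrals of \<open>f - 1\<close> over the bins. Three estimates are combined.

  Null hypothesis. Under the uniform law, \<open>n * (n - 1) * T_hat\<close> is the off-diagonal sum of the kernel
  \<open>D * 1[same bin] - 1\<close>. This kernel is centred and reproducing, so the conditional variance of each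
  martingale increment is, up to the diagonal, a multiple of the current sum; an exponential moment can
  then be bounded by backward induction over the sample (\<open>canonical_exp_moment\<close>). It gives a Gaussian tail
  at the scale \<open>sqrt (D * L) / n\<close>, up to the event that some bin is overcrowded, which is negligible
  when \<open>D\<close> lies between a large multiple of \<open>L\<close> and a power \<open>n powr (2 - \<delta>)\<close>. A union bound shows that
  the level at which each single \<open>D\<close> is tested is at least \<open>\<alpha> / card (dims n)\<close>, where \<open>dims n\<close> has
  only \<open>O(ln n)\<close> members; hence the critical value for the chosen \<open>D\<close> is at most \<open>11 * sqrt (D * L) / (n - 1)\<close>
  (\<open>T_hat_null_upper_tail\<close>, \<open>critical_value_le\<close>).

  Alternative. Under \<open>f\<close> the statistic has mean \<open>\<Delta>\<close> and variance of order
  \<open>D / n\<^sup>2 + \<Delta> / n\<close>, so Chebyshev's inequality shows that it exceeds that critical value with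
  probability at least \<open>1 - \<beta>\<close> once \<open>\<Delta>\<close> is a large multiple of \<open>sqrt (D * L) / n\<close>
  (\<open>T_hat_lower_tail\<close>, \<open>type_two_error\<close>).

  Approximation. For a smoothness \<open>s > 1\<close> a function is in general not within \<open>D powr (- s)\<close> of its piecewise
  constant projection, but its norm is still controlled: on a block of finitely many consecutive bins
  it is within \<open>O (D powr (- s))\<close> of a polynomial, and a polynomial is determined by its averages over
  sufficiently many bins. Hence \<open>(norm2 (f - f0))\<^sup>2 \<le> A * \<Delta> + B * D powr (- 2 * s)\<close>
  (\<open>hoelder_distance_le_binned_energy\<close>).

  The two requirements balance for \<open>D\<close> of order \<open>(n\<^sup>2 / L) powr (1 / (4 * s + 1))\<close>, where both
  \<open>sqrt (D * L) / n\<close> and \<open>D powr (- 2 * s)\<close> are of the order of the separation rate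
  (\<open>rate_identities\<close>). Such a \<open>D\<close> belongs to the collection for all large \<open>n\<close>; for the finitely many
  remaining \<open>n\<close> the constant is taken so large that no admissible \<open>f\<close> is that far from \<open>f0\<close>.
\<close>

section \<open>Off-diagonal sums over an i.i.d. sample\<close>

lemma prob_space_PiM_const: "prob_space M \<Longrightarrow> prob_space (Pi\<^sub>M I (\<lambda>_. M))"
  by (rule prob_space_PiM) simp

lemma product_prob_space_const: "prob_space M \<Longrightarrow> product_prob_space (\<lambda>_. M)"
  by (simp add: product_prob_space_def product_sigma_finite_def product_prob_space_axioms_def prob_space_imp_sigma_finite)

definition off_diag_sum :: "nat \<Rightarrow> ('a \<Rightarrow> 'a \<Rightarrow> real) \<Rightarrow> (nat \<Rightarrow> 'a) \<Rightarrow> real" where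
  "off_diag_sum n h X = (\<Sum>i\<in>{1..n}. \<Sum>j\<in>{1..n} - {i}. h (X i) (X j))"

lemma full_sum_eq_off_diag_sum:
  "(\<Sum>i\<in>{1..n}. \<Sum>j\<in>{1..n}. h (X i) (X j)) = off_diag_sum n h X + (\<Sum>i\<in>{1..n}. h (X i) (X i))"
proof -
  have "(\<Sum>j\<in>{1..n}. h (X i) (X j)) = (\<Sum>j\<in>{1..n} - {i}. h (X i) (X j)) + h (X i) (X i)"
    if "i \<in> {1..n}" for i
    using that by (subst sum.remove[of _ i]) auto
  then have "(\<Sum>i\<in>{1..n}. \<Sum>j\<in>{1..n}. h (X i) (X j))
      = (\<Sum>i\<in>{1..n}. (\<Sum>j\<in>{1..n} - {i}. h (X i) (X j)) + h (X i) (X i))"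
    by (intro sum.cong refl)
  then show ?thesis
    unfolding off_diag_sum_def by (simp add: sum.distrib)
qed

lemma off_diag_sum_Suc:
  assumes sym: "\<And>x y. h x y = h y x"
  shows "off_diag_sum (Suc n) h X = off_diag_sum n h X + 2 * (\<Sum>i\<in>{1..n}. h (X i) (X (Suc n)))"
proof -
  have "(\<Sum>i\<in>{1..n}. h (X (Suc n)) (X i)) = (\<Sum>i\<in>{1..n}. h (X i) (X (Suc n)))"
    by (subst sym) simp
  then show ?thesis
    using full_sum_eq_off_diag_sum[of h X "Suc n"] full_sum_eq_off_diag_sum[of h X n]
    by (simp add: sum.distrib)
qed

lemma off_diag_sum_upd [simp]:
  "off_diag_sum n h (X(Suc n := y)) = off_diag_sum n h X"
  unfolding off_diag_sum_def by (intro sum.cong refl) auto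

lemma measurable_kernel_component:
  assumes "case_prod h \<in> borel_measurable (M \<Otimes>\<^sub>M M)" "i \<in> I" "j \<in> I"
  shows "(\<lambda>X. h (X i) (X j)) \<in> borel_measurable (Pi\<^sub>M I (\<lambda>_. M))"
  using measurable_compose[OF measurable_Pair[OF measurable_component_singleton[OF assms(2)]
    measurable_component_singleton[OF assms(3)]] assms(1)] by simp

lemma measurable_off_diag_sum:
  assumes "case_prod h \<in> borel_measurable (M \<Otimes>\<^sub>M M)"
  shows "off_diag_sum n h \<in> borel_measurable (Pi\<^sub>M {1..n} (\<lambda>_. M))"
proof -
  have "(\<lambda>X. \<Sum>i\<in>{1..n}. \<Sum>j\<in>{1..n} - {i}. h (X i) (X j)) \<in> borel_measurable (Pi\<^sub>M {1..n} (\<lambda>_. M))"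
    by (intro borel_measurable_sum measurable_kernel_component[OF assms]) auto
  then show ?thesis by (simp add: off_diag_sum_def[abs_def])
qed

section \<open>Exponential tails of canonical U-statistics\<close>

text \<open>
  The right-hand side is positive for every \<open>z\<close>. After truncation of the exponential at \<open>z \<le> 1\<close> the
  expectation of the right-hand side can therefore still be taken over the whole space, and no
  centring is lost.
\<close>
lemma truncated_exp_le: "exp z * of_bool (z \<le> 1) \<le> 1 + z + z\<^sup>2" for z :: real
proof (cases "0 \<le> z")
  case True
  then show ?thesis using exp_bound[of z] by auto
next
  case False
  have "1 - z > 0" "exp (- z) \<ge> 1 - z" using False exp_ge_add_one_self[of "-z"] by auto
  then have "exp z \<le> 1 / (1 - z)"
    by (simp add: exp_minus field_simps)
  also have "\<dots> \<le> 1 + z + z\<^sup>2"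
  proof -
    have "(1 - z) * (1 + z + z\<^sup>2) = 1 - z * z\<^sup>2" by (simp add: algebra_simps power2_eq_square)
    also have "\<dots> \<ge> 1" using False by (simp add: mult_nonpos_nonneg)
    finally show ?thesis using \<open>1 - z > 0\<close> by (simp add: field_simps)
  qed
  finally show ?thesis using False by auto
qed

lemma truncated_exp_integral_le:
  assumes "prob_space M" and [measurable]: "Y \<in> borel_measurable M"
    and bdd: "\<And>x. \<bar>Y x\<bar> \<le> K" and mean: "(\<integral>x. Y x \<partial>M) = 0"
  shows "(\<integral>\<^sup>+x. ennreal (exp (Y x) * of_bool (Y x \<le> 1)) \<partial>M) \<le> ennreal (exp (\<integral>x. (Y x)\<^sup>2 \<partial>M))"
proof -
  interpret prob_space M by fact
  have iY: "integrable M Y"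
    by (rule integrable_const_bound[of _ K]) (use bdd in auto)
  have iY2: "integrable M (\<lambda>x. (Y x)\<^sup>2)"
  proof (rule integrable_const_bound[of _ "K\<^sup>2"])
    show "AE x in M. norm ((Y x)\<^sup>2) \<le> K\<^sup>2"
      using power_mono[OF bdd abs_ge_zero, where n=2] by (auto simp: power2_abs)
  qed simp
  have "(\<integral>\<^sup>+x. ennreal (exp (Y x) * of_bool (Y x \<le> 1)) \<partial>M) \<le> (\<integral>\<^sup>+x. ennreal (1 + Y x + (Y x)\<^sup>2) \<partial>M)"
    by (intro nn_integral_mono ennreal_leI truncated_exp_le)
  also have "\<dots> = ennreal (\<integral>x. 1 + Y x + (Y x)\<^sup>2 \<partial>M)"
  proof (rule nn_integral_eq_integral)
    have "0 \<le> 1 + z + z\<^sup>2" for z :: real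
      using zero_le_power2[of "z + 1/2"] by (simp add: power2_eq_square algebra_simps)
    then show "AE x in M. 0 \<le> 1 + Y x + (Y x)\<^sup>2" by simp
  qed (use iY iY2 in auto)
  also have "(\<integral>x. 1 + Y x + (Y x)\<^sup>2 \<partial>M) = 1 + (\<integral>x. (Y x)\<^sup>2 \<partial>M)"
    using iY iY2 mean by (simp add: prob_space)
  also have "\<dots> \<le> exp (\<integral>x. (Y x)\<^sup>2 \<partial>M)"
    by (rule exp_ge_add_one_self)
  finally show ?thesis by (simp add: ennreal_leI)
qed

text \<open>
  The truncation is one-sided: a large negative increment does no harm to an exponential moment.
\<close>
definition increments_le :: "nat \<Rightarrow> ('a \<Rightarrow> 'a \<Rightarrow> real) \<Rightarrow> real \<Rightarrow> (nat \<Rightarrow> 'a) \<Rightarrow> bool" where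
  "increments_le n h b X \<longleftrightarrow> (\<forall>j\<in>{1..n}. (\<Sum>i\<in>{1..<j}. h (X i) (X j)) \<le> b)"

lemma increments_le_Suc_upd:
  "increments_le (Suc n) h b (X(Suc n := y)) \<longleftrightarrow>
     increments_le n h b X \<and> (\<Sum>i\<in>{1..n}. h (X i) y) \<le> b"
proof -
  have *: "{1..<Suc n} = {1..n}" by auto
  have 1: "(\<Sum>i\<in>{1..<j}. h ((X(Suc n := y)) i) ((X(Suc n := y)) j)) = (\<Sum>i\<in>{1..<j}. h (X i) (X j))"
    if "j \<in> {1..n}" for j
    using that by (intro sum.cong refl) auto
  have 2: "(\<Sum>i\<in>{1..<Suc n}. h ((X(Suc n := y)) i) ((X(Suc n := y)) (Suc n))) = (\<Sum>i\<in>{1..n}. h (X i) y)"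
    unfolding * by (intro sum.cong refl) auto
  have "{1..Suc n} = insert (Suc n) {1..n}" by auto
  then show ?thesis unfolding increments_le_def using 1 2 by (auto simp del: fun_upd_apply)
qed

lemma measurable_increments_le:
  assumes "case_prod h \<in> borel_measurable (M \<Otimes>\<^sub>M M)"
  shows "Measurable.pred (Pi\<^sub>M {1..n} (\<lambda>_. M)) (increments_le n h b)"
proof -
  have "(\<lambda>X. \<Sum>i\<in>{1..<j}. h (X i) (X j)) \<in> borel_measurable (Pi\<^sub>M {1..n} (\<lambda>_. M))" if "j \<in> {1..n}" for j
    using that by (intro borel_measurable_sum measurable_kernel_component[OF assms]) auto
  then show ?thesis
    unfolding increments_le_def[abs_def] by (intro pred_intros_finite(3)) (auto intro: borel_measurable_pred_less)
qed

text \<open>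
  Adding the observation \<open>m + 1\<close> increases the sum by \<open>Y = 2 * (\<Sum>i\<le>m. h (X i) (X (m + 1)))\<close>. Given the
  past, \<open>Y\<close> has mean zero, and by the reproducing property its conditional second moment is
  \<open>4 * off_diag_sum m h X\<close> plus four times the diagonal terms. Integrating out the last observation thus
  replaces the parameter \<open>\<mu>\<close> by \<open>\<mu> + 4 * \<mu>\<^sup>2\<close> and costs a factor \<open>exp (4 * \<mu>\<^sup>2 * m * d)\<close>. The hypothesis
  \<open>16 * l * n \<le> 1\<close> keeps the parameter below \<open>2 * l\<close> during all \<open>n\<close> steps; the upper bound on \<open>\<mu>\<close> in the
  statement is the one that is stable under this recursion. The truncation level \<open>1 / (4 * l)\<close> makes
  \<open>\<mu> * Y \<le> 1\<close> for every such \<open>\<mu>\<close>.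
\<close>
lemma canonical_exp_moment:
  fixes M :: "'a measure" and h :: "'a \<Rightarrow> 'a \<Rightarrow> real"
  assumes M: "prob_space M" and meas: "case_prod h \<in> borel_measurable (M \<Otimes>\<^sub>M M)"
    and sym: "\<And>x y. h x y = h y x" and bdd: "\<And>x y. \<bar>h x y\<bar> \<le> K"
    and centred: "\<And>x. x \<in> space M \<Longrightarrow> (\<integral>y. h x y \<partial>M) = 0"
    and repr: "\<And>x x'. x \<in> space M \<Longrightarrow> x' \<in> space M \<Longrightarrow> (\<integral>y. h x y * h x' y \<partial>M) = h x x'"
    and diag: "\<And>x. x \<in> space M \<Longrightarrow> h x x \<le> d" and d: "0 \<le> d"
    and l: "0 < l" "16 * l * real n \<le> 1"
  shows "m \<le> n \<Longrightarrow> 0 \<le> \<mu> \<Longrightarrow> \<mu> \<le> l * (1 + 16 * l * (real n - real m)) \<Longrightarrow>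
    (\<integral>\<^sup>+X. ennreal (exp (\<mu> * off_diag_sum m h X) * of_bool (increments_le m h (1 / (4 * l)) X))
        \<partial>Pi\<^sub>M {1..m} (\<lambda>_. M)) \<le> ennreal (exp (8 * l\<^sup>2 * d * (real m)\<^sup>2))"
proof (induction m arbitrary: \<mu>)
  case 0
  interpret product_prob_space "\<lambda>_. M" "{}"
    by (rule product_prob_space_const[OF M])
  show ?case by (simp add: PiM_empty off_diag_sum_def nn_integral_count_space_finite increments_le_def)
next
  case (Suc m)
  interpret M: prob_space M by fact
  interpret P: product_prob_space "\<lambda>_. M" "{1..m}"
    by (rule product_prob_space_const[OF M])
  let ?b = "1 / (4 * l)"
  let ?P = "Pi\<^sub>M {1..m} (\<lambda>_. M)"
  define F where "F k \<mu> X = exp (\<mu> * off_diag_sum k h X) * of_bool (increments_le k h ?b X)" for k \<mu> X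
  have F_meas [measurable]: "F k \<mu> \<in> borel_measurable (Pi\<^sub>M {1..k} (\<lambda>_. M))" for k \<mu>
    using measurable_off_diag_sum[OF meas, of k] measurable_increments_le[OF meas, of k ?b]
    unfolding F_def[abs_def] by measurable
  have mu2: "\<mu> \<le> 2 * l"
  proof -
    have "16 * l * (real n - real (Suc m)) \<le> 16 * l * real n" using l by (intro mult_left_mono) auto
    then have "1 + 16 * l * (real n - real (Suc m)) \<le> 2" using l by linarith
    then have "l * (1 + 16 * l * (real n - real (Suc m))) \<le> l * 2" using l by (intro mult_left_mono) auto
    then show ?thesis using Suc.prems by linarith
  qed
  have mu4: "4 * \<mu>\<^sup>2 \<le> 16 * l\<^sup>2"
    using power_mono[OF mu2 Suc.prems(2), of 2] by (simp add: power_mult_distrib)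
  have step: "(\<integral>\<^sup>+y. ennreal (F (Suc m) \<mu> (X(Suc m := y))) \<partial>M) \<le>
      ennreal (exp (16 * l\<^sup>2 * d * real m)) * ennreal (F m (\<mu> + 4 * \<mu>\<^sup>2) X)" if X: "X \<in> space ?P" for X
  proof -
    have Xi: "X i \<in> space M" if "i \<in> {1..m}" for i
      using X that by (auto simp: space_PiM)
    define Y where "Y y = 2 * \<mu> * (\<Sum>i\<in>{1..m}. h (X i) y)" for y
    have hm [measurable]: "h (X i) \<in> borel_measurable M" if "i \<in> {1..m}" for i
      using measurable_compose[OF measurable_Pair1'[OF Xi[OF that], of M] meas] by simp
    have hint: "integrable M (h (X i))" if "i \<in> {1..m}" for i
      by (rule M.integrable_const_bound[of _ K]) (use bdd hm that in auto)
    have hint2: "integrable M (\<lambda>y. h (X i) y * h (X j) y)" if "i \<in> {1..m}" "j \<in> {1..m}" for i j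
    proof (rule M.integrable_const_bound[of _ "K * K"])
      have "K \<ge> 0" using bdd[of undefined undefined] by linarith
      then show "AE y in M. norm (h (X i) y * h (X j) y) \<le> K * K"
        using bdd by (auto simp: abs_mult intro!: mult_mono)
    qed (use hm that in measurable)
    have Ym [measurable]: "Y \<in> borel_measurable M"
      unfolding Y_def using hm by measurable
    have Yb: "\<bar>Y y\<bar> \<le> 2 * \<mu> * (\<Sum>i\<in>{1..m}. K)" for y
    proof -
      have "\<bar>\<Sum>i\<in>{1..m}. h (X i) y\<bar> \<le> (\<Sum>i\<in>{1..m}. K)"
        by (rule order_trans[OF sum_abs]) (intro sum_mono bdd)
      then show ?thesis unfolding Y_def using Suc.prems(2)
        by (simp add: abs_mult mult_left_mono)
    qed
    have Y0: "(\<integral>y. Y y \<partial>M) = 0"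
      unfolding Y_def using hint centred[OF Xi] by (simp add: Bochner_Integration.integral_sum)
    have "(\<integral>y. (Y y)\<^sup>2 \<partial>M) = 4 * \<mu>\<^sup>2 * (\<integral>y. (\<Sum>i\<in>{1..m}. \<Sum>j\<in>{1..m}. h (X i) y * h (X j) y) \<partial>M)"
      by (subst Bochner_Integration.integral_mult_right_zero[symmetric])
        (auto simp: Y_def power2_eq_square sum_product sum_distrib_left mult_ac intro!: Bochner_Integration.integral_cong)
    also have "(\<integral>y. (\<Sum>i\<in>{1..m}. \<Sum>j\<in>{1..m}. h (X i) y * h (X j) y) \<partial>M)
        = (\<Sum>i\<in>{1..m}. \<integral>y. (\<Sum>j\<in>{1..m}. h (X i) y * h (X j) y) \<partial>M)"
      by (rule Bochner_Integration.integral_sum) (intro Bochner_Integration.integrable_sum hint2)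
    also have "\<dots> = (\<Sum>i\<in>{1..m}. \<Sum>j\<in>{1..m}. \<integral>y. h (X i) y * h (X j) y \<partial>M)"
      by (intro sum.cong refl Bochner_Integration.integral_sum hint2)
    also have "\<dots> = (\<Sum>i\<in>{1..m}. \<Sum>j\<in>{1..m}. h (X i) (X j))"
      by (intro sum.cong refl repr Xi)
    also have "\<dots> = off_diag_sum m h X + (\<Sum>i\<in>{1..m}. h (X i) (X i))"
      by (rule full_sum_eq_off_diag_sum)
    also have "4 * \<mu>\<^sup>2 * \<dots> \<le> 4 * \<mu>\<^sup>2 * off_diag_sum m h X + 16 * l\<^sup>2 * d * real m"
    proof -
      have "(\<Sum>i\<in>{1..m}. h (X i) (X i)) \<le> real m * d"
        using sum_mono[of "{1..m}" "\<lambda>i. h (X i) (X i)" "\<lambda>_. d"] diag[OF Xi] by simp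
      then have "4 * \<mu>\<^sup>2 * (\<Sum>i\<in>{1..m}. h (X i) (X i)) \<le> 16 * l\<^sup>2 * (real m * d)"
        using mu4 d by (meson mult_left_mono mult_mono mult_nonneg_nonneg mult_right_mono of_nat_0_le_iff order_trans zero_le_power2 zero_le_numeral)
      then show ?thesis by (simp add: algebra_simps)
    qed
    finally have Y2: "(\<integral>y. (Y y)\<^sup>2 \<partial>M) \<le> 4 * \<mu>\<^sup>2 * off_diag_sum m h X + 16 * l\<^sup>2 * d * real m" .
    have "(\<integral>\<^sup>+y. ennreal (F (Suc m) \<mu> (X(Suc m := y))) \<partial>M)
        \<le> (\<integral>\<^sup>+y. ennreal (F m \<mu> X) * ennreal (exp (Y y) * of_bool (Y y \<le> 1)) \<partial>M)"
    proof (rule nn_integral_mono)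
      fix y
      have "Y y \<le> 1" if le: "(\<Sum>i\<in>{1..m}. h (X i) y) \<le> ?b"
      proof (cases "(\<Sum>i\<in>{1..m}. h (X i) y) \<le> 0")
        case True
        then have "Y y \<le> 0" unfolding Y_def using Suc.prems(2) by (simp add: mult_nonneg_nonpos)
        then show ?thesis by simp
      next
        case False
        then have "Y y \<le> 2 * (2 * l) * ?b" unfolding Y_def using Suc.prems(2) mu2 le l
          by (intro mult_mono) auto
        then show ?thesis using l by simp
      qed
      moreover have "exp (\<mu> * off_diag_sum (Suc m) h (X(Suc m := y))) = exp (\<mu> * off_diag_sum m h X) * exp (Y y)"
        unfolding off_diag_sum_Suc[of h, OF sym] Y_def by (simp add: exp_add[symmetric] algebra_simps)
      ultimately have "F (Suc m) \<mu> (X(Suc m := y)) \<le> F m \<mu> X * (exp (Y y) * of_bool (Y y \<le> 1))"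
        unfolding F_def increments_le_Suc_upd by auto
      then show "ennreal (F (Suc m) \<mu> (X(Suc m := y))) \<le> ennreal (F m \<mu> X) * ennreal (exp (Y y) * of_bool (Y y \<le> 1))"
        by (subst ennreal_mult[symmetric]) (auto simp: F_def intro!: ennreal_leI)
    qed
    also have "\<dots> = ennreal (F m \<mu> X) * (\<integral>\<^sup>+y. ennreal (exp (Y y) * of_bool (Y y \<le> 1)) \<partial>M)"
      by (rule nn_integral_cmult) measurable
    also have "\<dots> \<le> ennreal (F m \<mu> X) * ennreal (exp (\<integral>y. (Y y)\<^sup>2 \<partial>M))"
      by (intro mult_left_mono truncated_exp_integral_le[OF M Ym Yb Y0]) auto
    also have "\<dots> \<le> ennreal (F m \<mu> X) * ennreal (exp (4 * \<mu>\<^sup>2 * off_diag_sum m h X + 16 * l\<^sup>2 * d * real m))"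
      using Y2 by (intro mult_left_mono ennreal_leI) auto
    also have "\<dots> = ennreal (exp (16 * l\<^sup>2 * d * real m)) * ennreal (F m (\<mu> + 4 * \<mu>\<^sup>2) X)"
      by (subst (1 2) ennreal_mult[symmetric]) (auto simp: F_def exp_add ring_distribs)
    finally show ?thesis .
  qed
  have ins: "{1..Suc m} = insert (Suc m) {1..m}" by auto
  have "(\<integral>\<^sup>+X. ennreal (F (Suc m) \<mu> X) \<partial>Pi\<^sub>M {1..Suc m} (\<lambda>_. M))
      = (\<integral>\<^sup>+X. \<integral>\<^sup>+y. ennreal (F (Suc m) \<mu> (X(Suc m := y))) \<partial>M \<partial>?P)"
    using F_meas[of "Suc m" \<mu>] unfolding ins by (intro P.product_nn_integral_insert) auto
  also have "\<dots> \<le> (\<integral>\<^sup>+X. ennreal (exp (16 * l\<^sup>2 * d * real m)) * ennreal (F m (\<mu> + 4 * \<mu>\<^sup>2) X) \<partial>?P)"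
    by (intro nn_integral_mono step)
  also have "\<dots> = ennreal (exp (16 * l\<^sup>2 * d * real m)) * (\<integral>\<^sup>+X. ennreal (F m (\<mu> + 4 * \<mu>\<^sup>2) X) \<partial>?P)"
    by (rule nn_integral_cmult) measurable
  also have "\<dots> \<le> ennreal (exp (16 * l\<^sup>2 * d * real m)) * ennreal (exp (8 * l\<^sup>2 * d * (real m)\<^sup>2))"
  proof (rule mult_left_mono)
    have "\<mu> + 4 * \<mu>\<^sup>2 \<le> l * (1 + 16 * l * (real n - real (Suc m))) + 16 * l\<^sup>2"
      using mu4 Suc.prems by linarith
    also have "\<dots> = l * (1 + 16 * l * (real n - real m))"
      by (simp add: algebra_simps power2_eq_square)
    finally show "(\<integral>\<^sup>+X. ennreal (F m (\<mu> + 4 * \<mu>\<^sup>2) X) \<partial>?P) \<le> ennreal (exp (8 * l\<^sup>2 * d * (real m)\<^sup>2))"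
      unfolding F_def using Suc.prems by (intro Suc.IH) auto
  qed simp
  also have "\<dots> \<le> ennreal (exp (8 * l\<^sup>2 * d * (real (Suc m))\<^sup>2))"
  proof -
    have "0 \<le> l\<^sup>2 * d" using d by simp
    then show ?thesis
      by (subst ennreal_mult[symmetric]) (auto simp: exp_add[symmetric] power2_eq_square algebra_simps intro!: ennreal_leI)
  qed
  finally show ?case unfolding F_def .
qed

lemma exp_Markov:
  assumes "prob_space N" and [measurable]: "Z \<in> borel_measurable N" "Measurable.pred N G"
    and mom: "(\<integral>\<^sup>+x. ennreal (exp (l * Z x) * of_bool (G x)) \<partial>N) \<le> ennreal c"
    and "0 \<le> l" "0 \<le> c"
  shows "measure N {x \<in> space N. t < Z x \<and> G x} \<le> exp (- l * t) * c"
proof -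
  interpret prob_space N by fact
  let ?A = "{x \<in> space N. t < Z x \<and> G x}"
  have "emeasure N ?A = (\<integral>\<^sup>+x. indicator ?A x \<partial>N)"
    by (rule nn_integral_indicator[symmetric]) measurable
  also have "\<dots> \<le> (\<integral>\<^sup>+x. ennreal (exp (- l * t)) * ennreal (exp (l * Z x) * of_bool (G x)) \<partial>N)"
  proof (rule nn_integral_mono)
    fix x
    have "1 \<le> exp (- l * t) * exp (l * Z x)" if "t < Z x"
    proof -
      have "l * t \<le> l * Z x" using that \<open>0 \<le> l\<close> by (intro mult_left_mono) auto
      then have "exp 0 \<le> exp (l * Z x - l * t)" by simp
      then show ?thesis by (simp add: exp_add[symmetric])
    qed
    then show "indicator ?A x \<le> ennreal (exp (- l * t)) * ennreal (exp (l * Z x) * of_bool (G x))"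
      by (subst ennreal_mult[symmetric]) (auto simp: indicator_def)
  qed
  also have "\<dots> = ennreal (exp (- l * t)) * (\<integral>\<^sup>+x. ennreal (exp (l * Z x) * of_bool (G x)) \<partial>N)"
    by (rule nn_integral_cmult) measurable
  also have "\<dots> \<le> ennreal (exp (- l * t)) * ennreal c"
    by (intro mult_left_mono mom) simp
  also have "\<dots> = ennreal (exp (- l * t) * c)"
    using \<open>0 \<le> c\<close> by (simp add: ennreal_mult)
  finally show ?thesis using \<open>0 \<le> c\<close>
    by (simp add: emeasure_eq_measure)
qed

text \<open>
  Given the value \<open>y\<close> of the observation \<open>j\<close>, the terms \<open>\<phi> (X i) y\<close> are independent, so the exponential
  moment of their sum factorises.
\<close>
lemma kernel_sum_tail:
  fixes M :: "'a measure" and \<phi> :: "'a \<Rightarrow> 'a \<Rightarrow> real"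
  assumes M: "prob_space M" and meas [measurable]: "case_prod \<phi> \<in> borel_measurable (M \<Otimes>\<^sub>M M)"
    and mom: "\<And>y. y \<in> space M \<Longrightarrow> (\<integral>\<^sup>+x. ennreal (exp (\<phi> x y)) \<partial>M) \<le> ennreal (exp a)"
    and "0 \<le> a" and j: "j \<in> {1..n}"
  shows "measure (Pi\<^sub>M {1..n} (\<lambda>_. M)) {X \<in> space (Pi\<^sub>M {1..n} (\<lambda>_. M)). b < (\<Sum>i\<in>{1..<j}. \<phi> (X i) (X j))}
    \<le> exp (real n * a - b)"
proof -
  interpret M: prob_space M by fact
  interpret P: product_prob_space "\<lambda>_. M" "{1..n}"
    by (rule product_prob_space_const[OF M])
  let ?I = "{1..n} - {j}"
  let ?S = "\<lambda>X. \<Sum>i\<in>{1..<j}. \<phi> (X i) (X j)"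
  have S_meas [measurable]: "?S \<in> borel_measurable (Pi\<^sub>M {1..n} (\<lambda>_. M))"
    using j by (intro borel_measurable_sum measurable_kernel_component[OF meas]) auto
  have "(\<integral>\<^sup>+X. ennreal (exp (1 * ?S X) * of_bool True) \<partial>Pi\<^sub>M {1..n} (\<lambda>_. M)) \<le> ennreal (exp (real n * a))"
  proof -
    have ins: "{1..n} = insert j ?I" using j by auto
    have "(\<integral>\<^sup>+X. ennreal (exp (1 * ?S X) * of_bool True) \<partial>Pi\<^sub>M {1..n} (\<lambda>_. M))
      = (\<integral>\<^sup>+X. ennreal (exp (?S X)) \<partial>Pi\<^sub>M (insert j ?I) (\<lambda>_. M))"
      using ins by simp
    also have "\<dots> = (\<integral>\<^sup>+y. \<integral>\<^sup>+X. ennreal (exp (?S (X(j := y)))) \<partial>Pi\<^sub>M ?I (\<lambda>_. M) \<partial>M)"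
      using S_meas ins by (intro P.product_nn_integral_insert_rev) auto
    also have "\<dots> \<le> (\<integral>\<^sup>+y. ennreal (exp (real n * a)) \<partial>M)"
    proof (rule nn_integral_mono)
      fix y assume y: "y \<in> space M"
      have m1 [measurable]: "(\<lambda>x. \<phi> x y) \<in> borel_measurable M"
        using measurable_compose[OF measurable_Pair2'[OF y, of M] meas] by simp
      let ?g = "\<lambda>i x. if i < j then ennreal (exp (\<phi> x y)) else 1"
      have "ennreal (exp (?S (X(j := y)))) = (\<Prod>i\<in>?I. ?g i (X i))" for X
      proof -
        have "?S (X(j := y)) = (\<Sum>i\<in>{1..<j}. \<phi> (X i) y)" by (intro sum.cong refl) auto
        then have "ennreal (exp (?S (X(j := y)))) = (\<Prod>i\<in>{1..<j}. ennreal (exp (\<phi> (X i) y)))"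
          by (simp add: exp_sum prod_ennreal)
        also have "\<dots> = (\<Prod>i\<in>?I. ?g i (X i))"
          using j by (intro prod.mono_neutral_cong_left) auto
        finally show ?thesis .
      qed
      then have "(\<integral>\<^sup>+X. ennreal (exp (?S (X(j := y)))) \<partial>Pi\<^sub>M ?I (\<lambda>_. M)) = (\<Prod>i\<in>?I. integral\<^sup>N M (?g i))"
        by (subst P.product_nn_integral_prod[of ?I ?g, symmetric]) auto
      also have "\<dots> \<le> (\<Prod>i\<in>?I. ennreal (exp a))"
      proof (rule prod_mono_ennreal)
        show "integral\<^sup>N M (?g i) \<le> ennreal (exp a)" for i
          using mom[OF y] \<open>0 \<le> a\<close> ennreal_leI[of 1 "exp a"]
          by (cases "i < j") (auto simp: M.emeasure_space_1)
      qed
      also have "\<dots> = ennreal (exp (real (card ?I) * a))"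
        by (simp add: ennreal_power exp_of_nat_mult)
      also have "\<dots> \<le> ennreal (exp (real n * a))"
        using \<open>0 \<le> a\<close> card_mono[of "{1..n}" ?I] by (intro ennreal_leI) (auto intro!: mult_right_mono)
      finally show "(\<integral>\<^sup>+X. ennreal (exp (?S (X(j := y)))) \<partial>Pi\<^sub>M ?I (\<lambda>_. M)) \<le> ennreal (exp (real n * a))" .
    qed
    also have "\<dots> = ennreal (exp (real n * a))" by (simp add: M.emeasure_space_1)
    finally show ?thesis .
  qed
  from exp_Markov[OF P.prob_space_axioms S_meas _ this, of b] show ?thesis
    by (simp add: exp_diff exp_minus field_simps)
qed

text \<open>
  Markov's inequality for the truncated exponential moment, plus a union bound for the event that
  some increment is too large. The latter is controlled through a majorant \<open>d * \<phi>\<close> of the kernel: for a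
  histogram kernel, \<open>\<phi>\<close> indicates that two observations share a bin.
\<close>
lemma canonical_U_statistic_tail:
  fixes M :: "'a measure" and h \<phi> :: "'a \<Rightarrow> 'a \<Rightarrow> real"
  assumes M: "prob_space M" and meas: "case_prod h \<in> borel_measurable (M \<Otimes>\<^sub>M M)"
    and sym: "\<And>x y. h x y = h y x" and bdd: "\<And>x y. \<bar>h x y\<bar> \<le> K"
    and centred: "\<And>x. x \<in> space M \<Longrightarrow> (\<integral>y. h x y \<partial>M) = 0"
    and repr: "\<And>x x'. x \<in> space M \<Longrightarrow> x' \<in> space M \<Longrightarrow> (\<integral>y. h x y * h x' y \<partial>M) = h x x'"
    and diag: "\<And>x. x \<in> space M \<Longrightarrow> h x x \<le> d" and d: "0 < d"
    and measp: "case_prod \<phi> \<in> borel_measurable (M \<Otimes>\<^sub>M M)"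
    and dom: "\<And>x y. h x y \<le> d * \<phi> x y"
    and mom: "\<And>y. y \<in> space M \<Longrightarrow> (\<integral>\<^sup>+x. ennreal (exp (\<phi> x y)) \<partial>M) \<le> ennreal (exp a)" and a: "0 \<le> a"
    and l: "0 < l" "16 * l * real n \<le> 1"
  shows "measure (Pi\<^sub>M {1..n} (\<lambda>_. M)) {X \<in> space (Pi\<^sub>M {1..n} (\<lambda>_. M)). t < off_diag_sum n h X}
    \<le> exp (8 * l\<^sup>2 * d * (real n)\<^sup>2 - l * t) + real n * exp (real n * a - 1 / (4 * l * d))"
proof -
  interpret P: product_prob_space "\<lambda>_. M" "{1..n}"
    by (rule product_prob_space_const[OF M])
  let ?P = "Pi\<^sub>M {1..n} (\<lambda>_. M)"
  let ?G = "increments_le n h (1 / (4 * l))"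
  let ?A = "{X \<in> space ?P. t < off_diag_sum n h X \<and> ?G X}"
  let ?B = "\<lambda>j. {X \<in> space ?P. 1 / (4 * l * d) < (\<Sum>i\<in>{1..<j}. \<phi> (X i) (X j))}"
  note [measurable] = measurable_off_diag_sum[OF meas, of n] measurable_increments_le[OF meas, of n "1 / (4 * l)"]
  have A: "measure ?P ?A \<le> exp (- l * t) * exp (8 * l\<^sup>2 * d * (real n)\<^sup>2)"
  proof (rule exp_Markov[OF P.prob_space_axioms])
    show "(\<integral>\<^sup>+X. ennreal (exp (l * off_diag_sum n h X) * of_bool (?G X)) \<partial>?P)
        \<le> ennreal (exp (8 * l\<^sup>2 * d * (real n)\<^sup>2))"
      using l d by (intro canonical_exp_moment[OF M meas sym bdd centred repr diag, where n = n and l = l]) auto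
  qed (use l measurable_off_diag_sum[OF meas] measurable_increments_le[OF meas] in auto)
  have B_sets: "?B j \<in> sets ?P" if "j \<in> {1..n}" for j
  proof -
    have [measurable]: "(\<lambda>X. \<Sum>i\<in>{1..<j}. \<phi> (X i) (X j)) \<in> borel_measurable ?P"
      using that by (intro borel_measurable_sum measurable_kernel_component[OF measp]) auto
    show ?thesis by measurable
  qed
  have "{X \<in> space ?P. t < off_diag_sum n h X} \<subseteq> ?A \<union> (\<Union>j\<in>{1..n}. ?B j)"
  proof safe
    fix X assume X: "X \<in> space ?P" "t < off_diag_sum n h X" "X \<notin> (\<Union>j\<in>{1..n}. ?B j)"
    show "?G X" unfolding increments_le_def
    proof
      fix j assume "j \<in> {1..n}"
      then have "(\<Sum>i\<in>{1..<j}. \<phi> (X i) (X j)) \<le> 1 / (4 * l * d)" using X by (auto simp: not_less)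
      then have "d * (\<Sum>i\<in>{1..<j}. \<phi> (X i) (X j)) \<le> d * (1 / (4 * l * d))" using d by (intro mult_left_mono) auto
      moreover have "(\<Sum>i\<in>{1..<j}. h (X i) (X j)) \<le> d * (\<Sum>i\<in>{1..<j}. \<phi> (X i) (X j))"
        unfolding sum_distrib_left by (intro sum_mono dom)
      ultimately show "(\<Sum>i\<in>{1..<j}. h (X i) (X j)) \<le> 1 / (4 * l)" using d by simp
    qed
  qed
  then have "measure ?P {X \<in> space ?P. t < off_diag_sum n h X} \<le> measure ?P (?A \<union> (\<Union>j\<in>{1..n}. ?B j))"
  proof (rule P.finite_measure_mono)
    have "?A \<in> sets ?P" by measurable
    then show "?A \<union> (\<Union>j\<in>{1..n}. ?B j) \<in> sets ?P" using B_sets by blast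
  qed
  also have "\<dots> \<le> measure ?P ?A + measure ?P (\<Union>j\<in>{1..n}. ?B j)"
  proof (rule measure_Un_le)
    show "?A \<in> sets ?P" by measurable
    show "(\<Union>j\<in>{1..n}. ?B j) \<in> sets ?P" using B_sets by blast
  qed
  also have "measure ?P (\<Union>j\<in>{1..n}. ?B j) \<le> (\<Sum>j\<in>{1..n}. measure ?P (?B j))"
    using B_sets by (intro measure_UNION_le) auto
  also have "\<dots> \<le> (\<Sum>j\<in>{1..n}. exp (real n * a - 1 / (4 * l * d)))"
    by (intro sum_mono kernel_sum_tail[OF M measp mom a])
  moreover have "exp (8 * l\<^sup>2 * d * (real n)\<^sup>2 - l * t) = exp (- l * t) * exp (8 * l\<^sup>2 * d * (real n)\<^sup>2)"
    by (simp add: exp_add[symmetric])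
  ultimately show ?thesis using A by simp
qed

section \<open>Second moments of U-statistics\<close>

text \<open>
  Orthogonality of martingale increments. In the last term the integral over the new observation is
  the outer one, so that for a fixed new observation the inner integral is a second moment of a
  sum of independent variables.
\<close>
lemma orthogonal_increment:
  fixes M :: "'a measure" and \<phi> :: "(nat \<Rightarrow> 'a) \<Rightarrow> 'a \<Rightarrow> real"
  defines "P \<equiv> \<lambda>m. Pi\<^sub>M {1..m} (\<lambda>_. M)"
  assumes M: "prob_space M"
    and G [measurable]: "G \<in> borel_measurable (P (Suc m))" and F [measurable]: "F \<in> borel_measurable (P m)"
    and \<phi> [measurable]: "case_prod \<phi> \<in> borel_measurable (P m \<Otimes>\<^sub>M M)"
    and bdd: "\<And>X. \<bar>F X\<bar> \<le> A" "\<And>X y. \<bar>\<phi> X y\<bar> \<le> B"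
    and dec: "\<And>X y. G (X(Suc m := y)) = F X + \<phi> X y"
    and centred: "\<And>X. X \<in> space (P m) \<Longrightarrow> (\<integral>y. \<phi> X y \<partial>M) = 0"
  shows "(\<integral>X. (G X)\<^sup>2 \<partial>P (Suc m)) = (\<integral>X. (F X)\<^sup>2 \<partial>P m) + (\<integral>y. \<integral>X. (\<phi> X y)\<^sup>2 \<partial>P m \<partial>M)"
proof -
  interpret M: prob_space M by fact
  interpret PP: product_prob_space "\<lambda>_. M" UNIV
    by (rule product_prob_space_const[OF M])
  interpret P: prob_space "P k" for k unfolding P_def by (rule prob_space_PiM) (simp add: M.prob_space_axioms)
  interpret Q: pair_prob_space "P m" M ..
  have ins: "{1..Suc m} = insert (Suc m) {1..m}" by auto
  have sq: "\<bar>x\<^sup>2\<bar> \<le> c\<^sup>2" if "\<bar>x\<bar> \<le> c" for x c :: real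
    using that by (metis abs_ge_zero abs_power2 power2_abs power_mono)
  have G2: "integrable (P (Suc m)) (\<lambda>X. (G X)\<^sup>2)"
  proof (rule P.integrable_const_bound[where B = "(A + B)\<^sup>2"])
    show "AE X in P (Suc m). norm ((G X)\<^sup>2) \<le> (A + B)\<^sup>2"
    proof (rule AE_I2)
      fix X
      have "G X = F X + \<phi> X (X (Suc m))" using dec[of X "X (Suc m)"] by simp
      then have "\<bar>G X\<bar> \<le> A + B" using bdd(1)[of X] bdd(2)[of X "X (Suc m)"] by linarith
      then show "norm ((G X)\<^sup>2) \<le> (A + B)\<^sup>2" using sq by simp
    qed
  qed measurable
  have F2: "integrable (P m) (\<lambda>X. (F X)\<^sup>2)"
    by (rule P.integrable_const_bound[where B = "A\<^sup>2"]) (use sq[OF bdd(1)] in auto)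
  have phi2: "integrable (P m \<Otimes>\<^sub>M M) (\<lambda>(X, y). (\<phi> X y)\<^sup>2)"
    by (rule Q.P.integrable_const_bound[where B = "B\<^sup>2"]) (use sq[OF bdd(2)] in auto)
  have inner: "(\<integral>y. (G (X(Suc m := y)))\<^sup>2 \<partial>M) = (F X)\<^sup>2 + (\<integral>y. (\<phi> X y)\<^sup>2 \<partial>M)" if X: "X \<in> space (P m)" for X
  proof -
    have pm [measurable]: "\<phi> X \<in> borel_measurable M"
      using measurable_compose[OF measurable_Pair1'[OF X, of M] \<phi>] by simp
    have i1: "integrable M (\<phi> X)" by (rule M.integrable_const_bound[where B = B]) (use bdd in auto)
    have i2: "integrable M (\<lambda>y. (\<phi> X y)\<^sup>2)"
      by (rule M.integrable_const_bound[where B = "B\<^sup>2"]) (use sq[OF bdd(2)] in auto)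
    have "(\<integral>y. (G (X(Suc m := y)))\<^sup>2 \<partial>M) = (\<integral>y. (F X)\<^sup>2 + 2 * F X * \<phi> X y + (\<phi> X y)\<^sup>2 \<partial>M)"
      unfolding dec by (simp add: power2_sum algebra_simps)
    also have "\<dots> = (F X)\<^sup>2 + (\<integral>y. (\<phi> X y)\<^sup>2 \<partial>M)"
      using i1 i2 centred[OF X] by (simp add: M.prob_space)
    finally show ?thesis .
  qed
  have "(\<integral>X. (G X)\<^sup>2 \<partial>P (Suc m)) = (\<integral>X. \<integral>y. (G (X(Suc m := y)))\<^sup>2 \<partial>M \<partial>P m)"
    using G2 unfolding P_def ins by (intro PP.product_integral_insert) auto
  also have "\<dots> = (\<integral>X. (F X)\<^sup>2 + (\<integral>y. (\<phi> X y)\<^sup>2 \<partial>M) \<partial>P m)"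
    by (intro Bochner_Integration.integral_cong refl inner)
  also have "\<dots> = (\<integral>X. (F X)\<^sup>2 \<partial>P m) + (\<integral>X. \<integral>y. (\<phi> X y)\<^sup>2 \<partial>M \<partial>P m)"
    using Q.integrable_fst'[OF phi2] by (intro Bochner_Integration.integral_add F2) simp
  also have "(\<integral>X. \<integral>y. (\<phi> X y)\<^sup>2 \<partial>M \<partial>P m) = (\<integral>y. \<integral>X. (\<phi> X y)\<^sup>2 \<partial>P m \<partial>M)"
    using Q.Fubini_integral[OF phi2] by simp
  finally show ?thesis .
qed

lemma measurable_sum_component:
  assumes q: "q \<in> borel_measurable M" and J: "J \<subseteq> I"
  shows "(\<lambda>X. \<Sum>i\<in>J. q (X i) :: real) \<in> borel_measurable (Pi\<^sub>M I (\<lambda>_. M))"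
proof (rule borel_measurable_sum)
  fix i assume "i \<in> J"
  then show "(\<lambda>X. q (X i)) \<in> borel_measurable (Pi\<^sub>M I (\<lambda>_. M))"
    using J by (intro measurable_compose[OF _ q] measurable_component_singleton) auto
qed

lemma second_moment_sum:
  fixes M :: "'a measure" and q :: "'a \<Rightarrow> real"
  assumes M: "prob_space M" and q [measurable]: "q \<in> borel_measurable M"
    and bdd: "\<And>x. \<bar>q x\<bar> \<le> K" and centred: "(\<integral>x. q x \<partial>M) = 0"
  shows "(\<integral>X. (\<Sum>i\<in>{1..m}. q (X i))\<^sup>2 \<partial>Pi\<^sub>M {1..m} (\<lambda>_. M)) = real m * (\<integral>x. (q x)\<^sup>2 \<partial>M)"
proof (induction m)
  case (Suc m)
  interpret P: prob_space "Pi\<^sub>M {1..m} (\<lambda>_. M)" by (rule prob_space_PiM_const) fact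
  have "(\<integral>X. (\<Sum>i\<in>{1..Suc m}. q (X i))\<^sup>2 \<partial>Pi\<^sub>M {1..Suc m} (\<lambda>_. M))
    = (\<integral>X. (\<Sum>i\<in>{1..m}. q (X i))\<^sup>2 \<partial>Pi\<^sub>M {1..m} (\<lambda>_. M))
      + (\<integral>y. \<integral>X. (q y)\<^sup>2 \<partial>Pi\<^sub>M {1..m} (\<lambda>_. M) \<partial>M)"
  proof (rule orthogonal_increment[OF M])
    show "\<bar>\<Sum>i\<in>{1..m}. q (X i)\<bar> \<le> (\<Sum>i\<in>{1..m}. K)" for X
      by (rule order_trans[OF sum_abs]) (intro sum_mono bdd)
    show "(\<Sum>i\<in>{1..Suc m}. q ((X(Suc m := y)) i)) = (\<Sum>i\<in>{1..m}. q (X i)) + q y" for X y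
    proof -
      have "(\<Sum>i\<in>{1..m}. q ((X(Suc m := y)) i)) = (\<Sum>i\<in>{1..m}. q (X i))"
        by (intro sum.cong refl) auto
      then show ?thesis by simp
    qed
    show "(\<lambda>X. \<Sum>i\<in>{1..Suc m}. q (X i)) \<in> borel_measurable (Pi\<^sub>M {1..Suc m} (\<lambda>_. M))"
      by (rule measurable_sum_component[OF q]) simp
    show "(\<lambda>X. \<Sum>i\<in>{1..m}. q (X i)) \<in> borel_measurable (Pi\<^sub>M {1..m} (\<lambda>_. M))"
      by (rule measurable_sum_component[OF q]) simp
  qed (use bdd centred in \<open>auto simp del: fun_upd_apply\<close>)
  then show ?case using Suc.IH by (simp add: P.prob_space[unfolded One_nat_def] algebra_simps)
qed simp

text \<open>
  Given the observation \<open>y\<close> with index \<open>m + 1\<close>, the increment is twice a sum of \<open>m\<close> independent centred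
  variables \<open>w (X i) y\<close>.
\<close>
lemma second_moment_degenerate:
  fixes M :: "'a measure" and w :: "'a \<Rightarrow> 'a \<Rightarrow> real"
  assumes M: "prob_space M" and w [measurable]: "case_prod w \<in> borel_measurable (M \<Otimes>\<^sub>M M)"
    and sym: "\<And>x y. w x y = w y x" and bdd: "\<And>x y. \<bar>w x y\<bar> \<le> K"
    and centred: "\<And>x. x \<in> space M \<Longrightarrow> (\<integral>y. w x y \<partial>M) = 0"
  shows "(\<integral>X. (off_diag_sum m w X)\<^sup>2 \<partial>Pi\<^sub>M {1..m} (\<lambda>_. M))
    = 2 * real m * (real m - 1) * (\<integral>x. \<integral>y. (w x y)\<^sup>2 \<partial>M \<partial>M)"
proof (induction m)
  case 0
  show ?case by (simp add: off_diag_sum_def)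
next
  case (Suc m)
  interpret M: prob_space M by fact
  let ?P = "Pi\<^sub>M {1..m} (\<lambda>_. M)"
  let ?\<phi> = "\<lambda>X y. 2 * (\<Sum>i\<in>{1..m}. w (X i) y)"
  have sumb: "\<bar>\<Sum>i\<in>{1..m}. w (X i) y\<bar> \<le> real m * K" for X :: "nat \<Rightarrow> 'a" and y
    using order_trans[OF sum_abs sum_mono, of "{1..m}" "\<lambda>i. w (X i) y" "\<lambda>_. K"] bdd by simp
  have "(\<integral>X. (off_diag_sum (Suc m) w X)\<^sup>2 \<partial>Pi\<^sub>M {1..Suc m} (\<lambda>_. M))
    = (\<integral>X. (off_diag_sum m w X)\<^sup>2 \<partial>?P) + (\<integral>y. \<integral>X. (?\<phi> X y)\<^sup>2 \<partial>?P \<partial>M)"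
  proof (rule orthogonal_increment[OF M])
    show "off_diag_sum (Suc m) w \<in> borel_measurable (Pi\<^sub>M {1..Suc m} (\<lambda>_. M))"
      "off_diag_sum m w \<in> borel_measurable ?P"
      by (rule measurable_off_diag_sum[OF w])+
    have "(\<lambda>p. w (fst p i) (snd p)) \<in> borel_measurable (?P \<Otimes>\<^sub>M M)" if "i \<in> {1..m}" for i
      using measurable_compose[OF measurable_Pair[OF measurable_compose[OF measurable_fst
        measurable_component_singleton[OF that]] measurable_snd] w] by simp
    then show "case_prod ?\<phi> \<in> borel_measurable (?P \<Otimes>\<^sub>M M)"
      unfolding case_prod_beta by (intro borel_measurable_times borel_measurable_sum) auto
    show "\<bar>off_diag_sum m w X\<bar> \<le> real m * (real m * K)" for X
    proof -
      have K: "0 \<le> K" using bdd[of undefined undefined] by linarith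
      have "\<bar>off_diag_sum m w X\<bar> \<le> (\<Sum>i\<in>{1..m}. \<bar>\<Sum>j\<in>{1..m}-{i}. w (X i) (X j)\<bar>)"
        unfolding off_diag_sum_def by (rule sum_abs)
      also have "\<dots> \<le> (\<Sum>i\<in>{1..m}. real m * K)"
      proof (rule sum_mono)
        fix i
        have "\<bar>\<Sum>j\<in>{1..m}-{i}. w (X i) (X j)\<bar> \<le> (\<Sum>j\<in>{1..m}-{i}. K)"
          by (rule order_trans[OF sum_abs]) (intro sum_mono bdd)
        also have "\<dots> \<le> (\<Sum>j\<in>{1..m}. K)" using K by (intro sum_mono2) auto
        finally show "\<bar>\<Sum>j\<in>{1..m}-{i}. w (X i) (X j)\<bar> \<le> real m * K" by simp
      qed
      finally show ?thesis by simp
    qed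
    show "\<bar>?\<phi> X y\<bar> \<le> 2 * (real m * K)" for X y using sumb[of X y] by simp
    show "off_diag_sum (Suc m) w (X(Suc m := y)) = off_diag_sum m w X + ?\<phi> X y" for X y
      unfolding off_diag_sum_Suc[of w, OF sym] by simp
    show "(\<integral>y. ?\<phi> X y \<partial>M) = 0" if X: "X \<in> space ?P" for X
    proof -
      have Xi: "X i \<in> space M" if "i \<in> {1..m}" for i using X that by (auto simp: space_PiM)
      have "integrable M (w (X i))" if "i \<in> {1..m}" for i
        by (rule M.integrable_const_bound[where B = K])
          (use bdd measurable_compose[OF measurable_Pair1'[OF Xi[OF that], of M] w] in auto)
      then show ?thesis using centred[OF Xi] by (simp add: Bochner_Integration.integral_sum)
    qed
  qed
  also have "(\<integral>y. \<integral>X. (?\<phi> X y)\<^sup>2 \<partial>?P \<partial>M) = (\<integral>y. 4 * real m * (\<integral>x. (w y x)\<^sup>2 \<partial>M) \<partial>M)"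
  proof (intro Bochner_Integration.integral_cong refl)
    fix y assume y: "y \<in> space M"
    have wm [measurable]: "w y \<in> borel_measurable M"
      using measurable_compose[OF measurable_Pair1'[OF y, of M] w] by simp
    have "(\<integral>X. (?\<phi> X y)\<^sup>2 \<partial>?P) = 4 * (\<integral>X. (\<Sum>i\<in>{1..m}. w y (X i))\<^sup>2 \<partial>?P)"
      unfolding power_mult_distrib sym[of _ y] by simp
    also have "\<dots> = 4 * real m * (\<integral>x. (w y x)\<^sup>2 \<partial>M)"
      by (subst second_moment_sum[OF M wm bdd centred[OF y]]) simp
    finally show "(\<integral>X. (?\<phi> X y)\<^sup>2 \<partial>?P) = 4 * real m * (\<integral>x. (w y x)\<^sup>2 \<partial>M)" .
  qed
  also have "\<dots> = 4 * real m * (\<integral>x. \<integral>y. (w x y)\<^sup>2 \<partial>M \<partial>M)" by simp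
  finally show ?case using Suc.IH by (simp add: algebra_simps)
qed

text \<open>
  By the Hoeffding decomposition \<open>K x y = \<theta> + q x + q y + w x y\<close> with \<open>q x = p x - \<theta>\<close> and \<open>w\<close>
  degenerate, the centred U-statistic is the sum of a degenerate U-statistic with kernel \<open>w\<close> and of twice
  the empirical mean of \<open>q\<close>. The inequality \<open>(a + b)\<^sup>2 \<le> 2 * a\<^sup>2 + 2 * b\<^sup>2\<close> separates the two parts at the
  expense of the numerical constants.
\<close>
lemma U_statistic_second_moment:
  fixes M :: "'a measure" and K :: "'a \<Rightarrow> 'a \<Rightarrow> real"
  defines "p \<equiv> \<lambda>x. \<integral>y. K x y \<partial>M"
  defines "\<theta> \<equiv> \<integral>x. p x \<partial>M"
  assumes M: "prob_space M" and K [measurable]: "case_prod K \<in> borel_measurable (M \<Otimes>\<^sub>M M)"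
    and sym: "\<And>x y. K x y = K y x" and bdd: "\<And>x y. \<bar>K x y\<bar> \<le> B" and n: "2 \<le> n"
  shows "(\<integral>X. (off_diag_sum n K X / (real n * (real n - 1)) - \<theta>)\<^sup>2 \<partial>Pi\<^sub>M {1..n} (\<lambda>_. M))
    \<le> 16 / (real n * (real n - 1)) * (\<integral>x. \<integral>y. (K x y)\<^sup>2 \<partial>M \<partial>M) + 8 / real n * (\<integral>x. (p x - \<theta>)\<^sup>2 \<partial>M)"
proof -
  interpret M: prob_space M by fact
  interpret Q: pair_prob_space M M ..
  let ?P = "Pi\<^sub>M {1..n} (\<lambda>_. M)"
  interpret P: prob_space ?P by (rule prob_space_PiM_const) fact
  define q where "q x = p x - \<theta>" for x
  define w where "w x y = K x y - q x - q y - \<theta>" for x y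
  have sq: "\<bar>x\<^sup>2\<bar> \<le> c\<^sup>2" if "\<bar>x\<bar> \<le> c" for x c :: real
    using that by (metis abs_ge_zero abs_power2 power2_abs power_mono)
  have B0: "0 \<le> B" using bdd[of undefined undefined] by linarith
  have abs_int: "\<bar>\<integral>x. g x \<partial>M\<bar> \<le> C" if "\<And>x. \<bar>g x\<bar> \<le> C" "0 \<le> C" for g :: "'a \<Rightarrow> real" and C
  proof (cases "integrable M g")
    case True
    have "\<bar>\<integral>x. g x \<partial>M\<bar> \<le> (\<integral>x. \<bar>g x\<bar> \<partial>M)" by (rule integral_abs_bound)
    also have "\<dots> \<le> (\<integral>x. C \<partial>M)" using True that by (intro integral_mono) auto
    finally show ?thesis by (simp add: M.prob_space)
  next
    case False
    then show ?thesis using that by (simp add: not_integrable_integral_eq)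
  qed
  have pm [measurable]: "p \<in> borel_measurable M" unfolding p_def by measurable
  have pb: "\<bar>p x\<bar> \<le> B" for x unfolding p_def using bdd B0 by (intro abs_int)
  have tb: "\<bar>\<theta>\<bar> \<le> B" unfolding \<theta>_def using pb B0 by (intro abs_int)
  have qm [measurable]: "q \<in> borel_measurable M" unfolding q_def by measurable
  have qb: "\<bar>q x\<bar> \<le> 2 * B" for x unfolding q_def using pb[of x] tb by linarith
  have wm [measurable]: "case_prod w \<in> borel_measurable (M \<Otimes>\<^sub>M M)" unfolding w_def by measurable
  have wb: "\<bar>w x y\<bar> \<le> 6 * B" for x y
    unfolding w_def using bdd[of x y] qb[of x] qb[of y] tb by linarith
  have wsym: "w x y = w y x" for x y unfolding w_def using sym[of x y] by simp
  have Kx [measurable]: "K x \<in> borel_measurable M" if "x \<in> space M" for x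
    using measurable_compose[OF measurable_Pair1'[OF that, of M] K] by simp
  have iK: "integrable M (K x)" if "x \<in> space M" for x
    by (rule M.integrable_const_bound[where B = B]) (use bdd Kx[OF that] in auto)
  have iK2: "integrable M (\<lambda>y. (K x y)\<^sup>2)" if "x \<in> space M" for x
    by (rule M.integrable_const_bound[where B = "B\<^sup>2"]) (use sq[OF bdd] Kx[OF that] in auto)
  have ip: "integrable M p" by (rule M.integrable_const_bound[where B = B]) (use pb in auto)
  have iq: "integrable M q" by (rule M.integrable_const_bound[where B = "2 * B"]) (use qb in auto)
  have ip2: "integrable M (\<lambda>x. (p x)\<^sup>2)" by (rule M.integrable_const_bound[where B = "B\<^sup>2"]) (use sq[OF pb] in auto)
  have iq2: "integrable M (\<lambda>x. (q x)\<^sup>2)" by (rule M.integrable_const_bound[where B = "(2*B)\<^sup>2"]) (use sq[OF qb] in auto)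
  have q0: "(\<integral>x. q x \<partial>M) = 0" unfolding q_def using ip by (simp add: \<theta>_def M.prob_space)
  have w0: "(\<integral>y. w x y \<partial>M) = 0" if "x \<in> space M" for x
    unfolding w_def using iK[OF that] iq q0 by (simp add: M.prob_space) (simp add: q_def p_def)
  have iK2': "integrable M (\<lambda>x. \<integral>y. (K x y)\<^sup>2 \<partial>M)"
  proof -
    have "integrable (M \<Otimes>\<^sub>M M) (\<lambda>(x, y). (K x y)\<^sup>2)"
      by (rule Q.P.integrable_const_bound[where B = "B\<^sup>2"]) (use sq[OF bdd] in auto)
    from Q.integrable_fst'[OF this] show ?thesis by simp
  qed
  have var_K: "(\<integral>y. (K x y - p x)\<^sup>2 \<partial>M) = (\<integral>y. (K x y)\<^sup>2 \<partial>M) - (p x)\<^sup>2" if x: "x \<in> space M" for x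
  proof -
    have "(\<integral>y. (K x y - p x)\<^sup>2 \<partial>M) = (\<integral>y. (K x y)\<^sup>2 - 2 * p x * K x y + (p x)\<^sup>2 \<partial>M)"
      by (simp add: power2_diff algebra_simps)
    also have "\<dots> = (\<integral>y. (K x y)\<^sup>2 \<partial>M) - 2 * p x * p x + (p x)\<^sup>2"
      using iK[OF x] iK2[OF x] by (simp add: M.prob_space p_def)
    finally show ?thesis by (simp add: power2_eq_square)
  qed
  have p2_le: "(p x)\<^sup>2 \<le> (\<integral>y. (K x y)\<^sup>2 \<partial>M)" if "x \<in> space M" for x
  proof -
    have "0 \<le> (\<integral>y. (K x y - p x)\<^sup>2 \<partial>M)" by simp
    then show ?thesis using var_K[OF that] by simp
  qed
  let ?S = "\<integral>x. \<integral>y. (K x y)\<^sup>2 \<partial>M \<partial>M"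
  have q2_le: "(\<integral>x. (q x)\<^sup>2 \<partial>M) \<le> ?S"
  proof -
    have "(\<integral>x. (q x)\<^sup>2 \<partial>M) = (\<integral>x. (p x)\<^sup>2 - 2 * \<theta> * p x + \<theta>\<^sup>2 \<partial>M)"
      unfolding q_def by (simp add: power2_diff algebra_simps)
    also have "\<dots> = (\<integral>x. (p x)\<^sup>2 \<partial>M) - 2 * \<theta> * \<theta> + \<theta>\<^sup>2"
      using ip ip2 by (simp add: M.prob_space \<theta>_def)
    also have "\<dots> \<le> (\<integral>x. (p x)\<^sup>2 \<partial>M)" by (simp add: power2_eq_square)
    also have "\<dots> \<le> ?S" by (intro integral_mono ip2 iK2' p2_le)
    finally show ?thesis .
  qed
  have w2_le: "(\<integral>x. \<integral>y. (w x y)\<^sup>2 \<partial>M \<partial>M) \<le> 4 * ?S"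
  proof -
    have "(\<integral>x. \<integral>y. (w x y)\<^sup>2 \<partial>M \<partial>M) \<le> (\<integral>x. 2 * (\<integral>y. (K x y)\<^sup>2 \<partial>M) + 2 * (\<integral>y. (q y)\<^sup>2 \<partial>M) \<partial>M)"
    proof (rule integral_mono)
      have "integrable (M \<Otimes>\<^sub>M M) (\<lambda>(x, y). (w x y)\<^sup>2)"
        by (rule Q.P.integrable_const_bound[where B = "(6*B)\<^sup>2"]) (use sq[OF wb] in auto)
      from Q.integrable_fst'[OF this] show "integrable M (\<lambda>x. \<integral>y. (w x y)\<^sup>2 \<partial>M)" by simp
      show "integrable M (\<lambda>x. 2 * (\<integral>y. (K x y)\<^sup>2 \<partial>M) + 2 * (\<integral>y. (q y)\<^sup>2 \<partial>M))"
        using iK2' by simp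
      fix x assume x: "x \<in> space M"
      have wx [measurable]: "w x \<in> borel_measurable M"
        using measurable_compose[OF measurable_Pair1'[OF x, of M] wm] by simp
      have iKp: "integrable M (\<lambda>y. (K x y - p x)\<^sup>2)"
      proof (rule M.integrable_const_bound[where B = "(2*B)\<^sup>2"])
        have "\<bar>K x y - p x\<bar> \<le> 2 * B" for y using bdd[of x y] pb[of x] by linarith
        then show "AE y in M. norm ((K x y - p x)\<^sup>2) \<le> (2*B)\<^sup>2" using sq by (intro AE_I2) (metis real_norm_def)
      qed (use Kx[OF x] in measurable)
      have "(\<integral>y. (w x y)\<^sup>2 \<partial>M) \<le> (\<integral>y. 2 * (K x y - p x)\<^sup>2 + 2 * (q y)\<^sup>2 \<partial>M)"
      proof (rule integral_mono)
        show "integrable M (\<lambda>y. (w x y)\<^sup>2)"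
          by (rule M.integrable_const_bound[where B = "(6*B)\<^sup>2"]) (use sq[OF wb] in auto)
        show "integrable M (\<lambda>y. 2 * (K x y - p x)\<^sup>2 + 2 * (q y)\<^sup>2)" using iKp iq2 by simp
        fix y
        have "w x y = (K x y - p x) - q y" unfolding w_def q_def by simp
        moreover have "(a - b)\<^sup>2 \<le> 2 * a\<^sup>2 + 2 * b\<^sup>2" for a b :: real
          using zero_le_power2[of "a + b"] by (simp add: power2_eq_square algebra_simps)
        ultimately show "(w x y)\<^sup>2 \<le> 2 * (K x y - p x)\<^sup>2 + 2 * (q y)\<^sup>2" by simp
      qed
      also have "\<dots> = 2 * (\<integral>y. (K x y - p x)\<^sup>2 \<partial>M) + 2 * (\<integral>y. (q y)\<^sup>2 \<partial>M)"
        using iKp iq2 by simp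
      also have "\<dots> \<le> 2 * (\<integral>y. (K x y)\<^sup>2 \<partial>M) + 2 * (\<integral>y. (q y)\<^sup>2 \<partial>M)"
        unfolding var_K[OF x] by simp
      finally show "(\<integral>y. (w x y)\<^sup>2 \<partial>M) \<le> 2 * (\<integral>y. (K x y)\<^sup>2 \<partial>M) + 2 * (\<integral>y. (q y)\<^sup>2 \<partial>M)" .
    qed
    also have "\<dots> = 2 * ?S + 2 * (\<integral>y. (q y)\<^sup>2 \<partial>M)" using iK2' by (simp add: M.prob_space)
    finally show ?thesis using q2_le by simp
  qed
  let ?N = "real n * (real n - 1)"
  let ?L = "\<lambda>X. \<Sum>i\<in>{1..n}. q (X i)"
  have N: "?N > 0" "real n > 0" using n by auto
  have dec: "off_diag_sum n K X / ?N - \<theta> = off_diag_sum n w X / ?N + 2 / real n * ?L X" for X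
  proof -
    have card: "real (card ({1..n} - {i})) = real n - 1" if "i \<in> {1..n}" for i
      using that n by (simp add: card_Diff_singleton of_nat_diff)
    have "off_diag_sum n K X = (\<Sum>i\<in>{1..n}. \<Sum>j\<in>{1..n}-{i}. w (X i) (X j) + q (X i) + q (X j) + \<theta>)"
      unfolding off_diag_sum_def w_def by simp
    also have "\<dots> = off_diag_sum n w X + (\<Sum>i\<in>{1..n}. (real n - 1) * q (X i) + (?L X - q (X i)) + (real n - 1) * \<theta>)"
    proof -
      have "(\<Sum>j\<in>{1..n}-{i}. w (X i) (X j) + q (X i) + q (X j) + \<theta>)
        = (\<Sum>j\<in>{1..n}-{i}. w (X i) (X j)) + ((real n - 1) * q (X i) + (?L X - q (X i)) + (real n - 1) * \<theta>)"
        if "i \<in> {1..n}" for i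
        unfolding sum.distrib using card[OF that] that by (simp add: sum_diff1 algebra_simps)
      then show ?thesis unfolding off_diag_sum_def by (simp add: sum.distrib)
    qed
    also have "\<dots> = off_diag_sum n w X + 2 * (real n - 1) * ?L X + ?N * \<theta>"
    proof -
      define L where "L = ?L X"
      have "(\<Sum>i\<in>{1..n}. (real n - 1) * q (X i) + (L - q (X i)) + (real n - 1) * \<theta>)
        = (real n - 1) * ?L X + (real n * L - ?L X) + real n * ((real n - 1) * \<theta>)"
        unfolding sum.distrib sum_subtractf sum_distrib_left by simp
      then show ?thesis unfolding L_def by (simp add: algebra_simps)
    qed
    finally have eq: "off_diag_sum n K X = off_diag_sum n w X + 2 * (real n - 1) * ?L X + ?N * \<theta>" .
    have split: "(b + 2 * m * L + (x * m) * t) / (x * m) - t = b / (x * m) + 2 / x * L"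
      if "0 < x" "0 < m" for b m L x t :: real
      using that by (simp add: field_simps)
    show ?thesis unfolding eq using n by (intro split) auto
  qed
  have Lm [measurable]: "?L \<in> borel_measurable ?P"
    by (rule measurable_sum_component[OF qm]) simp
  note [measurable] = measurable_off_diag_sum[OF wm, of n]
  have Lb: "\<bar>?L X\<bar> \<le> real n * (2 * B)" for X
    using order_trans[OF sum_abs sum_mono, of "{1..n}" "\<lambda>i. q (X i)" "\<lambda>_. 2 * B"] qb by simp
  have iL: "integrable ?P (\<lambda>X. (?L X)\<^sup>2)"
    by (rule P.integrable_const_bound[where B = "(real n * (2 * B))\<^sup>2"]) (use sq[OF Lb] in auto)
  have Kb: "\<bar>off_diag_sum n w X\<bar> \<le> real n * (real n * (6 * B))" for X
  proof -
    have "\<bar>\<Sum>j\<in>{1..n}-{i}. w (X i) (X j)\<bar> \<le> real n * (6 * B)" for i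
    proof -
      have "\<bar>\<Sum>j\<in>{1..n}-{i}. w (X i) (X j)\<bar> \<le> (\<Sum>j\<in>{1..n}-{i}. 6 * B)"
        by (rule order_trans[OF sum_abs]) (intro sum_mono wb)
      also have "\<dots> \<le> (\<Sum>j\<in>{1..n}. 6 * B)" using B0 by (intro sum_mono2) auto
      finally show ?thesis by simp
    qed
    then show ?thesis unfolding off_diag_sum_def
      using order_trans[OF sum_abs sum_mono, of "{1..n}" "\<lambda>i. \<Sum>j\<in>{1..n}-{i}. w (X i) (X j)" "\<lambda>_. real n * (6 * B)"]
      by simp
  qed
  have iw: "integrable ?P (\<lambda>X. (off_diag_sum n w X)\<^sup>2)"
    by (rule P.integrable_const_bound[where B = "(real n * (real n * (6 * B)))\<^sup>2"]) (use sq[OF Kb] in simp, measurable)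
  have "(\<integral>X. (off_diag_sum n K X / ?N - \<theta>)\<^sup>2 \<partial>?P)
      \<le> (\<integral>X. 2 / ?N\<^sup>2 * (off_diag_sum n w X)\<^sup>2 + 8 / (real n)\<^sup>2 * (?L X)\<^sup>2 \<partial>?P)"
  proof (rule integral_mono')
    show "integrable ?P (\<lambda>X. 2 / ?N\<^sup>2 * (off_diag_sum n w X)\<^sup>2 + 8 / (real n)\<^sup>2 * (?L X)\<^sup>2)"
      using iL iw by simp
    fix X
    have "(a + b)\<^sup>2 \<le> 2 * a\<^sup>2 + 2 * b\<^sup>2" for a b :: real
      using zero_le_power2[of "a - b"] by (simp add: power2_eq_square algebra_simps)
    from this[of "off_diag_sum n w X / ?N" "2 / real n * ?L X"]
    show "(off_diag_sum n K X / ?N - \<theta>)\<^sup>2 \<le> 2 / ?N\<^sup>2 * (off_diag_sum n w X)\<^sup>2 + 8 / (real n)\<^sup>2 * (?L X)\<^sup>2"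
      unfolding dec by (simp add: power_divide power_mult_distrib)
  qed simp
  also have "\<dots> = 2 / ?N\<^sup>2 * (2 * real n * (real n - 1) * (\<integral>x. \<integral>y. (w x y)\<^sup>2 \<partial>M \<partial>M))
      + 8 / (real n)\<^sup>2 * (real n * (\<integral>x. (q x)\<^sup>2 \<partial>M))"
    using iL iw second_moment_degenerate[OF M wm wsym wb w0, of n] second_moment_sum[OF M qm qb q0, of n]
    by simp
  also have "\<dots> = 4 / ?N * (\<integral>x. \<integral>y. (w x y)\<^sup>2 \<partial>M \<partial>M) + 8 / real n * (\<integral>x. (q x)\<^sup>2 \<partial>M)"
  proof -
    have "2 / (x * m)\<^sup>2 * (2 * x * m * W) + 8 / x\<^sup>2 * (x * V) = 4 / (x * m) * W + 8 / x * V"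
      if "0 < x" "0 < m" for x m W V :: real
      using that by (simp add: power2_eq_square field_simps)
    then show ?thesis using n by auto
  qed
  also have "\<dots> \<le> 4 / ?N * (4 * ?S) + 8 / real n * (\<integral>x. (q x)\<^sup>2 \<partial>M)"
    using w2_le N by (intro add_right_mono mult_left_mono) auto
  finally show ?thesis unfolding q_def by simp
qed

section \<open>Taylor polynomials and interpolation at separated points\<close>

text \<open>Lagrange interpolation: the factors of the basis polynomials at \<open>x\<close> are at most \<open>r\<close> in absolute value.\<close>
lemma poly_bound_by_separated_values:
  fixes p :: "real poly" and \<xi> :: "nat \<Rightarrow> real"
  assumes deg: "degree p \<le> d" and sep: "\<And>i j. i \<le> d \<Longrightarrow> j \<le> d \<Longrightarrow> i \<noteq> j \<Longrightarrow> \<delta> \<le> \<bar>\<xi> i - \<xi> j\<bar>"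
    and near: "\<And>i. i \<le> d \<Longrightarrow> \<bar>x - \<xi> i\<bar> \<le> r * \<delta>" and "0 < \<delta>" "1 \<le> r"
  shows "\<bar>poly p x\<bar> \<le> r ^ d * (\<Sum>i\<le>d. \<bar>poly p (\<xi> i)\<bar>)"
proof -
  define L where "L i = (\<Prod>j\<in>{..d} - {i}. smult (1 / (\<xi> i - \<xi> j)) [:- \<xi> j, 1:])" for i
  define q where "q = (\<Sum>i\<le>d. smult (poly p (\<xi> i)) (L i))"
  have L_poly: "poly (L i) y = (\<Prod>j\<in>{..d} - {i}. (y - \<xi> j) / (\<xi> i - \<xi> j))" for i y
    by (simp add: L_def poly_prod diff_divide_distrib)
  have ne: "\<xi> i \<noteq> \<xi> j" if "i \<le> d" "j \<le> d" "i \<noteq> j" for i j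
    using sep[OF that] \<open>0 < \<delta>\<close> by auto
  have degL: "degree (L i) \<le> d" if "i \<le> d" for i
  proof -
    have "degree (L i) \<le> (\<Sum>j\<in>{..d} - {i}. degree (smult (1 / (\<xi> i - \<xi> j)) [:- \<xi> j, 1:]))"
      unfolding L_def by (rule degree_prod_sum_le[unfolded o_def]) simp
    also have "\<dots> \<le> (\<Sum>j\<in>{..d} - {i}. 1)" by (intro sum_mono order_trans[OF degree_smult_le]) simp
    also have "\<dots> = d" using that by simp
    finally show ?thesis .
  qed
  have "p = q"
  proof (rule poly_eqI_degree)
    show "poly p y = poly q y" if y: "y \<in> \<xi> ` {..d}" for y
    proof -
      obtain k where k: "k \<le> d" "y = \<xi> k" using y by auto
      have "poly (L i) (\<xi> k) = of_bool (i = k)" if "i \<le> d" for i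
      proof (cases "i = k")
        case True
        then show ?thesis using ne[of k] k by (auto simp: L_poly intro!: prod.neutral)
      next
        case False
        then show ?thesis unfolding L_poly using k by (auto intro!: prod_zero)
      qed
      then have "poly q y = (\<Sum>i\<le>d. poly p (\<xi> i) * of_bool (i = k))"
        unfolding q_def poly_sum k(2) by (intro sum.cong) auto
      then show ?thesis using k by simp
    qed
    have "card (\<xi> ` {..d}) = Suc d"
      using ne by (subst card_image) (auto simp: inj_on_def)
    moreover have "degree q \<le> d"
      unfolding q_def by (intro degree_sum_le order_trans[OF degree_smult_le] degL) auto
    ultimately show "degree p < card (\<xi> ` {..d})" "degree q < card (\<xi> ` {..d})"
      using deg by auto
  qed
  then have "poly p x = (\<Sum>i\<le>d. poly p (\<xi> i) * poly (L i) x)"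
    by (metis (no_types, lifting) q_def poly_sum poly_smult sum.cong)
  also have "\<bar>\<dots>\<bar> \<le> (\<Sum>i\<le>d. \<bar>poly p (\<xi> i)\<bar> * r ^ d)"
  proof (rule order_trans[OF sum_abs], rule sum_mono)
    fix i assume i: "i \<in> {..d}"
    have "\<bar>poly (L i) x\<bar> = (\<Prod>j\<in>{..d} - {i}. \<bar>x - \<xi> j\<bar> / \<bar>\<xi> i - \<xi> j\<bar>)"
      unfolding L_poly by (simp add: abs_prod)
    also have "\<dots> \<le> (\<Prod>j\<in>{..d} - {i}. r)"
    proof (rule prod_mono, safe)
      fix j assume j: "j \<le> d" "j \<noteq> i"
      have "\<bar>x - \<xi> j\<bar> / \<bar>\<xi> i - \<xi> j\<bar> \<le> (r * \<delta>) / \<delta>"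
        using near[OF j(1)] sep[of i j] i j \<open>0 < \<delta>\<close> by (intro frac_le) auto
      then show "\<bar>x - \<xi> j\<bar> / \<bar>\<xi> i - \<xi> j\<bar> \<le> r" using \<open>0 < \<delta>\<close> by simp
    qed simp
    also have "\<dots> = r ^ d" using i by simp
    finally show "\<bar>poly p (\<xi> i) * poly (L i) x\<bar> \<le> \<bar>poly p (\<xi> i)\<bar> * r ^ d"
      by (simp add: abs_mult mult_left_mono)
  qed
  finally show ?thesis by (simp add: sum_distrib_right sum_distrib_left mult.commute)
qed

lemma pderiv_sum: "pderiv (sum f A) = (\<Sum>x\<in>A. pderiv (f x))"
  by (induction A rule: infinite_finite_induct) (auto simp: pderiv_add)

text \<open>
  Induction on the number of derivatives: integrate the polynomial that approximates \<open>d 1\<close>, choosing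
  the constant so that both functions agree at \<open>a\<close>, and use the mean value inequality.
\<close>
lemma taylor_polynomial:
  fixes d :: "nat \<Rightarrow> real \<Rightarrow> real"
  assumes der: "\<And>i x. i < m \<Longrightarrow> x \<in> {0..1} \<Longrightarrow> (d i has_real_derivative d (Suc i) x) (at x within {0..1})"
    and osc: "\<And>x. x \<in> {a..a + h} \<Longrightarrow> \<bar>d m x - d m a\<bar> \<le> K"
    and ah: "0 \<le> a" "a + h \<le> 1" "0 \<le> h"
  shows "\<exists>p. degree p \<le> m \<and> (\<forall>x\<in>{a..a + h}. \<bar>d 0 x - poly p x\<bar> \<le> K * h ^ m)"
  using der osc
proof (induction m arbitrary: d)
  case 0
  have "\<forall>x\<in>{a..a + h}. \<bar>d 0 x - poly [:d 0 a:] x\<bar> \<le> K * h ^ 0" using 0 by simp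
  then show ?case by (intro exI[of _ "[:d 0 a:]"]) simp
next
  case (Suc m)
  obtain q where q: "degree q \<le> m" "\<forall>x\<in>{a..a + h}. \<bar>d (Suc 0) x - poly q x\<bar> \<le> K * h ^ m"
    using Suc.IH[of "\<lambda>i. d (Suc i)"] Suc.prems by auto
  \<comment> \<open>an antiderivative of \<open>q\<close>, written down coefficientwise\<close>
  obtain Q where Q: "pderiv Q = q" "degree Q \<le> Suc m"
  proof -
    define Q where "Q = (\<Sum>i\<le>m. monom (coeff q i / real (Suc i)) (Suc i))"
    have "pderiv Q = (\<Sum>i\<le>m. monom (coeff q i) i)"
      unfolding Q_def pderiv_sum by (intro sum.cong refl) (simp add: pderiv_monom del: of_nat_Suc)
    also have "\<dots> = q" using q(1) by (metis poly_as_sum_of_monoms')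
    finally have "pderiv Q = q" .
    moreover have "degree Q \<le> Suc m"
      unfolding Q_def by (intro degree_sum_le order_trans[OF degree_monom_le]) auto
    ultimately show ?thesis by (rule that)
  qed
  define p where "p = Q + [:d 0 a - poly Q a:]"
  have dp: "pderiv p = q" unfolding p_def pderiv_add Q(1) by (simp add: pderiv_pCons)
  have "\<bar>d 0 x - poly p x\<bar> \<le> K * h ^ Suc m" if x: "x \<in> {a..a + h}" for x
  proof -
    have "\<bar>(d 0 x - poly p x) - (d 0 a - poly p a)\<bar> \<le> K * h ^ m * \<bar>x - a\<bar>"
    proof (rule field_differentiable_bound[where S = "{a..a + h}"
          and f = "\<lambda>z. d 0 z - poly p z" and f' = "\<lambda>z. d (Suc 0) z - poly q z", unfolded real_norm_def])
      fix z assume z: "z \<in> {a..a + h}"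
      then have "(d 0 has_real_derivative d (Suc 0) z) (at z within {a..a + h})"
      proof (intro DERIV_subset[OF Suc.prems(1)[of 0 z]])
        show "{a..a + h} \<subseteq> {0..1}" using ah by simp
        then show "z \<in> {0..1}" using z by blast
      qed simp
      moreover have "(poly p has_real_derivative poly q z) (at z within {a..a + h})"
        using has_field_derivative_at_within[OF poly_DERIV[of p z]] unfolding dp .
      ultimately show "((\<lambda>z. d 0 z - poly p z) has_real_derivative d (Suc 0) z - poly q z) (at z within {a..a + h})"
        by (rule DERIV_diff)
      show "\<bar>d (Suc 0) z - poly q z\<bar> \<le> K * h ^ m" using q z by blast
    next
      show "convex {a..a + h}" by (rule convex_real_interval)
      show "x \<in> {a..a + h}" by (rule x)
      show "a \<in> {a..a + h}" using ah by simp
    qed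
    also have "\<dots> \<le> K * h ^ m * h"
    proof (rule mult_left_mono)
      have "0 \<le> K" using Suc.prems(2)[of a] ah by simp
      then show "0 \<le> K * h ^ m" using ah by simp
    qed (use x in auto)
    finally show ?thesis by (simp add: p_def mult_ac)
  qed
  moreover have "degree p \<le> Suc m"
    unfolding p_def using Q by (intro degree_add_le) auto
  ultimately show ?case by blast
qed

lemma mean_value_point:
  fixes g :: "real \<Rightarrow> real"
  assumes "continuous_on {a..b} g" "a < b"
  shows "\<exists>\<xi>\<in>{a..b}. (LINT x:{a..b}|lborel. g x) = (b - a) * g \<xi>"
proof -
  have "\<exists>\<xi>\<in>{a..b}. integral {a..b} g - integral {a..a} g = (b - a) * g \<xi>"
  proof -
    have "\<exists>\<xi>\<in>{a..b}. integral {a..b} g - integral {a..a} g = (\<lambda>h. h * g \<xi>) (b - a)"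
    proof (rule mvt_very_simple)
      fix x assume "a \<le> x" "x \<le> b"
      then have "((\<lambda>u. integral {a..u} g) has_real_derivative g x) (at x within {a..b})"
        using integral_has_real_derivative[OF assms(1)] by auto
      then show "((\<lambda>u. integral {a..u} g) has_derivative (\<lambda>h. h * g x)) (at x within {a..b})"
        by (simp add: has_field_derivative_def mult_commute_abs)
    qed (use assms in simp)
    then show ?thesis by simp
  qed
  moreover have "(LINT x:{a..b}|lborel. g x) = integral {a..b} g"
    using borel_integrable_atLeastAtMost'[OF assms(1)] by (rule set_borel_integral_eq_integral)
  ultimately show ?thesis by simp
qed

section \<open>Regular partitions of the unit interval\<close>

lemma prob_density_nonneg: "prob_density f \<Longrightarrow> 0 \<le> f x"
  by (simp add: prob_density_def)

text \<open>
  Points outside \<open>[0, 1)\<close> are sent to the cell 0. All laws considered here give them probability zero,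
  and with this convention the partition is indexed by \<open>{..<D}\<close> without exceptional points, so that
  identities for the histogram kernel hold everywhere and not just almost everywhere.
\<close>
definition cell :: "nat \<Rightarrow> real \<Rightarrow> nat" where
  "cell D x = (if x \<in> {0..<1} then nat \<lfloor>real D * x\<rfloor> else 0)"

lemma cell_less: "0 < D \<Longrightarrow> cell D x < D"
proof -
  assume D: "0 < D"
  have "nat \<lfloor>real D * x\<rfloor> < D" if "0 \<le> x" "x < 1"
  proof -
    have "real D * x < real D * 1" using that D by (intro mult_strict_left_mono) auto
    then have "\<lfloor>real D * x\<rfloor> < int D" by (simp add: floor_less_iff)
    then show ?thesis using D by linarith
  qed
  then show ?thesis using D by (auto simp: cell_def)
qed

lemma cell_eq_iff:
  assumes "0 < D" "x \<in> {0..<1}"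
  shows "cell D x = k \<longleftrightarrow> real k / real D \<le> x \<and> x < (real k + 1) / real D"
proof -
  have "cell D x = k \<longleftrightarrow> \<lfloor>real D * x\<rfloor> = int k"
    using assms by (auto simp: cell_def)
  also have "\<dots> \<longleftrightarrow> real k \<le> real D * x \<and> real D * x < real k + 1"
    by (auto simp: floor_eq_iff)
  finally show ?thesis using assms by (simp add: field_simps)
qed

lemma measurable_cell [measurable]: "cell D \<in> measurable borel (count_space UNIV)"
  unfolding cell_def[abs_def] by measurable

lemma integral_finite_valued:
  fixes \<phi> :: "nat \<Rightarrow> real"
  assumes "prob_space M" and c [measurable]: "c \<in> measurable M (count_space UNIV)" and "\<And>x. c x < D"
  shows "(\<integral>x. \<phi> (c x) \<partial>M) = (\<Sum>k<D. \<phi> k * measure M {x \<in> space M. c x = k})"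
proof -
  interpret prob_space M by fact
  have "(\<integral>x. \<phi> (c x) \<partial>M) = (\<integral>x. (\<Sum>k<D. \<phi> k * indicator {x \<in> space M. c x = k} x) \<partial>M)"
  proof (rule Bochner_Integration.integral_cong)
    fix x assume "x \<in> space M"
    then have "(\<Sum>k<D. \<phi> k * indicator {x \<in> space M. c x = k} x) = (\<Sum>k<D. \<phi> k * of_bool (c x = k))"
      by (intro sum.cong) (auto simp: indicator_def)
    also have "\<dots> = \<phi> (c x)" using assms(3)[of x] by (simp add: of_bool_def if_distrib cong: if_cong)
    finally show "\<phi> (c x) = (\<Sum>k<D. \<phi> k * indicator {x \<in> space M. c x = k} x)" by simp
  qed simp
  also have "\<dots> = (\<Sum>k<D. \<integral>x. \<phi> k * indicator {x \<in> space M. c x = k} x \<partial>M)"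
    by (rule Bochner_Integration.integral_sum) (auto intro!: integrable_mult_right integrable_real_indicator simp: emeasure_eq_measure)
  also have "\<dots> = (\<Sum>k<D. \<phi> k * measure M {x \<in> space M. c x = k})"
    by (intro sum.cong refl) simp
  finally show ?thesis .
qed

lemma prob_density_measurable: "prob_density f \<Longrightarrow> f \<in> borel_measurable borel"
  using has_bochner_integral_iff[of lborel f 1] by (auto simp: prob_density_def dest: borel_measurable_integrable)

lemma prob_space_density:
  assumes f: "prob_density f"
  shows "prob_space (density lborel (\<lambda>x. ennreal (f x)))"
proof (rule prob_spaceI)
  have "integrable lborel f" "(\<integral>x. f x \<partial>lborel) = 1" "\<And>x. 0 \<le> f x"
    using f by (auto simp: prob_density_def has_bochner_integral_iff)
  then have "(\<integral>\<^sup>+x. ennreal (f x) \<partial>lborel) = 1" by (subst nn_integral_eq_integral) auto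
  then show "emeasure (density lborel (\<lambda>x. ennreal (f x))) (space (density lborel (\<lambda>x. ennreal (f x)))) = 1"
    using prob_density_measurable[OF f] by (simp add: emeasure_density)
qed

lemma AE_unit_interval:
  assumes f: "prob_density f" and supp: "\<And>x. x \<notin> {0..1} \<Longrightarrow> f x = 0"
  shows "AE x in density lborel (\<lambda>x. ennreal (f x)). x \<in> {0..<1}"
proof -
  have "AE x in lborel. 0 < ennreal (f x) \<longrightarrow> x \<in> {0..<1}"
    using AE_lborel_singleton[of "1::real"]
  proof eventually_elim
    case (elim x)
    then show ?case using supp[of x] by (cases "x \<in> {0..1}") auto
  qed
  then show ?thesis using prob_density_measurable[OF f] by (simp add: AE_density del: atLeastLessThan_iff)
qed

text \<open>Closed bins are used on the right-hand side, in view of the mean value theorem on each of them.\<close>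
lemma prob_cell:
  assumes f: "prob_density f" and supp: "\<And>x. x \<notin> {0..1} \<Longrightarrow> f x = 0" and D: "0 < D" and k: "k < D"
  shows "measure (density lborel (\<lambda>x. ennreal (f x))) {x \<in> space (density lborel (\<lambda>x. ennreal (f x))). cell D x = k}
    = (LINT x:{real k / real D..(real k + 1) / real D}|lborel. f x)"
proof -
  note [measurable] = prob_density_measurable[OF f]
  let ?A = "{x. cell D x = k}"
  let ?M = "density lborel (\<lambda>x. ennreal (f x))"
  have pos: "\<And>x. 0 \<le> f x" using f by (auto simp: prob_density_def)
  interpret prob_space ?M by (rule prob_space_density[OF f])
  have A: "?A \<in> sets borel" by measurable
  have "measure ?M ?A = (\<integral>x. indicator ?A x \<partial>?M)" using A by simp
  also have "\<dots> = (\<integral>x. f x * indicator ?A x \<partial>lborel)"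
    using A pos by (subst integral_density) auto
  also have "\<dots> = (\<integral>x. indicator {real k / real D..(real k + 1) / real D} x * f x \<partial>lborel)"
  proof (rule integral_cong_AE)
    show "AE x in lborel. f x * indicator ?A x = indicator {real k / real D..(real k + 1) / real D} x * f x"
      using AE_lborel_singleton[of "1::real"] AE_lborel_singleton[of "(real k + 1) / real D"]
    proof eventually_elim
      case (elim x)
      show ?case
      proof (cases "x \<in> {0..<1}")
        case True
        then show ?thesis using cell_eq_iff[OF D True, of k] elim by (auto simp: indicator_def)
      next
        case False
        then have "f x = 0" using supp[of x] elim by (cases "x \<in> {0..1}") auto
        then show ?thesis by simp
      qed
    qed
  qed (use A in auto)
  finally show ?thesis by (simp add: set_lebesgue_integral_def)
qed

lemma prob_density_uniform: "prob_density (indicator {0..1})"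
  unfolding prob_density_def
  using has_bochner_integral_real_indicator[of "{0..1::real}" lborel] by auto

lemma prob_cell_uniform:
  assumes "0 < D" "k < D"
  shows "measure (density lborel (\<lambda>x. ennreal (indicator {0..1} x))) {x \<in> space (density lborel (\<lambda>x. ennreal (indicator {0..1} x))). cell D x = k}
    = 1 / real D"
proof -
  have sub: "{real k / real D..(real k + 1) / real D} \<inter> {0..1} = {real k / real D..(real k + 1) / real D}"
  proof (rule Int_absorb2)
    show "{real k / real D..(real k + 1) / real D} \<subseteq> {0..1}"
      using assms by (simp add: field_simps)
  qed
  have "(LINT x:{real k / real D..(real k + 1) / real D}|lborel. indicator {0..1} x)
      = (\<integral>x. indicator ({real k / real D..(real k + 1) / real D} \<inter> {0..1}) x \<partial>lborel :: real)"
    by (simp only: set_lebesgue_integral_def indicator_inter_arith real_scaleR_def)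
  also have "\<dots> = 1 / real D"
    unfolding sub using assms by (simp add: divide_right_mono diff_divide_distrib[symmetric])
  finally show ?thesis
    using assms by (subst prob_cell[OF prob_density_uniform]) auto
qed

section \<open>Hoelder functions are controlled by their bin averages\<close>

text \<open>
  The interval \<open>[b/N, (b+1)/N]\<close> is a block of \<open>r\<close> consecutive bins. The average of \<open>d 0\<close> over a bin is a
  value \<open>d 0 (\<xi> i)\<close> at some point of that bin. Taking every second bin makes the points \<open>\<xi> i\<close> separated by
  \<open>1 / D\<close>, so they determine the Taylor polynomial on the block, with a constant that depends only on
  \<open>r\<close> and \<open>m\<close>.
\<close>
lemma block_sup_le_bin_averages:
  fixes d :: "nat \<Rightarrow> real \<Rightarrow> real" and R s2 :: real and m r N D b :: nat
  defines "a \<equiv> \<lambda>k. LINT y:{real k / real D..(real k + 1) / real D}|lborel. d 0 y"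
  defines "\<epsilon> \<equiv> R * (1 / real N) powr s2 * (1 / real N) ^ m"
  assumes der: "\<And>i x. i < m \<Longrightarrow> x \<in> {0..1} \<Longrightarrow> (d i has_real_derivative d (Suc i) x) (at x within {0..1})"
    and osc: "\<And>x y. x \<in> {0..1} \<Longrightarrow> y \<in> {0..1} \<Longrightarrow> \<bar>d m x - d m y\<bar> \<le> R * \<bar>x - y\<bar> powr s2"
    and cont: "continuous_on {0..1} (d 0)" and R: "0 \<le> R" and s2: "0 \<le> s2"
    and r: "2 * (m + 1) \<le> r" and D: "D = r * N" and b: "b < N"
    and x: "x \<in> {real b / real N..(real b + 1) / real N}"
  shows "\<bar>d 0 x\<bar> \<le> real r ^ m * (\<Sum>i\<le>m. \<bar>real D * a (b * r + 2 * i)\<bar>) + (real (m + 1) * real r ^ m + 1) * \<epsilon>"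
proof -
  have N: "0 < real N" "0 < real r" "0 < real D" using b r D by auto
  let ?a = "real b / real N" and ?h = "1 / real N"
  have ah: "0 \<le> ?a" "?a + ?h \<le> 1" "0 \<le> ?h"
    using N b by (auto simp: field_simps)
  have x': "x \<in> {?a..?a + ?h}" using x by (simp add: add_divide_distrib)
  have "\<exists>p. degree p \<le> m \<and> (\<forall>x\<in>{?a..?a + ?h}. \<bar>d 0 x - poly p x\<bar> \<le> R * ?h powr s2 * ?h ^ m)"
  proof (rule taylor_polynomial[where d = d and m = m, OF der])
    fix z assume z: "z \<in> {?a..?a + ?h}"
    have "0 \<le> z" using z by (intro order_trans[OF ah(1), of z]) simp
    then have "\<bar>d m z - d m ?a\<bar> \<le> R * \<bar>z - ?a\<bar> powr s2" using z ah by (intro osc) auto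
    also have "\<dots> \<le> R * ?h powr s2" using z s2 R by (intro mult_left_mono powr_mono2) auto
    finally show "\<bar>d m z - d m ?a\<bar> \<le> R * ?h powr s2" .
  qed (use ah in auto)
  then obtain p where p: "degree p \<le> m" "\<And>z. z \<in> {?a..?a + ?h} \<Longrightarrow> \<bar>d 0 z - poly p z\<bar> \<le> \<epsilon>"
    unfolding \<epsilon>_def by blast
  let ?l = "\<lambda>i. real (b * r + 2 * i) / real D" and ?u = "\<lambda>i. (real (b * r + 2 * i) + 1) / real D"
  have in_block: "{?l i..?u i} \<subseteq> {?a..?a + ?h}" if "i \<le> m" for i
  proof -
    have "?a = real (b * r) / real D" using N by (simp add: D)
    also have "\<dots> \<le> ?l i" using N by (intro divide_right_mono) auto
    finally have 1: "?a \<le> ?l i" .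
    have "?u i \<le> real (b * r + r) / real D"
      using that r N by (intro divide_right_mono) (auto simp flip: of_nat_add of_nat_mult of_nat_Suc)
    also have "\<dots> = ?a + ?h" using N by (simp add: D field_simps)
    finally show ?thesis using 1 by auto
  qed
  have "\<exists>\<xi>\<in>{?l i..?u i}. a (b * r + 2 * i) = (?u i - ?l i) * d 0 \<xi>" if "i \<le> m" for i
    unfolding a_def
  proof (rule mean_value_point)
    show "continuous_on {?l i..?u i} (d 0)"
      using in_block[OF that] ah by (intro continuous_on_subset[OF cont]) auto
    show "?l i < ?u i" using N by (simp add: divide_strict_right_mono)
  qed
  then obtain \<xi> where \<xi>: "\<And>i. i \<le> m \<Longrightarrow> \<xi> i \<in> {?l i..?u i}"
      "\<And>i. i \<le> m \<Longrightarrow> a (b * r + 2 * i) = (?u i - ?l i) * d 0 (\<xi> i)"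
    by metis
  have val: "d 0 (\<xi> i) = real D * a (b * r + 2 * i)" if "i \<le> m" for i
    using \<xi>(2)[OF that] N by (simp add: diff_divide_distrib[symmetric])
  have sep_less: "1 / real D \<le> \<xi> j - \<xi> i" if "i < j" "j \<le> m" for i j
  proof -
    have "?u i + 1 / real D \<le> ?l j"
      unfolding add_divide_distrib[symmetric]
      using that N by (intro divide_right_mono) (auto simp flip: of_nat_add of_nat_mult of_nat_Suc)
    then show ?thesis using \<xi>(1)[of i] \<xi>(1)[of j] that by auto
  qed
  have "\<bar>poly p x\<bar> \<le> real r ^ m * (\<Sum>i\<le>m. \<bar>poly p (\<xi> i)\<bar>)"
  proof (rule poly_bound_by_separated_values[OF p(1), where \<delta> = "1 / real D"])
    show "1 / real D \<le> \<bar>\<xi> i - \<xi> j\<bar>" if "i \<le> m" "j \<le> m" "i \<noteq> j" for i j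
      using sep_less[of i j] sep_less[of j i] that by linarith
    show "\<bar>x - \<xi> i\<bar> \<le> real r * (1 / real D)" if "i \<le> m" for i
    proof -
      have "\<xi> i \<in> {?a..?a + ?h}" using \<xi>(1)[OF that] in_block[OF that] by blast
      then have "\<bar>x - \<xi> i\<bar> \<le> ?h" using x' by auto
      also have "?h = real r * (1 / real D)" using N by (simp add: D)
      finally show ?thesis .
    qed
  qed (use N r in auto)
  also have "\<dots> \<le> real r ^ m * (\<Sum>i\<le>m. \<bar>real D * a (b * r + 2 * i)\<bar> + \<epsilon>)"
  proof (intro mult_left_mono sum_mono)
    fix i assume "i \<in> {..m}"
    then have i: "i \<le> m" by simp
    have "\<bar>d 0 (\<xi> i) - poly p (\<xi> i)\<bar> \<le> \<epsilon>" using \<xi>(1)[OF i] in_block[OF i] by (intro p(2)) blast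
    then show "\<bar>poly p (\<xi> i)\<bar> \<le> \<bar>real D * a (b * r + 2 * i)\<bar> + \<epsilon>" using val[OF i] by linarith
  qed simp
  also have "\<dots> = real r ^ m * (\<Sum>i\<le>m. \<bar>real D * a (b * r + 2 * i)\<bar>) + real (m + 1) * real r ^ m * \<epsilon>"
    by (simp add: sum.distrib algebra_simps)
  finally show ?thesis using p(2)[OF x'] by (simp add: algebra_simps)
qed

text \<open>
  Square the pointwise bound on each block and integrate. On the right-hand side the bins of one block
  are collected first, then the blocks.
\<close>
lemma square_integral_le_binned_energy:
  fixes d :: "nat \<Rightarrow> real \<Rightarrow> real" and g :: "real \<Rightarrow> real" and R s2 :: real and m r N D :: nat
  defines "a \<equiv> \<lambda>k. LINT y:{real k / real D..(real k + 1) / real D}|lborel. g y"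
  defines "\<epsilon> \<equiv> R * (1 / real N) powr s2 * (1 / real N) ^ m"
  assumes der: "\<And>i x. i < m \<Longrightarrow> x \<in> {0..1} \<Longrightarrow> (d i has_real_derivative d (Suc i) x) (at x within {0..1})"
    and osc: "\<And>x y. x \<in> {0..1} \<Longrightarrow> y \<in> {0..1} \<Longrightarrow> \<bar>d m x - d m y\<bar> \<le> R * \<bar>x - y\<bar> powr s2"
    and g: "\<And>x. x \<in> {0..1} \<Longrightarrow> g x = d 0 x" and gm [measurable]: "g \<in> borel_measurable borel"
    and cont: "continuous_on {0..1} (d 0)" and R: "0 \<le> R" and s2: "0 \<le> s2"
    and r: "2 * (m + 1) \<le> r" and D: "D = r * N" and N: "0 < N"
  shows "(LINT x:{0..1}|lborel. (g x)\<^sup>2)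
    \<le> 2 * real r ^ (2 * m + 1) * real (m + 1) * (real D * (\<Sum>k<D. (a k)\<^sup>2))
      + 2 * (real (m + 1) * real r ^ m + 1)\<^sup>2 * \<epsilon>\<^sup>2"
proof -
  let ?U = "density lborel (\<lambda>x. ennreal (indicator {0..1::real} x))"
  interpret prob_space ?U by (rule prob_space_density[OF prob_density_uniform])
  define c where "c = real (m + 1) * real r ^ m + 1"
  define S where "S b = (\<Sum>k\<in>{b * r..<b * r + r}. (real D * a k)\<^sup>2)" for b
  define \<phi> where "\<phi> b = 2 * real r ^ (2 * m) * real (m + 1) * S b + 2 * c\<^sup>2 * \<epsilon>\<^sup>2" for b
  have a_eq: "a k = (LINT y:{real k / real D..(real k + 1) / real D}|lborel. d 0 y)" if "k < D" for k
    unfolding a_def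
  proof (rule set_lebesgue_integral_cong)
    have "real k / real D \<ge> 0" "(real k + 1) / real D \<le> 1" using that by (auto simp: field_simps)
    then have "{real k / real D..(real k + 1) / real D} \<subseteq> {0..1}" by (simp only: atLeastatMost_subset_iff) auto
    then show "\<forall>x. x \<in> {real k / real D..(real k + 1) / real D} \<longrightarrow> g x = d 0 x" using g by blast
  qed simp
  have pointwise: "(g x)\<^sup>2 \<le> \<phi> (cell N x)" if x: "x \<in> {0..<1}" for x
  proof -
    let ?b = "cell N x"
    have b: "?b < N" by (rule cell_less[OF N])
    have xb: "x \<in> {real ?b / real N..(real ?b + 1) / real N}"
      using cell_eq_iff[OF N x, of ?b] by auto
    have idx: "?b * r + 2 * i \<in> {?b * r..<?b * r + r}" "?b * r + 2 * i < D" if "i \<le> m" for i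
    proof -
      show "?b * r + 2 * i \<in> {?b * r..<?b * r + r}" using that r by auto
      then have "?b * r + 2 * i < (?b + 1) * r" by simp
      also have "\<dots> \<le> N * r" using b by (intro mult_right_mono) auto
      finally show "?b * r + 2 * i < D" by (simp add: D mult.commute)
    qed
    let ?T = "\<Sum>i\<le>m. \<bar>real D * a (?b * r + 2 * i)\<bar>"
    have "\<bar>g x\<bar> \<le> real r ^ m * ?T + c * \<epsilon>"
    proof -
      have "?T = (\<Sum>i\<le>m. \<bar>real D * (LINT y:{real (?b * r + 2 * i) / real D..(real (?b * r + 2 * i) + 1) / real D}|lborel. d 0 y)\<bar>)"
        using a_eq[OF idx(2)] by (intro sum.cong) auto
      then show ?thesis
        using block_sup_le_bin_averages[OF der osc cont R s2 r D b xb] g[of x] x unfolding c_def \<epsilon>_def by simp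
    qed
    then have "(g x)\<^sup>2 \<le> (real r ^ m * ?T + c * \<epsilon>)\<^sup>2"
      using power_mono[OF _ abs_ge_zero, of "g x" _ 2] by simp
    also have "\<dots> \<le> 2 * (real r ^ m * ?T)\<^sup>2 + 2 * (c * \<epsilon>)\<^sup>2"
    proof -
      have "(u + v)\<^sup>2 \<le> 2 * u\<^sup>2 + 2 * v\<^sup>2" for u v :: real
        using zero_le_power2[of "u - v"] by (simp add: power2_eq_square algebra_simps)
      then show ?thesis .
    qed
    also have "\<dots> = 2 * real r ^ (2 * m) * ?T\<^sup>2 + 2 * c\<^sup>2 * \<epsilon>\<^sup>2"
      by (simp add: power_mult_distrib power_mult[symmetric] mult.commute)
    also have "\<dots> \<le> 2 * real r ^ (2 * m) * (real (m + 1) * S ?b) + 2 * c\<^sup>2 * \<epsilon>\<^sup>2"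
    proof (intro add_right_mono mult_left_mono)
      have "?T\<^sup>2 \<le> (\<Sum>i\<le>m. \<bar>real D * a (?b * r + 2 * i)\<bar>\<^sup>2) * real (card {..m})"
        by (rule sum_squared_le_sum_of_squares)
      also have "(\<Sum>i\<le>m. \<bar>real D * a (?b * r + 2 * i)\<bar>\<^sup>2) = (\<Sum>k\<in>(\<lambda>i. ?b * r + 2 * i) ` {..m}. (real D * a k)\<^sup>2)"
        by (subst sum.reindex) (auto simp: inj_on_def)
      also have "\<dots> \<le> S ?b"
        unfolding S_def using idx(1) by (intro sum_mono2) auto
      finally show "?T\<^sup>2 \<le> real (m + 1) * S ?b" by (simp add: mult.commute mult_left_mono add.commute)
    qed simp
    finally show ?thesis unfolding \<phi>_def by (simp add: mult.assoc)
  qed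
  have "(LINT x:{0..1}|lborel. (g x)\<^sup>2) = (\<integral>x. (g x)\<^sup>2 \<partial>?U)"
    by (subst integral_density) (auto simp: set_lebesgue_integral_def)
  also have "\<dots> \<le> (\<integral>x. \<phi> (cell N x) \<partial>?U)"
  proof (rule integral_mono_AE')
    show "integrable ?U (\<lambda>x. \<phi> (cell N x))"
    proof (rule integrable_const_bound[where B = "\<Sum>b<N. \<bar>\<phi> b\<bar>"])
      show "AE x in ?U. norm (\<phi> (cell N x)) \<le> (\<Sum>b<N. \<bar>\<phi> b\<bar>)"
        using cell_less[OF N] by (intro AE_I2) (auto intro!: member_le_sum[of _ _ "\<lambda>b. \<bar>\<phi> b\<bar>"])
    qed measurable
    show "AE x in ?U. (g x)\<^sup>2 \<le> \<phi> (cell N x)"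
      by (rule eventually_mono[OF AE_unit_interval[OF prob_density_uniform] pointwise]) simp
    show "AE x in ?U. 0 \<le> \<phi> (cell N x)"
      unfolding \<phi>_def S_def by (intro AE_I2 add_nonneg_nonneg mult_nonneg_nonneg sum_nonneg) auto
  qed
  also have "\<dots> = (\<Sum>b<N. \<phi> b * (1 / real N))"
    by (subst integral_finite_valued[OF prob_space_axioms _ cell_less[OF N]])
      (auto intro!: sum.cong simp: prob_cell_uniform[OF N, simplified])
  also have "\<dots> = 2 * real r ^ (2 * m) * real (m + 1) * ((\<Sum>b<N. S b) / real N) + 2 * c\<^sup>2 * \<epsilon>\<^sup>2"
    using N unfolding \<phi>_def
    by (simp add: sum.distrib sum_distrib_left[symmetric] sum_divide_distrib[symmetric] add_divide_distrib)
  also have "(\<Sum>b<N. S b) = (\<Sum>k<D. (real D * a k)\<^sup>2)"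
    unfolding S_def sum.nat_group by (simp add: D mult.commute)
  also have "\<dots> / real N = real r * (real D * (\<Sum>k<D. (a k)\<^sup>2))"
  proof -
    have "(\<Sum>k<D. (real D * a k)\<^sup>2) = (real D)\<^sup>2 * (\<Sum>k<D. (a k)\<^sup>2)"
      by (simp add: power_mult_distrib sum_distrib_left)
    moreover have "(real D)\<^sup>2 / real N = real r * real D"
      using N by (simp add: D power2_eq_square)
    ultimately show ?thesis by (metis mult.assoc times_divide_eq_left)
  qed
  finally show ?thesis unfolding c_def by (simp add: mult_ac)
qed

text \<open>
  The number of derivatives and the exponent in the definition of the class are determined by \<open>s\<close>, so the
  constants depend on \<open>s\<close> and \<open>R\<close> only. A block of \<open>r = 2 ^ (m + 1)\<close> bins is long enough to provide
  \<open>m + 1\<close> pairwise nonadjacent bins, and it is compatible with the dyadic dimensions.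
\<close>
lemma hoelder_distance_le_binned_energy:
  fixes s R :: real
  defines "m \<equiv> nat (\<lceil>s\<rceil> - 1)"
  defines "r \<equiv> 2 ^ (m + 1) :: nat"
  assumes f: "f \<in> holder_class s R" and fm [measurable]: "f \<in> borel_measurable borel"
    and R: "0 \<le> R" and D: "D = r * N" and N: "0 < N"
  shows "(LINT x:{0..1}|lborel. (f x - 1)\<^sup>2)
    \<le> 2 * real r ^ (2 * m + 1) * real (m + 1) * (real D * (\<Sum>k<D. (LINT y:{real k / real D..(real k + 1) / real D}|lborel. f y - 1)\<^sup>2))
      + 2 * (real (m + 1) * real r ^ m + 1)\<^sup>2 * R\<^sup>2 * real r powr (2 * s) * real D powr (- (2 * s))"
proof -
  obtain s1 :: nat and s2 and d where s: "s = real s1 + s2" "0 < s2" "s2 \<le> 1"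
    and d0: "\<forall>x\<in>{0..1}. d 0 x = f x"
    and der: "\<forall>i<s1. \<forall>x\<in>{0..1}. (d i has_real_derivative d (Suc i) x) (at x within {0..1})"
    and osc: "\<forall>x\<in>{0..1}. \<forall>y\<in>{0..1}. \<bar>d s1 x - d s1 y\<bar> \<le> R * \<bar>x - y\<bar> powr s2"
    using f unfolding holder_class_def by blast
  have "\<lceil>s\<rceil> = int s1 + 1" using s by (simp add: ceiling_eq_iff)
  then have m: "m = s1" by (simp add: m_def)
  define d' where "d' = d(0 := \<lambda>x. d 0 x - 1)"
  have der': "(d' i has_real_derivative d' (Suc i) x) (at x within {0..1})" if "i < m" "x \<in> {0..1}" for i x
    using der that m by (cases i) (auto simp: d'_def intro!: derivative_eq_intros)
  have osc': "\<bar>d' m x - d' m y\<bar> \<le> R * \<bar>x - y\<bar> powr s2" if "x \<in> {0..1}" "y \<in> {0..1}" for x y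
    using osc that m by (cases m) (auto simp: d'_def)
  have cont: "continuous_on {0..1} (d' 0)"
  proof (cases "m = 0")
    case False
    then have "\<And>x. x \<in> {0..1} \<Longrightarrow> (d' 0 has_real_derivative d' (Suc 0) x) (at x within {0..1})"
      using der'[of 0] by simp
    then show ?thesis by (meson DERIV_continuous_on)
  next
    case True
    show ?thesis unfolding continuous_on_def
    proof
      fix x :: real assume x: "x \<in> {0..1}"
      have "((\<lambda>y. R * \<bar>y - x\<bar> powr s2) \<longlongrightarrow> R * \<bar>x - x\<bar> powr s2) (at x within {0..1})"
        using s(2) by (intro tendsto_intros) auto
      then have lim: "((\<lambda>y. R * \<bar>y - x\<bar> powr s2) \<longlongrightarrow> 0) (at x within {0..1})" by simp
      have "((\<lambda>y. d' 0 y - d' 0 x) \<longlongrightarrow> 0) (at x within {0..1})"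
      proof (rule Lim_null_comparison[OF _ lim])
        show "\<forall>\<^sub>F y in at x within {0..1}. norm (d' 0 y - d' 0 x) \<le> R * \<bar>y - x\<bar> powr s2"
          using osc'[OF _ x] True by (auto simp: eventually_at_filter)
      qed
      then show "(d' 0 \<longlongrightarrow> d' 0 x) (at x within {0..1})" by (rule LIM_zero_cancel)
    qed
  qed
  have r: "2 * (m + 1) \<le> r"
  proof -
    have "m < 2 ^ m" by (rule less_exp)
    then have "2 * (m + 1) \<le> 2 * 2 ^ m" by (intro mult_le_mono2) (simp add: Suc_le_eq)
    then show ?thesis unfolding r_def by (simp only: power_add power_one_right mult.commute)
  qed
  let ?\<epsilon> = "R * (1 / real N) powr s2 * (1 / real N) ^ m"
  have "(LINT x:{0..1}|lborel. (f x - 1)\<^sup>2)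
    \<le> 2 * real r ^ (2 * m + 1) * real (m + 1) * (real D * (\<Sum>k<D. (LINT y:{real k / real D..(real k + 1) / real D}|lborel. f y - 1)\<^sup>2))
      + 2 * (real (m + 1) * real r ^ m + 1)\<^sup>2 * ?\<epsilon>\<^sup>2"
    by (rule square_integral_le_binned_energy[where d = d', OF der' osc' _ _ cont R _ r D N]) (use d0 s in \<open>auto simp: d'_def\<close>)
  also have "?\<epsilon>\<^sup>2 = R\<^sup>2 * real r powr (2 * s) * real D powr (- (2 * s))"
  proof -
    have pos: "real r > 0" "real N > 0" using r N by auto
    have "(1 / real N) powr s2 * (1 / real N) ^ m = (1 / real N) powr s"
      using pos by (simp add: powr_realpow[symmetric] powr_add[symmetric] s(1) m add.commute)
    then have e1: "?\<epsilon> = R * (1 / real N) powr s" by (simp add: mult.assoc)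
    have e2: "((1 / real N) powr s)\<^sup>2 = (1 / real N) powr (2 * s)"
      using pos by (simp add: powr_power mult.commute)
    have e3: "(1 / real N) powr (2 * s) = real r powr (2 * s) * real D powr (- (2 * s))"
      using pos by (simp add: D powr_divide powr_mult powr_minus_divide)
    show ?thesis unfolding e1 power_mult_distrib e2 e3 by (simp only: mult.assoc)
  qed
  finally show ?thesis by (simp add: mult.assoc)
qed

section \<open>The projection statistic under the null and under an alternative\<close>

lemma prob_space_sample_law: "prob_density f \<Longrightarrow> prob_space (sample_law n f)"
  unfolding sample_law_def by (rule prob_space_PiM) (rule prob_space_density)

lemma AE_sample_law:
  assumes "prob_density f" "\<And>x. x \<notin> {0..1} \<Longrightarrow> f x = 0"
  shows "AE X in sample_law n f. \<forall>i\<in>{1..n}. X i \<in> {0..<1}"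
  unfolding sample_law_def
proof (rule AE_finite_allI)
  fix i assume "i \<in> {1..n}"
  then show "AE X in Pi\<^sub>M {1..n} (\<lambda>_. density lborel (\<lambda>x. ennreal (f x))). X i \<in> {0..<1}"
    by (intro AE_PiM_component prob_space_density assms AE_unit_interval) auto
qed simp

text \<open>
  For a fixed sample only the finitely many bins that contain an observation contribute to the sum over
  all integers.
\<close>
lemma theta_hat_eq:
  assumes D: "0 < D"
  shows "theta_hat n D X = off_diag_sum n (\<lambda>x y. real D * of_bool (\<lfloor>real D * x\<rfloor> = \<lfloor>real D * y\<rfloor>)) X
    / (real n * (real n - 1))"
proof -
  have bin: "bin_fun D k x = sqrt (real D) * of_bool (\<lfloor>real D * x\<rfloor> = k)" for k x
  proof -
    have "x \<in> {real_of_int k / real D..<(real_of_int k + 1) / real D} \<longleftrightarrow> \<lfloor>real D * x\<rfloor> = k"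
      using D by (simp add: floor_eq_iff field_simps)
    then show ?thesis by (simp add: bin_fun_def indicator_def)
  qed
  let ?S = "(\<lambda>i. \<lfloor>real D * X i\<rfloor>) ` {1..n}"
  let ?F = "\<lambda>k. \<Sum>i\<in>{1..n}. \<Sum>j\<in>{1..n} - {i}. bin_fun D k (X i) * bin_fun D k (X j)"
  have "(\<Sum>\<^sub>\<infinity>k\<in>(UNIV::int set). ?F k) = (\<Sum>\<^sub>\<infinity>k\<in>?S. ?F k)"
  proof (rule infsum_cong_neutral)
    fix k assume "k \<in> UNIV - ?S"
    then have "\<lfloor>real D * X i\<rfloor> \<noteq> k" if "i \<in> {1..n}" for i using that by blast
    then show "?F k = 0" by (intro sum.neutral ballI) (simp add: bin)
  qed auto
  also have "\<dots> = (\<Sum>k\<in>?S. ?F k)" by (rule infsum_finite) simp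
  also have "\<dots> = (\<Sum>i\<in>{1..n}. \<Sum>j\<in>{1..n} - {i}. \<Sum>k\<in>?S. bin_fun D k (X i) * bin_fun D k (X j))"
    by (subst sum.swap) (intro sum.cong refl sum.swap)
  also have "\<dots> = off_diag_sum n (\<lambda>x y. real D * of_bool (\<lfloor>real D * x\<rfloor> = \<lfloor>real D * y\<rfloor>)) X"
    unfolding off_diag_sum_def
  proof (intro sum.cong refl)
    fix i j assume i: "i \<in> {1..n}"
    have "(\<Sum>k\<in>?S. bin_fun D k (X i) * bin_fun D k (X j))
        = (\<Sum>k\<in>?S. if k = \<lfloor>real D * X i\<rfloor> then real D * of_bool (\<lfloor>real D * X i\<rfloor> = \<lfloor>real D * X j\<rfloor>) else 0)"
      by (intro sum.cong refl) (auto simp: bin)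
    also have "\<dots> = real D * of_bool (\<lfloor>real D * X i\<rfloor> = \<lfloor>real D * X j\<rfloor>)"
      using i by (subst sum.delta) auto
    finally show "(\<Sum>k\<in>?S. bin_fun D k (X i) * bin_fun D k (X j)) = real D * of_bool (\<lfloor>real D * X i\<rfloor> = \<lfloor>real D * X j\<rfloor>)" .
  qed
  finally show ?thesis unfolding theta_hat_def by simp
qed

definition coincidence :: "nat \<Rightarrow> real \<Rightarrow> real \<Rightarrow> real" where
  "coincidence D x y = of_bool (cell D x = cell D y)"

lemma norm2_uniform: "norm2 (indicator {0..1}) = 1"
proof -
  have "(\<lambda>x::real. (indicator {0..1} x :: real)\<^sup>2) = indicator {0..1}"
    by (auto simp: indicator_def)
  then show ?thesis by (simp add: norm2_def)
qed

lemma T_hat_eq: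
  assumes D: "0 < D" and n: "2 \<le> n" and X: "\<forall>i\<in>{1..n}. X i \<in> {0..<1}"
  shows "T_hat n (indicator {0..1}) D X
    = off_diag_sum n (\<lambda>x y. real D * coincidence D x y) X / (real n * (real n - 1)) - 1"
proof -
  have same: "\<lfloor>real D * x\<rfloor> = \<lfloor>real D * y\<rfloor> \<longleftrightarrow> cell D x = cell D y" if "x \<in> {0..<1}" "y \<in> {0..<1}" for x y
  proof -
    have "int (cell D z) = \<lfloor>real D * z\<rfloor>" if "z \<in> {0..<1}" for z
      using that by (simp add: cell_def)
    then show ?thesis using that by (metis of_nat_eq_iff)
  qed
  have "theta_hat n D X = off_diag_sum n (\<lambda>x y. real D * coincidence D x y) X / (real n * (real n - 1))"
    unfolding theta_hat_eq[OF D] off_diag_sum_def coincidence_def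
    using X same by (intro arg_cong2[where f = "(/)"] sum.cong refl) auto
  moreover have "(\<Sum>i\<in>{1..n}. indicator {0..1} (X i)) = (\<Sum>i\<in>{1..n}. 1::real)"
  proof (intro sum.cong refl)
    fix i assume "i \<in> {1..n}"
    then have "X i \<in> {0..<1}" using X by blast
    then show "indicator {0..1} (X i) = (1::real)" by simp
  qed
  ultimately show ?thesis using n by (simp add: T_hat_def norm2_uniform)
qed

lemma T_hat_centred_eq:
  assumes D: "0 < D" and n: "2 \<le> n" and X: "\<forall>i\<in>{1..n}. X i \<in> {0..<1}"
  shows "T_hat n (indicator {0..1}) D X * (real n * (real n - 1))
    = off_diag_sum n (\<lambda>x y. real D * coincidence D x y - 1) X"
proof -
  have "off_diag_sum n (\<lambda>x y. real D * coincidence D x y - 1) X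
    = off_diag_sum n (\<lambda>x y. real D * coincidence D x y) X - (\<Sum>i\<in>{1..n}. real (card ({1..n} - {i})))"
    unfolding off_diag_sum_def by (simp add: sum_subtractf)
  also have "(\<Sum>i\<in>{1..n}. real (card ({1..n} - {i}))) = (\<Sum>i\<in>{1..n}. real n - 1)"
    using n by (intro sum.cong refl) (simp add: card_Diff_singleton of_nat_diff)
  finally show ?thesis
    unfolding T_hat_eq[OF assms] using n by (simp add: left_diff_distrib)
qed

lemma measurable_T_hat:
  assumes "0 < D"
  shows "T_hat n (indicator {0..1}) D \<in> borel_measurable (sample_law n f)"
proof -
  let ?M = "density lborel (\<lambda>x. ennreal (f x))"
  have k: "case_prod (\<lambda>x y. real D * of_bool (\<lfloor>real D * x\<rfloor> = \<lfloor>real D * y\<rfloor>)) \<in> borel_measurable (?M \<Otimes>\<^sub>M ?M)"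
    by measurable
  have "(\<lambda>X. off_diag_sum n (\<lambda>x y. real D * of_bool (\<lfloor>real D * x\<rfloor> = \<lfloor>real D * y\<rfloor>)) X)
      \<in> borel_measurable (sample_law n f)"
    unfolding sample_law_def by (rule measurable_off_diag_sum[OF k])
  moreover have "(\<lambda>X. \<Sum>i\<in>{1..n}. indicator {0..1} (X i) :: real) \<in> borel_measurable (sample_law n f)"
    unfolding sample_law_def by (rule measurable_sum_component) auto
  ultimately show ?thesis
    unfolding T_hat_def[abs_def] theta_hat_eq[OF assms] by measurable
qed

lemma measurable_coincidence:
  "case_prod (\<lambda>x y. coincidence D x y) \<in> borel_measurable (density lborel g \<Otimes>\<^sub>M density lborel g)"
proof -
  have [measurable]: "(\<lambda>x. real (cell D x)) \<in> borel_measurable borel" by measurable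
  have "(\<lambda>p. of_bool (real (cell D (fst p)) = real (cell D (snd p))) :: real)
      \<in> borel_measurable (density lborel g \<Otimes>\<^sub>M density lborel g)"
    by measurable
  then show ?thesis by (simp add: coincidence_def case_prod_beta)
qed

text \<open>
  Under the uniform law all cells have the same probability, which makes the kernel
  \<open>D * coincidence D x y - 1\<close> centred and reproducing. The exponential moment of a coincidence is at most
  \<open>1 + (exp 1 - 1) / D \<le> exp (2 / D)\<close>.
\<close>
lemma T_hat_null_upper_tail:
  fixes l \<tau> :: real
  assumes D: "0 < D" and n: "2 \<le> n" and l: "0 < l" "16 * l * real n \<le> 1"
  shows "measure (sample_law n (indicator {0..1})) {X \<in> space (sample_law n (indicator {0..1})). \<tau> < T_hat n (indicator {0..1}) D X}
    \<le> exp (8 * l\<^sup>2 * real D * (real n)\<^sup>2 - l * (\<tau> * (real n * (real n - 1))))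
      + real n * exp (real n * (2 / real D) - 1 / (4 * l * real D))"
proof -
  let ?f0 = "indicator {0..1} :: real \<Rightarrow> real"
  let ?M = "density lborel (\<lambda>x. ennreal (?f0 x))"
  let ?P = "sample_law n ?f0"
  let ?h = "\<lambda>x y. real D * coincidence D x y - 1"
  have D': "real D > 0" using D by simp
  interpret M: prob_space ?M by (rule prob_space_density[OF prob_density_uniform])
  interpret P: prob_space ?P by (rule prob_space_sample_law[OF prob_density_uniform])
  have cells: "(\<integral>y. \<phi> (cell D y) \<partial>?M) = (\<Sum>k<D. \<phi> k * (1 / real D))" for \<phi> :: "nat \<Rightarrow> real"
    by (subst integral_finite_valued[OF M.prob_space_axioms _ cell_less[OF D]])
      (auto intro!: sum.cong simp: prob_cell_uniform[OF D, simplified])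
  have pick_cell: "(\<Sum>k<D. of_bool (cell D x = k) * \<phi> k) = \<phi> (cell D x)" for x and \<phi> :: "nat \<Rightarrow> real"
    using cell_less[OF D, of x] by (simp add: of_bool_def if_distrib if_distribR cong: if_cong)
  have h_meas: "case_prod ?h \<in> borel_measurable (?M \<Otimes>\<^sub>M ?M)"
    using measurable_coincidence[of D] by measurable
  have centred: "(\<integral>y. ?h x y \<partial>?M) = 0" for x
  proof -
    have "(\<integral>y. ?h x y \<partial>?M) = (\<Sum>k<D. (real D * of_bool (cell D x = k) - 1) * (1 / real D))"
      unfolding coincidence_def by (rule cells)
    also have "\<dots> = (\<Sum>k<D. of_bool (cell D x = k) * 1 - 1 / real D)"
      using D' by (intro sum.cong refl) (auto simp: field_simps)
    also have "\<dots> = (\<Sum>k<D. of_bool (cell D x = k) * 1) - 1"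
      unfolding sum_subtractf using D' by simp
    finally show ?thesis unfolding pick_cell by simp
  qed
  have repr: "(\<integral>y. ?h x y * ?h x' y \<partial>?M) = ?h x x'" for x x'
  proof -
    have "(\<integral>y. ?h x y * ?h x' y \<partial>?M)
      = (\<Sum>k<D. ((real D * of_bool (cell D x = k) - 1) * (real D * of_bool (cell D x' = k) - 1)) * (1 / real D))"
      unfolding coincidence_def by (rule cells)
    also have "\<dots> = (\<Sum>k<D. of_bool (cell D x = k) * (real D * of_bool (cell D x' = k))
        - of_bool (cell D x = k) * 1 - of_bool (cell D x' = k) * 1 + 1 / real D)"
      using D' by (intro sum.cong refl) (auto simp: field_simps)
    also have "\<dots> = ?h x x'"
      unfolding sum.distrib sum_subtractf pick_cell using D' by (auto simp: coincidence_def)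
    finally show ?thesis .
  qed
  have mom: "(\<integral>\<^sup>+x. ennreal (exp (coincidence D x y)) \<partial>?M) \<le> ennreal (exp (2 / real D))" for y
  proof -
    have "(\<integral>\<^sup>+x. ennreal (exp (coincidence D x y)) \<partial>?M) = ennreal (\<integral>x. exp (coincidence D x y) \<partial>?M)"
    proof (rule nn_integral_eq_integral)
      show "integrable ?M (\<lambda>x. exp (coincidence D x y))"
        by (rule M.integrable_const_bound[where B = "exp 1"]) (auto simp: coincidence_def)
    qed simp
    also have "(\<integral>x. exp (coincidence D x y) \<partial>?M) = (\<Sum>k<D. exp (of_bool (k = cell D y)) * (1 / real D))"
      unfolding coincidence_def by (rule cells)
    also have "\<dots> = (\<Sum>k<D. of_bool (cell D y = k) * ((exp 1 - 1) / real D) + 1 / real D)"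
      using D' by (intro sum.cong refl) (auto simp: field_simps)
    also have "\<dots> = 1 + (exp 1 - 1) / real D" unfolding sum.distrib pick_cell using D' by simp
    also have "\<dots> \<le> 1 + 2 / real D" using exp_le D' by (simp add: divide_right_mono)
    also have "\<dots> \<le> exp (2 / real D)" by (rule exp_ge_add_one_self)
    finally show ?thesis by (simp add: ennreal_leI)
  qed
  have tail: "measure ?P {X \<in> space ?P. \<tau> * (real n * (real n - 1)) < off_diag_sum n ?h X}
    \<le> exp (8 * l\<^sup>2 * real D * (real n)\<^sup>2 - l * (\<tau> * (real n * (real n - 1))))
      + real n * exp (real n * (2 / real D) - 1 / (4 * l * real D))"
    unfolding sample_law_def
  proof (rule canonical_U_statistic_tail[where \<phi> = "coincidence D" and K = "real D + 1"])
    show "\<bar>?h x y\<bar> \<le> real D + 1" for x y by (auto simp: coincidence_def)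
    show "?h x y = ?h y x" for x y by (auto simp: coincidence_def)
    show "?h x x \<le> real D" for x by (simp add: coincidence_def)
    show "?h x y \<le> real D * coincidence D x y" for x y by simp
  qed (use M.prob_space_axioms h_meas centred repr D' measurable_coincidence[of D] mom l in auto)
  have "measure ?P {X \<in> space ?P. \<tau> < T_hat n ?f0 D X} \<le> measure ?P {X \<in> space ?P. \<tau> * (real n * (real n - 1)) < off_diag_sum n ?h X}"
  proof (rule P.finite_measure_mono_AE)
    have "AE X in ?P. \<forall>i\<in>{1..n}. X i \<in> {0..<1}"
      by (rule AE_sample_law[OF prob_density_uniform]) simp
    then show "AE X in ?P. X \<in> {X \<in> space ?P. \<tau> < T_hat n ?f0 D X}
        \<longrightarrow> X \<in> {X \<in> space ?P. \<tau> * (real n * (real n - 1)) < off_diag_sum n ?h X}"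
    proof eventually_elim
      case (elim X)
      have "\<tau> * (real n * (real n - 1)) < T_hat n ?f0 D X * (real n * (real n - 1))" if "\<tau> < T_hat n ?f0 D X"
        using that n by (intro mult_strict_right_mono) auto
      then show ?case using T_hat_centred_eq[OF D n elim] by auto
    qed
    show "{X \<in> space ?P. \<tau> * (real n * (real n - 1)) < off_diag_sum n ?h X} \<in> sets ?P"
      using measurable_off_diag_sum[OF h_meas, of n] unfolding sample_law_def by measurable
  qed
  with tail show ?thesis by linarith
qed

text \<open>
  Chebyshev's inequality. With \<open>m k\<close> the probability of the cell \<open>k\<close>, the projection of \<open>f\<close> takes the value
  \<open>D * m k\<close> there; it is at most \<open>M\<close>, because \<open>f\<close> is. This bounds the second moment of the kernel by
  \<open>D * M\<close>, and the variance of the projection by \<open>M * \<Delta>\<close>: its deviation from the mean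
  \<open>\<theta> = 1 + \<Delta>\<close> has a smaller second moment than its deviation from 1.
\<close>
lemma T_hat_lower_tail:
  fixes f :: "real \<Rightarrow> real" and M \<tau> :: real and D n :: nat
  defines "\<Delta> \<equiv> real D * (\<Sum>k<D. (LINT y:{real k / real D..(real k + 1) / real D}|lborel. f y - 1)\<^sup>2)"
  assumes f: "prob_density f" and supp: "\<And>x. x \<notin> {0..1} \<Longrightarrow> f x = 0"
    and bdd: "\<And>x. f x \<le> M" and D: "0 < D" and n: "2 \<le> n" and \<tau>: "\<tau> < \<Delta>"
  shows "measure (sample_law n f) {X \<in> space (sample_law n f). T_hat n (indicator {0..1}) D X \<le> \<tau>}
    \<le> (16 * real D * M / (real n * (real n - 1)) + 8 * M * \<Delta> / real n) / (\<Delta> - \<tau>)\<^sup>2"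
proof -
  let ?M = "density lborel (\<lambda>x. ennreal (f x))"
  let ?P = "sample_law n f"
  let ?f0 = "indicator {0..1} :: real \<Rightarrow> real"
  let ?K = "\<lambda>x y. real D * coincidence D x y"
  have D': "real D > 0" using D by simp
  interpret M: prob_space ?M by (rule prob_space_density[OF f])
  interpret P: prob_space ?P by (rule prob_space_sample_law[OF f])
  have fi: "integrable lborel f" "(\<integral>x. f x \<partial>lborel) = 1"
    using f by (auto simp: prob_density_def has_bochner_integral_iff)
  define m where "m k = (LINT y:{real k / real D..(real k + 1) / real D}|lborel. f y)" for k
  have cells: "(\<integral>y. \<phi> (cell D y) \<partial>?M) = (\<Sum>k<D. \<phi> k * m k)" for \<phi> :: "nat \<Rightarrow> real"
    unfolding m_def
    by (subst integral_finite_valued[OF M.prob_space_axioms _ cell_less[OF D]])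
      (auto intro!: sum.cong simp: prob_cell[OF f supp D, simplified])
  have pick_cell: "(\<Sum>k<D. of_bool (cell D x = k) * \<phi> k) = \<phi> (cell D x)" for x and \<phi> :: "nat \<Rightarrow> real"
    using cell_less[OF D, of x] by (simp add: of_bool_def if_distrib if_distribR cong: if_cong)
  have m_sum: "(\<Sum>k<D. m k) = 1" using cells[of "\<lambda>_. 1"] M.prob_space by simp
  have m_nonneg: "0 \<le> m k" for k
    unfolding m_def set_lebesgue_integral_def
    by (intro Bochner_Integration.integral_nonneg) (simp add: prob_density_nonneg[OF f])
  have fset: "set_integrable lborel {a..b} f" for a b
    by (rule set_integrable_subset[of lborel UNIV]) (use fi in \<open>auto simp: set_integrable_def\<close>)
  have cset: "set_integrable lborel {a..b} (\<lambda>_. c)" for a b c :: real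
    by (rule borel_integrable_atLeastAtMost') (rule continuous_on_const)
  have m_le: "m k \<le> M / real D" for k
  proof -
    have "m k \<le> (LINT y:{real k / real D..(real k + 1) / real D}|lborel. M)"
      unfolding m_def by (intro set_integral_mono fset cset bdd)
    also have "\<dots> = M / real D" using D' by (simp add: set_lebesgue_integral_def divide_right_mono diff_divide_distrib[symmetric])
    finally show ?thesis .
  qed
  have dev: "(LINT y:{real k / real D..(real k + 1) / real D}|lborel. f y - 1) = m k - 1 / real D" for k
  proof -
    have "(LINT y:{real k / real D..(real k + 1) / real D}|lborel. f y - 1)
       = m k - (LINT y:{real k / real D..(real k + 1) / real D}|lborel. 1)"
      unfolding m_def by (intro set_integral_diff(2) fset cset)
    then show ?thesis using D' by (simp add: set_lebesgue_integral_def divide_right_mono diff_divide_distrib[symmetric])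
  qed
  have \<Delta>: "\<Delta> = real D * (\<Sum>k<D. (m k - 1 / real D)\<^sup>2)" unfolding \<Delta>_def dev ..
  define p where "p x = (\<integral>y. ?K x y \<partial>?M)" for x
  define \<theta> where "\<theta> = (\<integral>x. p x \<partial>?M)"
  have p: "p x = real D * m (cell D x)" for x
  proof -
    have "p x = (\<Sum>k<D. (real D * of_bool (cell D x = k)) * m k)"
      unfolding p_def coincidence_def by (rule cells)
    also have "\<dots> = (\<Sum>k<D. of_bool (cell D x = k) * (real D * m k))" by (simp add: mult_ac)
    finally show ?thesis unfolding pick_cell .
  qed
  have \<theta>: "\<theta> = (\<Sum>k<D. real D * m k * m k)" unfolding \<theta>_def p by (rule cells)
  have \<theta>_\<Delta>: "\<theta> - 1 = \<Delta>"
  proof -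
    have "\<Delta> = (\<Sum>k<D. real D * m k * m k - 2 * m k + 1 / real D)"
      unfolding \<Delta> sum_distrib_left using D' by (intro sum.cong refl) (simp add: power2_eq_square field_simps)
    also have "\<dots> = \<theta> - 2 * (\<Sum>k<D. m k) + 1"
      unfolding sum.distrib sum_subtractf \<theta> sum_distrib_left using D' by simp
    finally show ?thesis using m_sum by simp
  qed
  have K2: "(\<integral>x. \<integral>y. (?K x y)\<^sup>2 \<partial>?M \<partial>?M) \<le> real D * M"
  proof -
    have "(\<integral>y. (?K x y)\<^sup>2 \<partial>?M) = real D * p x" for x
    proof -
      have "(\<integral>y. (?K x y)\<^sup>2 \<partial>?M) = (\<integral>y. real D * ?K x y \<partial>?M)"
        by (intro Bochner_Integration.integral_cong refl) (auto simp: coincidence_def power2_eq_square)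
      then show ?thesis by (simp add: p_def)
    qed
    then have "(\<integral>x. \<integral>y. (?K x y)\<^sup>2 \<partial>?M \<partial>?M) = real D * \<theta>" by (simp add: \<theta>_def)
    also have "\<theta> \<le> (\<Sum>k<D. M * m k)"
      unfolding \<theta>
    proof (intro sum_mono mult_right_mono m_nonneg)
      fix k show "real D * m k \<le> M" using m_le[of k] D' by (simp add: field_simps)
    qed
    also have "\<dots> = M" using m_sum by (simp add: sum_distrib_left[symmetric])
    finally show ?thesis using D' by simp
  qed
  have q2: "(\<integral>x. (p x - \<theta>)\<^sup>2 \<partial>?M) \<le> M * \<Delta>"
  proof -
    have "(\<integral>x. (p x - \<theta>)\<^sup>2 \<partial>?M) = (\<Sum>k<D. (real D * m k - \<theta>)\<^sup>2 * m k)" unfolding p by (rule cells)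
    also have "\<dots> = (\<Sum>k<D. (real D * m k - 1)\<^sup>2 * m k - 2 * (\<theta> - 1) * (real D * m k * m k) + (\<theta>\<^sup>2 - 1) * m k)"
      by (intro sum.cong refl) (simp add: power2_eq_square algebra_simps)
    also have "\<dots> = (\<Sum>k<D. (real D * m k - 1)\<^sup>2 * m k) - 2 * (\<theta> - 1) * \<theta> + (\<theta>\<^sup>2 - 1) * (\<Sum>k<D. m k)"
      unfolding sum.distrib sum_subtractf \<theta> sum_distrib_left ..
    also have "\<dots> = (\<Sum>k<D. (real D * m k - 1)\<^sup>2 * m k) - (\<theta> - 1)\<^sup>2"
      using m_sum by (simp add: power2_eq_square algebra_simps)
    also have "\<dots> \<le> (\<Sum>k<D. (real D * m k - 1)\<^sup>2 * m k)" by simp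
    also have "\<dots> \<le> (\<Sum>k<D. (real D * m k - 1)\<^sup>2 * (M / real D))"
      by (intro sum_mono mult_left_mono m_le) simp
    also have "\<dots> = M * \<Delta>"
    proof -
      have "(real D * m k - 1)\<^sup>2 * (M / real D) = M * (real D * (m k - 1 / real D)\<^sup>2)" for k
        using D' by (simp add: power2_eq_square field_simps)
      then show ?thesis unfolding \<Delta> sum_distrib_left by simp
    qed
    finally show ?thesis .
  qed
  have K_meas: "case_prod ?K \<in> borel_measurable (?M \<Otimes>\<^sub>M ?M)"
    using measurable_coincidence[of D] by measurable
  let ?N = "real n * (real n - 1)"
  define Z where "Z X = off_diag_sum n ?K X / ?N - \<theta>" for X
  have Z_meas [measurable]: "Z \<in> borel_measurable ?P"
    using measurable_off_diag_sum[OF K_meas, of n] unfolding Z_def sample_law_def by measurable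
  have "(\<integral>X. (Z X)\<^sup>2 \<partial>?P) \<le> 16 / ?N * (\<integral>x. \<integral>y. (?K x y)\<^sup>2 \<partial>?M \<partial>?M) + 8 / real n * (\<integral>x. (p x - \<theta>)\<^sup>2 \<partial>?M)"
    unfolding Z_def \<theta>_def p_def sample_law_def
    by (rule U_statistic_second_moment[OF M.prob_space_axioms K_meas, where B = "real D"])
      (use n in \<open>auto simp: coincidence_def\<close>)
  also have "\<dots> \<le> 16 / ?N * (real D * M) + 8 / real n * (M * \<Delta>)"
    using K2 q2 n by (intro add_mono mult_left_mono) auto
  finally have Z2: "(\<integral>X. (Z X)\<^sup>2 \<partial>?P) \<le> 16 * real D * M / ?N + 8 * M * \<Delta> / real n" by (simp add: mult_ac)
  have Zi: "integrable ?P (\<lambda>X. (Z X)\<^sup>2)"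
  proof (rule P.integrable_const_bound[where B = "(real n * (real n * real D) / ?N + \<bar>\<theta>\<bar>)\<^sup>2"])
    have "\<bar>off_diag_sum n ?K X\<bar> \<le> real n * (real n * real D)" for X
    proof -
      have "\<bar>\<Sum>j\<in>{1..n}-{i}. ?K (X i) (X j)\<bar> \<le> real n * real D" for i
      proof -
        have "\<bar>\<Sum>j\<in>{1..n}-{i}. ?K (X i) (X j)\<bar> \<le> (\<Sum>j\<in>{1..n}-{i}. real D)"
          by (rule order_trans[OF sum_abs]) (intro sum_mono, simp add: coincidence_def)
        also have "\<dots> \<le> (\<Sum>j\<in>{1..n}. real D)" by (intro sum_mono2) auto
        finally show ?thesis by simp
      qed
      then show ?thesis unfolding off_diag_sum_def
        using order_trans[OF sum_abs sum_mono, of "{1..n}" "\<lambda>i. \<Sum>j\<in>{1..n}-{i}. ?K (X i) (X j)" "\<lambda>_. real n * real D"]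
        by simp
    qed
    then have "\<bar>off_diag_sum n ?K X / ?N\<bar> \<le> real n * (real n * real D) / ?N" for X
    proof -
      have "\<bar>off_diag_sum n ?K X\<bar> / ?N \<le> real n * (real n * real D) / ?N"
        using \<open>\<And>X. \<bar>off_diag_sum n ?K X\<bar> \<le> real n * (real n * real D)\<close> n by (intro divide_right_mono) auto
      moreover have "\<bar>?N\<bar> = ?N" using n by simp
      ultimately show ?thesis unfolding abs_divide by simp
    qed
    then have "\<bar>Z X\<bar> \<le> real n * (real n * real D) / ?N + \<bar>\<theta>\<bar>" for X
      unfolding Z_def by (intro order_trans[OF abs_triangle_ineq4 add_right_mono])
    then show "AE X in ?P. norm ((Z X)\<^sup>2) \<le> (real n * (real n * real D) / ?N + \<bar>\<theta>\<bar>)\<^sup>2"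
      using power_mono[OF _ abs_ge_zero, of "Z _" _ 2] by simp
  qed measurable
  have ae: "AE X in ?P. \<forall>i\<in>{1..n}. X i \<in> {0..<1}" by (rule AE_sample_law[OF f]) (rule supp)
  have "measure ?P {X \<in> space ?P. T_hat n ?f0 D X \<le> \<tau>} \<le> measure ?P {X \<in> space ?P. \<bar>Z X\<bar> \<ge> \<Delta> - \<tau>}"
  proof (rule P.finite_measure_mono_AE)
    show "AE X in ?P. X \<in> {X \<in> space ?P. T_hat n ?f0 D X \<le> \<tau>} \<longrightarrow> X \<in> {X \<in> space ?P. \<bar>Z X\<bar> \<ge> \<Delta> - \<tau>}"
      using ae
    proof eventually_elim
      case (elim X)
      then have "T_hat n ?f0 D X = Z X + \<Delta>"
        using T_hat_eq[OF D n elim] \<theta>_\<Delta> unfolding Z_def by simp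
      then show ?case by auto
    qed
  qed measurable
  also have "\<dots> \<le> (\<integral>X. (Z X)\<^sup>2 \<partial>?P) / (\<Delta> - \<tau>)\<^sup>2"
    using \<tau> by (intro P.second_moment_method Zi) auto
  also have "\<dots> \<le> (16 * real D * M / ?N + 8 * M * \<Delta> / real n) / (\<Delta> - \<tau>)\<^sup>2"
    using Z2 by (rule divide_right_mono) simp
  finally show ?thesis .
qed

section \<open>Critical values of the aggregated test\<close>

text \<open>By right continuity, the distribution function reaches the level \<open>p\<close> at the infimum that defines the quantile.\<close>
lemma quantile_tail:
  assumes \<mu>: "real_distribution \<mu>" and p: "0 < p" "p \<le> 1"
  shows "measure \<mu> {x \<in> space \<mu>. quantile \<mu> p < ereal x} \<le> 1 - p"
proof -
  interpret real_distribution \<mu> by fact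
  let ?S = "{t. p \<le> cdf \<mu> t}"
  show ?thesis
  proof (cases "?S = {}")
    case True
    then have "quantile \<mu> p = \<infinity>" by (simp add: quantile_def top_ereal_def)
    then show ?thesis using p by simp
  next
    case False
    define a where "a = Inf ?S"
    have "eventually (\<lambda>t. cdf \<mu> t < p) at_bot"
      using cdf_lim_at_bot p(1) by (rule order_tendstoD)
    then obtain N where N: "\<And>t. t \<le> N \<Longrightarrow> cdf \<mu> t < p"
      by (auto simp: eventually_at_bot_linorder)
    have bdd: "bdd_below ?S"
    proof (rule bdd_belowI)
      fix t assume "t \<in> ?S"
      then show "N \<le> t" using N[of t] by force
    qed
    have "p \<le> cdf \<mu> a"
    proof (rule tendsto_lowerbound)
      show "(cdf \<mu> \<longlongrightarrow> cdf \<mu> a) (at_right a)"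
        using cdf_is_right_cont[of a] by (simp add: continuous_within)
      show "\<forall>\<^sub>F t in at_right a. p \<le> cdf \<mu> t"
      proof (rule eventually_at_right_less[THEN eventually_mono])
        fix t assume "a < t"
        then obtain s where "s \<in> ?S" "s < t" using cInf_lessD[OF False] unfolding a_def by blast
        then show "p \<le> cdf \<mu> t" using cdf_nondecreasing[of s t] by auto
      qed
    qed simp
    have "ereal a \<le> quantile \<mu> p"
      unfolding quantile_def a_def by (intro INF_greatest) (use bdd in \<open>auto intro: cInf_lower\<close>)
    then have "{x \<in> space \<mu>. quantile \<mu> p < ereal x} \<subseteq> space \<mu> - {..a}"
      using order_le_less_trans by fastforce
    then have "measure \<mu> {x \<in> space \<mu>. quantile \<mu> p < ereal x} \<le> measure \<mu> (space \<mu> - {..a})"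
      by (intro finite_measure_mono) auto
    also have "\<dots> = 1 - cdf \<mu> a"
      unfolding cdf_def by (rule prob_compl) simp
    finally show ?thesis using \<open>p \<le> cdf \<mu> a\<close> by linarith
  qed
qed

text \<open>
  By the union bound the level \<open>\<alpha> / card \<D>\<close> belongs to the set whose supremum is \<open>u_level\<close>, and critical
  values decrease with the level.
\<close>
lemma critical_value_le:
  assumes P: "prob_space (sample_law n f0)"
    and meas: "\<And>D. D \<in> \<D> \<Longrightarrow> T_hat n f0 D \<in> borel_measurable (sample_law n f0)"
    and fin: "finite \<D>" and D: "D \<in> \<D>" and \<alpha>: "0 < \<alpha>" "\<alpha> < 1"
    and tail: "measure (sample_law n f0) {X \<in> space (sample_law n f0). \<tau> < T_hat n f0 D X} \<le> \<alpha> / real (card \<D>)"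
  shows "t_crit n f0 D (u_level n f0 \<D> \<alpha>) \<le> ereal \<tau>"
proof -
  let ?P = "sample_law n f0"
  interpret prob_space ?P by fact
  define u where "u = \<alpha> / real (card \<D>)"
  have card: "1 \<le> real (card \<D>)" using fin D card_gt_0_iff[of \<D>] by (auto simp: Suc_le_eq)
  then have "\<alpha> / real (card \<D>) \<le> \<alpha> / 1" using \<alpha> by (intro divide_left_mono) auto
  then have u: "0 < u" "u < 1" using card \<alpha> unfolding u_def by auto
  let ?U = "{u \<in> {0<..<1}. \<P>(X in ?P. T_sup n f0 \<D> u X > 0) \<le> \<alpha>}"
  have exceed: "{X \<in> space ?P. t_crit n f0 D' u < ereal (T_hat n f0 D' X)} \<in> sets ?P"
    "measure ?P {X \<in> space ?P. t_crit n f0 D' u < ereal (T_hat n f0 D' X)} \<le> u" if D': "D' \<in> \<D>" for D'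
  proof -
    note [measurable] = meas[OF D']
    show "{X \<in> space ?P. t_crit n f0 D' u < ereal (T_hat n f0 D' X)} \<in> sets ?P" by measurable
    let ?\<mu> = "distr ?P borel (T_hat n f0 D')"
    have "measure ?\<mu> {x \<in> space ?\<mu>. quantile ?\<mu> (1 - u) < ereal x} \<le> 1 - (1 - u)"
      using u by (intro quantile_tail real_distribution_distr) auto
    moreover have "measure ?\<mu> {x \<in> space ?\<mu>. quantile ?\<mu> (1 - u) < ereal x}
        = measure ?P {X \<in> space ?P. t_crit n f0 D' u < ereal (T_hat n f0 D' X)}"
      unfolding t_crit_def by (subst measure_distr) (auto intro!: arg_cong2[where f = measure])
    ultimately show "measure ?P {X \<in> space ?P. t_crit n f0 D' u < ereal (T_hat n f0 D' X)} \<le> u" by simp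
  qed
  have "u \<in> ?U"
  proof -
    have "{X \<in> space ?P. T_sup n f0 \<D> u X > 0}
        \<subseteq> (\<Union>D'\<in>\<D>. {X \<in> space ?P. t_crit n f0 D' u < ereal (T_hat n f0 D' X)})"
    proof
      fix X assume X: "X \<in> {X \<in> space ?P. T_sup n f0 \<D> u X > 0}"
      then obtain D' where D': "D' \<in> \<D>" "0 < ereal (T_hat n f0 D' X) - t_crit n f0 D' u"
        by (auto simp: T_sup_def less_SUP_iff)
      then have "t_crit n f0 D' u < ereal (T_hat n f0 D' X)"
        by (cases "t_crit n f0 D' u") auto
      then show "X \<in> (\<Union>D'\<in>\<D>. {X \<in> space ?P. t_crit n f0 D' u < ereal (T_hat n f0 D' X)})"
        using X D' by auto
    qed
    then have "measure ?P {X \<in> space ?P. T_sup n f0 \<D> u X > 0}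
        \<le> measure ?P (\<Union>D'\<in>\<D>. {X \<in> space ?P. t_crit n f0 D' u < ereal (T_hat n f0 D' X)})"
      using exceed(1) fin by (intro finite_measure_mono) auto
    also have "\<dots> \<le> (\<Sum>D'\<in>\<D>. measure ?P {X \<in> space ?P. t_crit n f0 D' u < ereal (T_hat n f0 D' X)})"
      using exceed(1) fin by (intro measure_UNION_le) auto
    also have "\<dots> \<le> (\<Sum>D'\<in>\<D>. u)" by (intro sum_mono exceed(2))
    also have "\<dots> = \<alpha>" using card by (simp add: u_def)
    finally show ?thesis using u by simp
  qed
  then have "u \<le> u_level n f0 \<D> \<alpha>"
    unfolding u_level_def by (intro cSup_upper) (auto intro!: bdd_aboveI[of _ 1])
  note [measurable] = meas[OF D]
  let ?\<mu> = "distr ?P borel (T_hat n f0 D)"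
  have "cdf ?\<mu> \<tau> = measure ?P {X \<in> space ?P. T_hat n f0 D X \<le> \<tau>}"
    unfolding cdf_def by (subst measure_distr) (auto intro!: arg_cong2[where f = measure])
  also have "\<dots> = measure ?P (space ?P - {X \<in> space ?P. \<tau> < T_hat n f0 D X})"
    by (intro arg_cong2[where f = measure]) auto
  also have "\<dots> = 1 - measure ?P {X \<in> space ?P. \<tau> < T_hat n f0 D X}"
    by (rule prob_compl) measurable
  finally have "1 - u_level n f0 \<D> \<alpha> \<le> cdf ?\<mu> \<tau>"
    using tail \<open>u \<le> u_level n f0 \<D> \<alpha>\<close> unfolding u_def by linarith
  then show ?thesis unfolding t_crit_def quantile_def by (intro INF_lower) simp
qed

lemma T_test_nonpos_imp:
  assumes "T_test n f0 \<D> \<alpha> X \<le> 0" "D \<in> \<D>" "t_crit n f0 D (u_level n f0 \<D> \<alpha>) \<le> ereal \<tau>"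
  shows "T_hat n f0 D X \<le> \<tau>"
proof -
  have "ereal (T_hat n f0 D X) - t_crit n f0 D (u_level n f0 \<D> \<alpha>) \<le> 0"
    using assms(1,2) unfolding T_test_def T_sup_def by (simp add: SUP_le_iff)
  then show ?thesis using assms(3) by (cases "t_crit n f0 D (u_level n f0 \<D> \<alpha>)") auto
qed

section \<open>Choice of the dimension\<close>

lemma dims_card:
  assumes n: "0 < n" and L: "1 \<le> ln (ln (real n))"
  shows "finite (dims n)" "real (card (dims n)) \<le> 1 + log 2 ((real n)\<^sup>2)"
proof -
  have "(real n)\<^sup>2 / ln (ln (real n)) ^ 3 \<le> (real n)\<^sup>2 / 1"
    using L by (intro divide_left_mono one_le_power) auto
  then have le: "log 2 ((real n)\<^sup>2 / ln (ln (real n)) ^ 3) \<le> log 2 ((real n)\<^sup>2)"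
    using n L by (subst log_le_cancel_iff) (auto intro!: divide_pos_pos)
  have pos: "0 \<le> log 2 ((real n)\<^sup>2)" using n by simp
  let ?S = "(\<lambda>J. 2 ^ J) ` {..nat \<lfloor>log 2 ((real n)\<^sup>2)\<rfloor>} :: nat set"
  have sub: "dims n \<subseteq> ?S"
    unfolding dims_def using le by (auto simp: le_nat_floor)
  then show "finite (dims n)" by (rule finite_subset) simp
  have "card (dims n) \<le> card ?S" using sub by (intro card_mono) auto
  also have "\<dots> \<le> card {..nat \<lfloor>log 2 ((real n)\<^sup>2)\<rfloor>}" by (rule card_image_le) simp
  finally have "real (card (dims n)) \<le> 1 + real (nat \<lfloor>log 2 ((real n)\<^sup>2)\<rfloor>)" by simp
  also have "\<dots> \<le> 1 + log 2 ((real n)\<^sup>2)" using pos by (simp add: of_nat_floor)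
  finally show "real (card (dims n)) \<le> 1 + log 2 ((real n)\<^sup>2)" .
qed

text \<open>
  Take for \<open>2 ^ J\<close> the largest power of two below \<open>E = (n\<^sup>2 / L) powr b\<close>. As \<open>b\<close> lies strictly between 0
  and 1, \<open>E\<close> is polynomially larger than 1 and polynomially smaller than \<open>n\<^sup>2\<close>, and all requirements hold
  with polynomial room to spare. The last one bounds the null tail: its first term is
  \<open>(ln n) powr (- 3)\<close>, while \<open>card (dims n)\<close> is at most \<open>(ln n)\<^sup>2\<close>, and its second term decreases faster than
  any power of \<open>n\<close>.
\<close>
lemma eventually_suitable_dimension:
  fixes b \<alpha> :: real and q :: nat
  assumes b: "0 < b" "b < 1" and \<alpha>: "0 < \<alpha>"
  shows "eventually (\<lambda>n::nat. 1 \<le> ln (ln (real n)) \<and> (\<exists>J. q \<le> J \<and> (2::nat) ^ J \<in> dims n \<and>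
    2 ^ J \<le> ((real n)\<^sup>2 / ln (ln (real n))) powr b \<and>
    ((real n)\<^sup>2 / ln (ln (real n))) powr b \<le> 2 * 2 ^ J \<and>
    256 * ln (ln (real n)) \<le> 2 ^ J \<and>
    exp (- 3 * ln (ln (real n))) + real n * exp (real n * (2 / 2 ^ J) - real n / (4 * sqrt (2 ^ J * ln (ln (real n)))))
      \<le> \<alpha> / real (card (dims n)))) at_top"
proof -
  let ?L = "\<lambda>n::nat. ln (ln (real n))" and ?E = "\<lambda>n::nat. ((real n)\<^sup>2 / ln (ln (real n))) powr b"
  have 1: "eventually (\<lambda>n. 1 \<le> ?L n) at_top" by real_asymp
  have "filterlim ?E at_top at_top" using b by real_asymp
  then have 2: "eventually (\<lambda>n. 2 ^ q \<le> ?E n) at_top" by (simp add: filterlim_at_top)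
  have 3: "eventually (\<lambda>n. ?E n \<le> (real n)\<^sup>2 / ?L n ^ 3) at_top" using b by real_asymp
  have 4: "eventually (\<lambda>n. 256 * ?L n \<le> ?E n / 2) at_top" using b by real_asymp
  have 5: "eventually (\<lambda>n::nat. 1 + log 2 ((real n)\<^sup>2) \<le> (ln (real n))\<^sup>2) at_top" by real_asymp
  have "filterlim (\<lambda>n::nat. ln (real n)) at_top at_top" by real_asymp
  then have 6: "eventually (\<lambda>n::nat. 2 / \<alpha> \<le> ln (real n)) at_top" by (simp add: filterlim_at_top)
  have "((\<lambda>n. real n * exp (- (real n / (8 * sqrt (?E n * ?L n)))) * (ln (real n))\<^sup>2) \<longlongrightarrow> 0) at_top"
    using b by real_asymp
  then have 7: "eventually (\<lambda>n. real n * exp (- (real n / (8 * sqrt (?E n * ?L n)))) * (ln (real n))\<^sup>2 < \<alpha> / 2) at_top"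
    by (rule order_tendstoD) (use \<alpha> in simp)
  have 8: "eventually (\<lambda>n::nat. 1 < ln (real n)) at_top" by real_asymp
  have 9: "eventually (\<lambda>n::nat. 0 < n) at_top" by (rule eventually_gt_at_top)
  show ?thesis using 1 2 3 4 5 6 7 8 9
  proof eventually_elim
    case (elim n)
    let ?L = "ln (ln (real n))" and ?E = "((real n)\<^sup>2 / ln (ln (real n))) powr b" and ?l = "ln (real n)"
    define e where "e = ?E"
    note elim = elim[folded e_def]
    have E1: "1 \<le> e" using elim(2) one_le_power[of "2::real" q] by linarith
    define J where "J = nat \<lfloor>log 2 e\<rfloor>"
    have log0: "0 \<le> log 2 e" using E1 by simp
    have J_le: "real J \<le> log 2 e" and J_gt: "log 2 e < real J + 1"
      unfolding J_def using log0 by linarith+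
    have pow: "2 ^ J = 2 powr real J" by (simp add: powr_realpow)
    have le: "2 ^ J \<le> e"
      unfolding pow using J_le E1 by (subst le_log_iff[symmetric]) auto
    have "e \<le> 2 powr (real J + 1)"
      using J_gt E1 by (subst log_le_iff[symmetric]) auto
    then have ge: "e \<le> 2 * 2 ^ J" unfolding pow powr_add by simp
    have "q \<le> J"
    proof -
      have "real q \<le> log 2 e" using elim(2) E1 by (subst le_log_iff) (auto simp: powr_realpow)
      then show ?thesis using J_gt by linarith
    qed
    have "real J \<le> log 2 ((real n)\<^sup>2 / ?L ^ 3)"
      using J_le elim(3) E1 by (smt (verit) log_le_cancel_iff)
    then have dim: "2 ^ J \<in> dims n" unfolding dims_def by blast
    have D256: "256 * ?L \<le> 2 ^ J" using elim(4) ge by linarith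
    have D0: "(0::real) < 2 ^ J" by simp
    have L0: "0 < ?L" using elim(1) by simp
    have sq: "16 * sqrt ?L \<le> sqrt (2 ^ J)"
    proof -
      have "sqrt (256 * ?L) \<le> sqrt (2 ^ J)" using D256 by (rule real_sqrt_le_mono)
      moreover have "sqrt 256 = (16::real)" by (rule real_sqrt_unique) auto
      ultimately show ?thesis by (simp add: real_sqrt_mult)
    qed
    let ?r = "sqrt (2 ^ J * ?L)"
    have r0: "0 < ?r" using D0 L0 by simp
    have "real n * (2 / 2 ^ J) \<le> real n / (8 * ?r)"
    proof -
      have "16 * ?r \<le> 2 ^ J"
      proof -
        have "16 * ?r = sqrt (2 ^ J) * (16 * sqrt ?L)" by (simp add: real_sqrt_mult)
        also have "\<dots> \<le> sqrt (2 ^ J) * sqrt (2 ^ J)" using sq by (intro mult_left_mono) auto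
        finally show ?thesis by simp
      qed
      then have "2 / 2 ^ J \<le> 1 / (8 * ?r)" using r0 by (simp add: field_simps)
      then have "real n * (2 / 2 ^ J) \<le> real n * (1 / (8 * ?r))" by (intro mult_left_mono) auto
      then show ?thesis by simp
    qed
    moreover have "real n / (4 * ?r) = 2 * (real n / (8 * ?r))" by simp
    ultimately have "real n * (2 / 2 ^ J) - real n / (4 * ?r) \<le> - (real n / (8 * ?r))" by linarith
    also have "\<dots> \<le> - (real n / (8 * sqrt (e * ?L)))"
    proof -
      have "?r \<le> sqrt (e * ?L)" using le L0 by (intro real_sqrt_le_mono mult_right_mono) auto
      then have "real n / (8 * sqrt (e * ?L)) \<le> real n / (8 * ?r)"
        using r0 by (intro divide_left_mono mult_pos_pos) auto
      then show ?thesis by simp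
    qed
    finally have "real n * exp (real n * (2 / 2 ^ J) - real n / (4 * ?r)) \<le> real n * exp (- (real n / (8 * sqrt (e * ?L))))"
      by (intro mult_left_mono) auto
    also have "\<dots> \<le> \<alpha> / 2 / ?l\<^sup>2"
      using elim(7,8) by (subst pos_le_divide_eq) auto
    finally have t2: "real n * exp (real n * (2 / 2 ^ J) - real n / (4 * ?r)) \<le> \<alpha> / 2 / ?l\<^sup>2" .
    have t1: "exp (- 3 * ?L) \<le> \<alpha> / 2 / ?l\<^sup>2"
    proof -
      have "exp (- 3 * ?L) = inverse (exp ?L ^ 3)" by (simp add: exp_minus exp_of_nat_mult[symmetric])
      also have "\<dots> = 1 / (?l * ?l\<^sup>2)" using elim(8) by (simp add: power2_eq_square power3_eq_cube field_simps)
      also have "\<dots> \<le> \<alpha> / 2 / ?l\<^sup>2"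
      proof -
        have "1 / ?l \<le> \<alpha> / 2" using elim(6,8) \<alpha> by (simp add: field_simps)
        then have "1 / ?l / ?l\<^sup>2 \<le> \<alpha> / 2 / ?l\<^sup>2" by (rule divide_right_mono) simp
        then show ?thesis by simp
      qed
      finally show ?thesis .
    qed
    have card: "real (card (dims n)) \<le> ?l\<^sup>2" "0 < real (card (dims n))"
    proof -
      show "real (card (dims n)) \<le> ?l\<^sup>2" using dims_card[OF elim(9) elim(1)] elim(5) by linarith
      show "0 < real (card (dims n))" using dims_card(1)[OF elim(9) elim(1)] dim by (auto simp: card_gt_0_iff)
    qed
    have "exp (- 3 * ?L) + real n * exp (real n * (2 / 2 ^ J) - real n / (4 * ?r)) \<le> \<alpha> / ?l\<^sup>2"
      using t1 t2 by simp
    also have "\<dots> \<le> \<alpha> / real (card (dims n))" using card \<alpha> elim(8) by (intro divide_left_mono mult_pos_pos) auto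
    finally show ?case using elim(1) \<open>q \<le> J\<close> dim le ge D256 unfolding e_def by blast
  qed
qed

text \<open>
  At \<open>D = E\<close> the detection threshold \<open>sqrt (D * L) / n\<close> and the squared approximation error
  \<open>D powr (- 2 * s)\<close> both coincide with the separation rate.
\<close>
lemma rate_identities:
  fixes s L x :: real
  assumes s: "0 < s" and L: "0 < L" and x: "0 < x"
  defines "E \<equiv> (x\<^sup>2 / L) powr (1 / (4 * s + 1))" and "\<rho> \<equiv> (sqrt L / x) powr (4 * s / (4 * s + 1))"
  shows "sqrt (E * L) / x = \<rho>" "E powr (- (2 * s)) = \<rho>"
proof -
  define y where "y = x\<^sup>2 / L"
  have y: "0 < y" using L x by (simp add: y_def)
  have root: "sqrt L / x = y powr (- 1 / 2)"
  proof -
    have "y powr (- 1 / 2) = 1 / sqrt y" using y by (simp add: powr_minus_divide powr_half_sqrt)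
    then show ?thesis using L x by (simp add: y_def real_sqrt_divide)
  qed
  have \<rho>: "\<rho> = y powr (- (2 * s / (4 * s + 1)))"
    unfolding \<rho>_def root powr_powr by (rule arg_cong[where f = "\<lambda>t. y powr t"]) simp
  show "E powr (- (2 * s)) = \<rho>"
    unfolding \<rho> E_def y_def[symmetric] powr_powr by (rule arg_cong[where f = "\<lambda>t. y powr t"]) simp
  have "sqrt (E * L) / x = sqrt E * (sqrt L / x)" by (simp add: real_sqrt_mult)
  also have "\<dots> = (y powr (1 / (4 * s + 1))) powr (1 / 2) * y powr (- 1 / 2)"
    unfolding root E_def y_def[symmetric] by (simp add: powr_half_sqrt)
  also have "\<dots> = y powr (1 / (4 * s + 1) * (1 / 2) + - 1 / 2)"
    by (simp only: powr_powr powr_add)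
  also have "1 / (4 * s + 1) * (1 / 2) + - 1 / 2 = - (2 * s / (4 * s + 1))"
    using s by (simp add: field_simps)
  finally show "sqrt (E * L) / x = \<rho>" unfolding \<rho> .
qed

section \<open>Error of the second kind\<close>

text \<open>
  The second bound makes the separation hypothesis void for small samples: no density bounded by \<open>M\<close>
  has squared distance more than \<open>M\<close> from the uniform one.
\<close>
lemma distance_from_uniform:
  assumes f: "prob_density f" and supp: "\<And>x. x \<notin> {0..1} \<Longrightarrow> f x = 0" and bdd: "\<And>x. f x \<le> M"
  shows "(norm2 (\<lambda>x. f x - indicator {0..1} x))\<^sup>2 = (LINT x:{0..1}|lborel. (f x - 1)\<^sup>2)"
    and "(LINT x:{0..1}|lborel. (f x - 1)\<^sup>2) \<le> M"
proof -
  have fi: "integrable lborel f" "(\<integral>x. f x \<partial>lborel) = 1"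
    using f by (auto simp: prob_density_def has_bochner_integral_iff)
  have "(norm2 (\<lambda>x. f x - indicator {0..1} x))\<^sup>2 = (\<integral>x. (f x - indicator {0..1} x)\<^sup>2 \<partial>lborel)"
    unfolding norm2_def by (rule real_sqrt_pow2) (simp add: Bochner_Integration.integral_nonneg)
  also have "\<dots> = (LINT x:{0..1}|lborel. (f x - 1)\<^sup>2)"
    unfolding set_lebesgue_integral_def using supp
    by (intro Bochner_Integration.integral_cong refl) (auto simp: indicator_def)
  finally show "(norm2 (\<lambda>x. f x - indicator {0..1} x))\<^sup>2 = (LINT x:{0..1}|lborel. (f x - 1)\<^sup>2)" .
  have iu: "integrable lborel (indicator {0..1} :: real \<Rightarrow> real)" "(\<integral>x. indicator {0..1::real} x \<partial>lborel) = (1::real)"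
    by simp_all
  have "(LINT x:{0..1}|lborel. (f x - 1)\<^sup>2) \<le> (\<integral>x. (M - 2) * f x + indicator {0..1} x \<partial>lborel)"
    unfolding set_lebesgue_integral_def
  proof (rule integral_mono')
    show "integrable lborel (\<lambda>x. (M - 2) * f x + indicator {0..1} x)" using fi iu by simp
    fix x
    have "f x * f x \<le> M * f x" using bdd[of x] prob_density_nonneg[OF f, of x] by (rule mult_right_mono)
    then show le: "indicator {0..1} x *\<^sub>R (f x - 1)\<^sup>2 \<le> (M - 2) * f x + indicator {0..1} x"
      using supp[of x] by (auto simp: indicator_def power2_eq_square algebra_simps)
    show "0 \<le> (M - 2) * f x + indicator {0..1} x" by (rule order_trans[OF _ le]) simp
  qed
  also have "\<dots> = (M - 2) * 1 + 1" using fi iu by simp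
  finally show "(LINT x:{0..1}|lborel. (f x - 1)\<^sup>2) \<le> M" by simp
qed

text \<open>
  The null tail is used with \<open>l = sqrt L / (n * sqrt D)\<close> and the threshold \<open>\<tau> = 11 * sqrt (D * L) / (n - 1)\<close>,
  for which its Gaussian part is \<open>exp (8 * L - 11 * L)\<close>. In the separation constant, 44 ensures
  \<open>2 * \<tau> \<le> \<Delta>\<close>, and \<open>160 * M / \<beta>\<close> brings Chebyshev's bound below \<open>\<beta>\<close>.
\<close>
lemma type_two_error:
  fixes f :: "real \<Rightarrow> real" and M \<alpha> \<beta> :: real and D n :: nat
  defines "\<Delta> \<equiv> real D * (\<Sum>k<D. (LINT y:{real k / real D..(real k + 1) / real D}|lborel. f y - 1)\<^sup>2)"
    and "L \<equiv> ln (ln (real n))" and "f0 \<equiv> indicator {0..1} :: real \<Rightarrow> real"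
  assumes n: "2 \<le> n" and L: "1 \<le> L" and D: "D \<in> dims n" "256 * L \<le> real D"
    and tail: "exp (- 3 * L) + real n * exp (real n * (2 / real D) - real n / (4 * sqrt (real D * L))) \<le> \<alpha> / real (card (dims n))"
    and \<alpha>: "0 < \<alpha>" "\<alpha> < 1" and \<beta>: "0 < \<beta>"
    and f: "prob_density f" and supp: "\<And>x. x \<notin> {0..1} \<Longrightarrow> f x = 0" and bdd: "\<And>x. f x \<le> M"
    and sep: "(44 + 160 * M / \<beta>) * (sqrt (real D * L) / real n) \<le> \<Delta>"
  shows "\<P>(X in sample_law n f. T_test n f0 (dims n) \<alpha> X \<le> 0) \<le> \<beta>"
proof -
  have D0: "0 < D" using D(1) by (auto simp: dims_def)
  have D1: "1 \<le> real D" "0 < real D" using D0 by auto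
  have n': "0 < real n" "0 < real n - 1" using n by auto
  have L0: "0 < L" using L by simp
  have M0: "0 \<le> M" using bdd[of 0] prob_density_nonneg[OF f, of 0] by linarith
  interpret P0: prob_space "sample_law n f0"
    unfolding f0_def by (rule prob_space_sample_law[OF prob_density_uniform])
  interpret Pf: prob_space "sample_law n f" by (rule prob_space_sample_law[OF f])
  let ?r = "sqrt (real D * L)"
  have r: "?r = sqrt (real D) * sqrt L" by (rule real_sqrt_mult)
  have r1: "1 \<le> ?r"
    using mult_mono[of 1 "real D" 1 L] D1 L by simp
  define l where "l = sqrt L / (real n * sqrt (real D))"
  define \<tau> where "\<tau> = 11 * ?r / (real n - 1)"
  define c where "c = 44 + 160 * M / \<beta>"
  have c: "44 \<le> c" using M0 \<beta> by (simp add: c_def)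
  have n\<Delta>: "c * ?r \<le> real n * \<Delta>"
    using mult_left_mono[OF sep, of "real n"] n' unfolding c_def by simp
  have \<Delta>0: "0 < \<Delta>"
  proof -
    have "0 < c * (?r / real n)" using c r1 n' by (intro mult_pos_pos divide_pos_pos) auto
    then show ?thesis using sep unfolding c_def by linarith
  qed
  have \<tau>_half: "2 * \<tau> \<le> \<Delta>"
  proof -
    have "?r / (real n - 1) \<le> ?r / (real n / 2)"
      using n n' r1 by (intro divide_left_mono mult_pos_pos) auto
    then have "2 * \<tau> \<le> 44 * (?r / real n)" unfolding \<tau>_def by simp
    also have "\<dots> \<le> c * (?r / real n)" using c r1 by (intro mult_right_mono) auto
    also have "\<dots> \<le> \<Delta>" using sep unfolding c_def .
    finally show ?thesis .
  qed
  have l0: "0 < l" unfolding l_def using n' D1 L0 by simp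
  have sq: "16 * sqrt L \<le> sqrt (real D)"
  proof -
    have "sqrt (256 * L) \<le> sqrt (real D)" using D(2) by (rule real_sqrt_le_mono)
    moreover have "sqrt 256 = (16::real)" by (rule real_sqrt_unique) auto
    ultimately show ?thesis by (simp add: real_sqrt_mult)
  qed
  have "16 * l * real n \<le> 1" unfolding l_def using n' D1 sq by simp
  then have "measure (sample_law n f0) {X \<in> space (sample_law n f0). \<tau> < T_hat n f0 D X}
    \<le> exp (8 * l\<^sup>2 * real D * (real n)\<^sup>2 - l * (\<tau> * (real n * (real n - 1))))
      + real n * exp (real n * (2 / real D) - 1 / (4 * l * real D))"
    unfolding f0_def by (intro T_hat_null_upper_tail D0 n l0)
  also have "8 * l\<^sup>2 * real D * (real n)\<^sup>2 - l * (\<tau> * (real n * (real n - 1))) = - 3 * L"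
  proof -
    have "8 * l\<^sup>2 * real D * (real n)\<^sup>2 = 8 * L"
      unfolding l_def using n' D1 L0 by (simp add: power_divide power_mult_distrib)
    moreover have "l * (\<tau> * (real n * (real n - 1))) = 11 * (l * (?r * real n))"
      unfolding \<tau>_def using n' by simp
    moreover have "l * (?r * real n) = L"
      unfolding l_def r using n' D1 L0 by simp
    ultimately show ?thesis by simp
  qed
  also have "1 / (4 * l * real D) = real n / (4 * ?r)"
  proof -
    have "l * real D = ?r / real n"
    proof -
      have "u / (x * q) * (q * q) = q * u / x" if "0 < q" "0 < x" for q u x :: real
        using that by (simp add: field_simps)
      from this[of "sqrt (real D)" "real n" "sqrt L"] show ?thesis
        unfolding r l_def using n' D1 by simp
    qed
    then show ?thesis using n' r1 by (simp add: mult.assoc)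
  qed
  also note tail
  finally have "t_crit n f0 D (u_level n f0 (dims n) \<alpha>) \<le> ereal \<tau>"
  proof (intro critical_value_le)
    show "T_hat n f0 D' \<in> borel_measurable (sample_law n f0)" if "D' \<in> dims n" for D'
      unfolding f0_def by (rule measurable_T_hat) (use that in \<open>auto simp: dims_def\<close>)
    show "finite (dims n)" using n L unfolding L_def by (intro dims_card) auto
  qed (use P0.prob_space_axioms D \<alpha> in auto)
  then have "{X \<in> space (sample_law n f). T_test n f0 (dims n) \<alpha> X \<le> 0}
      \<subseteq> {X \<in> space (sample_law n f). T_hat n f0 D X \<le> \<tau>}"
    using T_test_nonpos_imp[OF _ D(1)] by blast
  then have "\<P>(X in sample_law n f. T_test n f0 (dims n) \<alpha> X \<le> 0)
      \<le> measure (sample_law n f) {X \<in> space (sample_law n f). T_hat n f0 D X \<le> \<tau>}"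
  proof (rule Pf.finite_measure_mono)
    note [measurable] = measurable_T_hat[OF D0, of n f, folded f0_def]
    show "{X \<in> space (sample_law n f). T_hat n f0 D X \<le> \<tau>} \<in> sets (sample_law n f)" by measurable
  qed
  also have "\<dots> \<le> (16 * real D * M / (real n * (real n - 1)) + 8 * M * \<Delta> / real n) / (\<Delta> - \<tau>)\<^sup>2"
    unfolding \<Delta>_def f0_def
    by (rule T_hat_lower_tail[OF f supp bdd D0 n]) (use \<tau>_half \<Delta>0 in \<open>simp_all add: \<Delta>_def\<close>)
  also have "\<dots> \<le> (16 * real D * M / ((real n)\<^sup>2 / 2) + 8 * M * \<Delta> / real n) / (\<Delta> / 2)\<^sup>2"
  proof (rule frac_le)
    have "(real n)\<^sup>2 / 2 \<le> real n * (real n - 1)"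
      using n n' by (simp add: power2_eq_square)
    then have "16 * real D * M / (real n * (real n - 1)) \<le> 16 * real D * M / ((real n)\<^sup>2 / 2)"
      using n' M0 D1 by (intro divide_left_mono mult_pos_pos) auto
    then show "16 * real D * M / (real n * (real n - 1)) + 8 * M * \<Delta> / real n
        \<le> 16 * real D * M / ((real n)\<^sup>2 / 2) + 8 * M * \<Delta> / real n" by simp
    show "0 \<le> 16 * real D * M / ((real n)\<^sup>2 / 2) + 8 * M * \<Delta> / real n"
      using M0 \<Delta>0 by simp
    show "0 < (\<Delta> / 2)\<^sup>2" using \<Delta>0 by simp
    show "(\<Delta> / 2)\<^sup>2 \<le> (\<Delta> - \<tau>)\<^sup>2" using \<Delta>0 \<tau>_half by (intro power_mono) auto
  qed
  also have "\<dots> = M * (128 * (real D / (real n * \<Delta>)\<^sup>2) + 32 * (1 / (real n * \<Delta>)))"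
    using n' \<Delta>0 by (simp add: power2_eq_square field_simps)
  also have "\<dots> \<le> M * (128 * (1 / c) + 32 * (1 / c))"
  proof (intro mult_left_mono add_mono M0)
    have "c * 1 \<le> c * ?r" using r1 c by (intro mult_left_mono) auto
    then have "c \<le> real n * \<Delta>" using n\<Delta> by linarith
    then show "1 / (real n * \<Delta>) \<le> 1 / c" using c by (intro divide_left_mono mult_pos_pos) (use n' \<Delta>0 in auto)
    have "c * real D \<le> c\<^sup>2 * ?r\<^sup>2"
    proof (rule mult_mono)
      show "c \<le> c\<^sup>2" using c by (simp add: power2_eq_square)
      show "real D \<le> ?r\<^sup>2" using D1 L0 mult_left_mono[OF L, of "real D"] by simp
    qed (use c in auto)
    also have "\<dots> = (c * ?r)\<^sup>2" by (simp add: power_mult_distrib)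
    also have "\<dots> \<le> (real n * \<Delta>)\<^sup>2" using n\<Delta> c r1 by (intro power_mono) auto
    finally show "real D / (real n * \<Delta>)\<^sup>2 \<le> 1 / c"
      using c n' \<Delta>0 by (simp add: field_simps)
  qed auto
  also have "\<dots> = (160 * M / \<beta>) * (\<beta> / c)" using \<beta> by simp
  also have "\<dots> \<le> c * (\<beta> / c)" using c \<beta> unfolding c_def by (intro mult_right_mono) auto
  also have "\<dots> = \<beta>" using c by simp
  finally show ?thesis .
qed

theorem corollary2:
  fixes \<alpha> \<beta> s M R :: real and f0 :: "real \<Rightarrow> real"
  assumes "0 < \<alpha>" "\<alpha> < 1" and "0 < \<beta>" "\<beta> < 1"
    and "0 < s" and "0 < M" and "0 < R"
    and f0: "f0 = indicator {0..1}"
  shows "\<exists>C>0. \<forall>(n::nat) (f :: real \<Rightarrow> real).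
    16 \<le> n \<longrightarrow>
    prob_density f \<longrightarrow>
    integrable lborel (\<lambda>x. (f x)\<^sup>2) \<longrightarrow>
    f \<in> holder_class s R \<longrightarrow>
    (\<forall>x. x \<notin> {0..1} \<longrightarrow> f x = 0) \<longrightarrow>
    sup_norm f \<le> ereal M \<longrightarrow>
    (norm2 (\<lambda>x. f x - f0 x))\<^sup>2 > C * (sqrt (ln (ln (real n))) / real n) powr (4 * s / (4 * s + 1)) \<longrightarrow>
    \<P>(X in sample_law n f. T_test n f0 (dims n) \<alpha> X \<le> 0) \<le> \<beta>"
proof -
  define m where "m = nat (\<lceil>s\<rceil> - 1)"
  define r where "r = (2 ^ (m + 1) :: nat)"
  define b where "b = 1 / (4 * s + 1)"
  have b: "0 < b" "b < 1" using \<open>0 < s\<close> by (auto simp: b_def)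
  define L where "L n = ln (ln (real n))" for n :: nat
  define \<rho> where "\<rho> n = (sqrt (L n) / real n) powr (4 * s / (4 * s + 1))" for n :: nat
  define A where "A = 2 * real r ^ (2 * m + 1) * real (m + 1)"
  define B where "B = 2 * (real (m + 1) * real r ^ m + 1)\<^sup>2 * R\<^sup>2 * real r powr (2 * s)"
  define C1 where "C1 = 44 + 160 * M / \<beta>"
  obtain n0 :: nat where n0: "\<And>n. n0 \<le> n \<Longrightarrow> 1 \<le> L n \<and> (\<exists>J. m + 1 \<le> J \<and> (2::nat) ^ J \<in> dims n \<and>
    2 ^ J \<le> ((real n)\<^sup>2 / L n) powr b \<and> ((real n)\<^sup>2 / L n) powr b \<le> 2 * 2 ^ J \<and> 256 * L n \<le> 2 ^ J \<and>
    exp (- 3 * L n) + real n * exp (real n * (2 / 2 ^ J) - real n / (4 * sqrt (2 ^ J * L n))) \<le> \<alpha> / real (card (dims n)))"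
    using eventually_suitable_dimension[OF b \<open>0 < \<alpha>\<close>, of "m + 1"] unfolding L_def eventually_sequentially by blast
  \<comment> \<open>the last summand is at least \<open>M / \<rho> n\<close> for each of the finitely many \<open>n < n0\<close>\<close>
  define C where "C = A * C1 + B * 2 powr (2 * s) + M * (\<Sum>n\<in>{16..<n0}. 1 / \<rho> n)"
  have A0: "0 < A" by (simp add: A_def r_def)
  have B0: "0 \<le> B" by (simp add: B_def)
  have C1: "0 < C1" using \<open>0 < M\<close> \<open>0 < \<beta>\<close> by (simp add: C1_def add_pos_nonneg)
  \<comment> \<open>\<open>ln 16 = 4 * ln 2\<close> exceeds 1, so the rate is positive for every sample size that occurs\<close>
  have L_pos: "0 < L n" if "16 \<le> n" for n
  proof -
    have "(1::real) < 4 * ln 2" using ln2_ge_two_thirds by simp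
    also have "4 * ln 2 = ln ((2::real) ^ 4)" by (subst ln_realpow) auto
    also have "\<dots> \<le> ln (real n)" using that by (subst ln_le_cancel_iff) auto
    finally show ?thesis unfolding L_def by simp
  qed
  have \<rho>_pos: "0 < \<rho> n" if "16 \<le> n" for n using L_pos[OF that] that by (simp add: \<rho>_def)
  have sum_nonneg: "0 \<le> (\<Sum>n\<in>{16..<n0}. 1 / \<rho> n)"
    by (rule sum_nonneg) (simp add: \<rho>_def)
  have "0 < C" unfolding C_def
    using A0 B0 C1 sum_nonneg \<open>0 < M\<close> by (intro add_pos_nonneg) auto
  moreover have "\<P>(X in sample_law n f. T_test n f0 (dims n) \<alpha> X \<le> 0) \<le> \<beta>"
    if n: "16 \<le> n" and f: "prob_density f" and hol: "f \<in> holder_class s R"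
      and supp: "\<forall>x. x \<notin> {0..1} \<longrightarrow> f x = 0" and sup: "sup_norm f \<le> ereal M"
      and far: "(norm2 (\<lambda>x. f x - f0 x))\<^sup>2 > C * \<rho> n" for n f
  proof -
    have supp': "\<And>x. x \<notin> {0..1} \<Longrightarrow> f x = 0" using supp by blast
    have bdd: "f x \<le> M" for x
    proof -
      have "ereal \<bar>f x\<bar> \<le> sup_norm f" unfolding sup_norm_def by (rule SUP_upper) simp
      then have "ereal \<bar>f x\<bar> \<le> ereal M" using sup by (rule order_trans)
      then show ?thesis by simp
    qed
    have dist: "(norm2 (\<lambda>x. f x - f0 x))\<^sup>2 = (LINT x:{0..1}|lborel. (f x - 1)\<^sup>2)"
      "(LINT x:{0..1}|lborel. (f x - 1)\<^sup>2) \<le> M"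
      unfolding f0 by (rule distance_from_uniform[OF f]; fact supp' bdd)+
    have "n0 \<le> n"
    proof (rule ccontr)
      assume "\<not> n0 \<le> n"
      then have "1 / \<rho> n \<le> (\<Sum>n\<in>{16..<n0}. 1 / \<rho> n)"
        using n by (intro member_le_sum) (auto simp: \<rho>_def)
      then have "M * (1 / \<rho> n) \<le> C"
        unfolding C_def using \<open>0 < M\<close> A0 B0 C1 by (intro add_increasing mult_left_mono) auto
      then have "M \<le> C * \<rho> n" using \<rho>_pos[OF n] by (simp add: field_simps)
      then show False using far dist by linarith
    qed
    then obtain J where LJ: "1 \<le> L n" "m + 1 \<le> J" "(2::nat) ^ J \<in> dims n"
      "2 ^ J \<le> ((real n)\<^sup>2 / L n) powr b" "((real n)\<^sup>2 / L n) powr b \<le> 2 * 2 ^ J" "256 * L n \<le> 2 ^ J"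
      "exp (- 3 * L n) + real n * exp (real n * (2 / 2 ^ J) - real n / (4 * sqrt (2 ^ J * L n))) \<le> \<alpha> / real (card (dims n))"
      using n0 by blast
    define D where "D = (2::nat) ^ J"
    define E where "E = ((real n)\<^sup>2 / L n) powr b"
    have D: "real D = 2 ^ J" "D = r * 2 ^ (J - (m + 1))"
    proof -
      show "real D = 2 ^ J" by (simp add: D_def)
      show "D = r * 2 ^ (J - (m + 1))" unfolding D_def r_def power_add[symmetric] using LJ(2) by simp
    qed
    have D0: "0 < real D" by (simp add: D_def)
    have DE: "real D \<le> E" "E \<le> 2 * real D" using LJ by (auto simp: D(1) E_def)
    have E0: "0 < E" using DE D0 by linarith
    have rate: "sqrt (E * L n) / real n = \<rho> n" "E powr (- (2 * s)) = \<rho> n"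
      unfolding E_def b_def \<rho>_def using rate_identities[of s "L n" "real n"] \<open>0 < s\<close> L_pos[OF n] n by auto
    define \<Delta> where "\<Delta> = real D * (\<Sum>k<D. (LINT y:{real k / real D..(real k + 1) / real D}|lborel. f y - 1)\<^sup>2)"
    have "(norm2 (\<lambda>x. f x - f0 x))\<^sup>2 \<le> A * \<Delta> + B * real D powr (- (2 * s))"
      unfolding dist(1) A_def B_def \<Delta>_def r_def m_def
      by (rule hoelder_distance_le_binned_energy[OF hol prob_density_measurable[OF f], where N = "2 ^ (J - (m + 1))"])
        (use \<open>0 < R\<close> D(2) in \<open>auto simp: r_def m_def\<close>)
    also have "real D powr (- (2 * s)) \<le> 2 powr (2 * s) * \<rho> n"
    proof -
      have "real D powr (- (2 * s)) \<le> (E / 2) powr (- (2 * s))"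
        using DE E0 \<open>0 < s\<close> by (intro powr_mono2') auto
      also have "\<dots> = 2 powr (2 * s) * \<rho> n"
        using E0 by (simp add: powr_divide rate(2)[symmetric] powr_minus_divide)
      finally show ?thesis .
    qed
    finally have "(norm2 (\<lambda>x. f x - f0 x))\<^sup>2 \<le> A * \<Delta> + B * (2 powr (2 * s) * \<rho> n)"
      using B0 by (simp add: mult_left_mono)
    moreover have "A * C1 * \<rho> n + B * (2 powr (2 * s) * \<rho> n) \<le> C * \<rho> n"
    proof -
      have "0 \<le> M * (\<Sum>n\<in>{16..<n0}. 1 / \<rho> n) * \<rho> n"
        using \<open>0 < M\<close> sum_nonneg \<rho>_pos[OF n] by (intro mult_nonneg_nonneg) auto
      then show ?thesis unfolding C_def by (simp add: algebra_simps)
    qed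
    ultimately have "A * (C1 * \<rho> n) \<le> A * \<Delta>" using far by (simp add: mult.assoc)
    then have "C1 * \<rho> n \<le> \<Delta>" using A0 by simp
    moreover have "C1 * (sqrt (real D * L n) / real n) \<le> C1 * \<rho> n"
      unfolding rate(1)[symmetric] using DE L_pos[OF n] C1
      by (intro mult_left_mono divide_right_mono real_sqrt_le_mono mult_right_mono) auto
    ultimately have sep: "C1 * (sqrt (real D * L n) / real n) \<le> \<Delta>" by linarith
    show ?thesis unfolding f0
    proof (rule type_two_error[where D = D and M = M])
      show "1 \<le> ln (ln (real n))" "D \<in> dims n" "256 * ln (ln (real n)) \<le> real D"
        "exp (- 3 * ln (ln (real n))) + real n * exp (real n * (2 / real D)
            - real n / (4 * sqrt (real D * ln (ln (real n))))) \<le> \<alpha> / real (card (dims n))"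
        using LJ unfolding D(1) L_def by (simp_all add: D_def)
      show "(44 + 160 * M / \<beta>) * (sqrt (real D * ln (ln (real n))) / real n)
          \<le> real D * (\<Sum>k<D. (LINT y:{real k / real D..(real k + 1) / real D}|lborel. f y - 1)\<^sup>2)"
        using sep unfolding C1_def L_def \<Delta>_def .
    qed (use n assms(1-3) f supp' bdd in auto)
  qed
  ultimately show ?thesis unfolding \<rho>_def L_def by blast
qed

end
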